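(* For each integer $n\ge 3$, let $G_n$ be the random bipartite graph with $n$ vertices in each of its two partite sets, in which every pair consisting of one vertex from each partite set is an edge independently with probability $p=1/\log n$, and let $g=g(G_n)$ be the Euler genus of $G_n$. Then there is a constant $c_1>0$ such that, with probability tending to $1$ as $n\to\infty$, $$\mathrm{box}(G_n)\ge \frac{c_1}{2}\sqrt{g\log g}.$$
   Context: Graphs are finite and simple. A $d$-box is a Cartesian product $[x_1,y_1]\times\cdots\times[x_d,y_d]$ of $d$ closed intervals of the real line. The boxicity $\mathrm{box}(G)$ of a graph $G$ is the smallest integer $d\ge 1$ such that $G$ is the intersection graph of a collection of $d$-boxes, i.e. one can assign to each vertex $v$ a $d$-box $B_v$ such that two distinct vertices $u,v$ are adjacent if and only if $B_u\cap B_v\neq\emptyset$ (distinct vertices may be assigned the same box). A surface is a non-null compact connected $2$-manifold without boundary. The orientable surface of genus $h\ge 0$ is obtained by adding $h$ handles to the sphere; the non-orientable surface of genus $k\ge 1$ is obtained by adding $k$ cross-caps to the sphere. The Euler genus of a surface is twice its genus if it is orientable, and its non-orientable genus otherwise. The Euler genus of a graph is the minimum Euler genus of a surface in which it embeds. The logarithm is natural, and $0\log 0=0$. *)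

theory Defs
  imports "HOL-Analysis.Analysis" "HOL-Probability.Probability"
begin

section \<open>Graphs and boxicity\<close>

text \<open>A graph is a pair \<open>(V, E)\<close> of a vertex set and a set of edges, each edge being the
  two-element set of its ends.\<close>

type_synonym 'v graph = "'v set \<times> 'v set set"

fun finite_simple_graph :: "'v graph \<Rightarrow> bool" where
  "finite_simple_graph (V, E) \<longleftrightarrow> finite V \<and> (\<forall>e\<in>E. e \<subseteq> V \<and> card e = 2)"

text \<open>The intervals are nonempty, and points of \<open>\<real>\<^sup>d\<close> are the extensional functions on
  \<open>{..<d}\<close>, since \<open>d\<close> varies inside the definition of boxicity.\<close>

definition is_box :: "nat \<Rightarrow> (nat \<Rightarrow> real) set \<Rightarrow> bool" where
  "is_box d B \<longleftrightarrow> (\<exists>x y. (\<forall>i<d. x i \<le> y i) \<and> B = (\<Pi>\<^sub>E i\<in>{..<d}. {x i..y i}))"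

fun has_box_representation :: "nat \<Rightarrow> 'v graph \<Rightarrow> bool" where
  "has_box_representation d (V, E) \<longleftrightarrow>
     (\<exists>B. (\<forall>v\<in>V. is_box d (B v)) \<and>
          (\<forall>u\<in>V. \<forall>v\<in>V. u \<noteq> v \<longrightarrow> ({u, v} \<in> E \<longleftrightarrow> B u \<inter> B v \<noteq> {})))"

definition boxicity :: "'v graph \<Rightarrow> nat" where
  "boxicity G = (LEAST d. 1 \<le> d \<and> has_box_representation d G)"


section \<open>Surfaces\<close>

text \<open>Second countability is not listed because it follows from compactness and the local
  condition.\<close>

definition surface :: "'a topology \<Rightarrow> bool" where
  "surface X \<longleftrightarrow>
     topspace X \<noteq> {} \<and> compact_space X \<and> connected_space X \<and> Hausdorff_space X \<and>
     (\<forall>x\<in>topspace X. \<exists>U (W :: (real ^ 2) set).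
        openin X U \<and> x \<in> U \<and> open W \<and> subtopology X U homeomorphic_space top_of_set W)"

abbreviation unit_sphere :: "(real ^ 3) set" where
  "unit_sphere \<equiv> sphere 0 1"

definition cap :: "real ^ 3 \<Rightarrow> real \<Rightarrow> (real ^ 3) set" where
  "cap a r = unit_sphere \<inter> cball a r"

definition open_cap :: "real ^ 3 \<Rightarrow> real \<Rightarrow> (real ^ 3) set" where
  "open_cap a r = unit_sphere \<inter> ball a r"

definition cap_boundary :: "real ^ 3 \<Rightarrow> real \<Rightarrow> (real ^ 3) set" where
  "cap_boundary a r = unit_sphere \<inter> sphere a r"

text \<open>\<open>swap_reflection a b\<close> is the reflection in the perpendicular bisector plane of \<open>a\<close> and \<open>b\<close>.
  For unit vectors it maps the cap around \<open>a\<close> onto the cap of the same radius around \<open>b\<close> and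
  reverses the orientation of the sphere; hence identifying the two boundary circles along it,
  after removing the open caps, adds a handle. (An orientation preserving map would give a
  Klein bottle handle instead.)

  \<open>half_turn a\<close> is the rotation by \<open>\<pi>\<close> about the axis through the unit vector \<open>a\<close>; on the
  boundary circle of a cap around \<open>a\<close> it is the antipodal map.\<close>

definition swap_reflection :: "real ^ 3 \<Rightarrow> real ^ 3 \<Rightarrow> real ^ 3 \<Rightarrow> real ^ 3" where
  "swap_reflection a b x = x - (2 * (x \<bullet> (a - b)) / ((a - b) \<bullet> (a - b))) *\<^sub>R (a - b)"

definition half_turn :: "real ^ 3 \<Rightarrow> real ^ 3 \<Rightarrow> real ^ 3" where
  "half_turn a x = (2 * (x \<bullet> a)) *\<^sub>R a - x"

text \<open>\<open>X\<close> arises from the subspace \<open>M\<close> by identifying exactly the pairs of points related by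
  \<open>R\<close>; \<open>X\<close> is determined up to homeomorphism. In the uses below \<open>R\<close>, together with
  equality and its converse, is an equivalence relation.\<close>

definition glued :: "'a::topological_space set \<Rightarrow> ('a \<Rightarrow> 'a \<Rightarrow> bool) \<Rightarrow> 'b topology \<Rightarrow> bool" where
  "glued M R X \<longleftrightarrow>
     (\<exists>q. quotient_map (top_of_set M) X q \<and>
          (\<forall>x\<in>M. \<forall>y\<in>M. q x = q y \<longleftrightarrow> x = y \<or> R x y \<or> R y x))"

definition sphere_with_handles :: "nat \<Rightarrow> 'b topology \<Rightarrow> bool" where
  "sphere_with_handles h X \<longleftrightarrow>
     (\<exists>a b r.
        (\<forall>i<h. a i \<in> unit_sphere \<and> b i \<in> unit_sphere \<and> 0 < r i \<and>
               cap (a i) (r i) \<inter> cap (b i) (r i) = {}) \<and>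
        disjoint_family_on (\<lambda>i. cap (a i) (r i) \<union> cap (b i) (r i)) {..<h} \<and>
        glued (unit_sphere - (\<Union>i<h. open_cap (a i) (r i) \<union> open_cap (b i) (r i)))
          (\<lambda>x y. \<exists>i<h. x \<in> cap_boundary (a i) (r i) \<and> y = swap_reflection (a i) (b i) x) X)"

text \<open>The bound \<open>r i < 2\<close> makes each cap a disc, not the whole sphere; for handles this follows
  from disjointness.\<close>

definition sphere_with_crosscaps :: "nat \<Rightarrow> 'b topology \<Rightarrow> bool" where
  "sphere_with_crosscaps k X \<longleftrightarrow>
     (\<exists>a r.
        (\<forall>i<k. a i \<in> unit_sphere \<and> 0 < r i \<and> r i < 2) \<and>
        disjoint_family_on (\<lambda>i. cap (a i) (r i)) {..<k} \<and>
        glued (unit_sphere - (\<Union>i<k. open_cap (a i) (r i)))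
          (\<lambda>x y. \<exists>i<k. x \<in> cap_boundary (a i) (r i) \<and> y = half_turn (a i) x) X)"

definition surface_of_Euler_genus :: "nat \<Rightarrow> 'b topology \<Rightarrow> bool" where
  "surface_of_Euler_genus g X \<longleftrightarrow>
     surface X \<and>
     ((\<exists>h. g = 2 * h \<and> sphere_with_handles h X) \<or> (1 \<le> g \<and> sphere_with_crosscaps g X))"


section \<open>Euler genus of a graph\<close>

text \<open>Vertices are sent to distinct points and edges to simple arcs joining their ends; the
  interior of an arc meets neither a vertex nor the interior of another arc.\<close>

fun embeds_in :: "'v graph \<Rightarrow> 'b topology \<Rightarrow> bool" where
  "embeds_in (V, E) X \<longleftrightarrow>
     (\<exists>(\<phi> :: 'v \<Rightarrow> 'b) (\<gamma> :: 'v set \<Rightarrow> real \<Rightarrow> 'b).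
        \<phi> ` V \<subseteq> topspace X \<and> inj_on \<phi> V \<and>
        (\<forall>e\<in>E. pathin X (\<gamma> e) \<and> inj_on (\<gamma> e) {0..1} \<and>
                {\<gamma> e 0, \<gamma> e 1} = \<phi> ` e \<and> \<gamma> e ` {0<..<1} \<inter> \<phi> ` V = {}) \<and>
        (\<forall>e\<in>E. \<forall>f\<in>E. e \<noteq> f \<longrightarrow> \<gamma> e ` {0<..<1} \<inter> \<gamma> f ` {0<..<1} = {}))"

text \<open>The type \<open>real ^ 3\<close> only supplies the points of \<open>X\<close>, whose topology is arbitrary: every
  surface has the cardinality of the continuum, so it is homeomorphic to a topology on a set of
  elements of this type.\<close>

definition Euler_genus :: "'v graph \<Rightarrow> nat" where
  "Euler_genus G =
     (LEAST g. \<exists>X :: (real ^ 3) topology. surface_of_Euler_genus g X \<and> embeds_in G X)"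


section \<open>The random bipartite graph\<close>

definition bipartite_graph :: "nat \<Rightarrow> (nat \<times> nat \<Rightarrow> bool) \<Rightarrow> (nat + nat) graph" where
  "bipartite_graph n f =
     ({..<n} <+> {..<n}, {{Inl i, Inr j} | i j. i < n \<and> j < n \<and> f (i, j)})"

definition random_bipartite_graph :: "nat \<Rightarrow> real \<Rightarrow> (nat + nat) graph pmf" where
  "random_bipartite_graph n p =
     map_pmf (bipartite_graph n) (Pi_pmf ({..<n} \<times> {..<n}) False (\<lambda>_. bernoulli_pmf p))"

lemma finite_simple_graph_random_bipartite_graph:
  assumes "G \<in> set_pmf (random_bipartite_graph n p)"
  shows "finite_simple_graph G"
  using assms
  by (auto simp: random_bipartite_graph_def bipartite_graph_def card_insert_if)

end

theory Submission
  imports Defs "HOL-Real_Asymp.Real_Asymp"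
begin

text \<open>The Euler genus of a graph is at most twice its number of edges, since every edge can be
  routed through a handle of its own; hence \<open>g \<le> 8 n\<^sup>2 / log n\<close> and \<open>sqrt (g log g) \<le> 4 n\<close> with
  high probability, and it remains to show that the boxicity is at least linear in \<open>n\<close>.

  A box representation in dimension \<open>d\<close> covers the non-edges between the two sides by \<open>2 d\<close>
  staircases (two for each coordinate, according to which of two disjoint intervals lies on the
  left). With high probability there is no empty \<open>K \<times> K\<close> rectangle for \<open>K \<approx> 4 log\<^sup>2 n\<close>, so a
  staircase is determined by the first \<open>K\<close> vertices of each side in its order, and only
  \<open>n ^ (2 K)\<close> possibilities need to be considered for each of them. Fix \<open>m \<le> n / 52\<close> such
  staircases. A pair \<open>(i, j)\<close> is not covered if it is a non-edge and each list containing \<open>i\<close> has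
  an earlier entry adjacent to \<open>j\<close>, and vice versa. The entry number \<open>s + 1\<close> of a list is blocked
  with probability \<open>1 - (1 - p) ^ s\<close>, and as \<open>- log (1 - (1 - p) ^ s)\<close> sums up to \<open>O(log n)\<close> over
  \<open>s \<ge> 1\<close>, Harris' inequality shows that each of at least \<open>n\<^sup>2 / 4\<close> pairs is uncovered with probability
  at least \<open>n powr (- 1 / 4) / 2\<close>. Among these pairs there are \<open>n\<^sup>2\<close> up to logarithmic factors
  whose events are independent, so the \<open>m\<close> staircases cover all non-edges with probability
  \<open>exp (- n powr (7 / 4 - o(1)))\<close>, which beats the number of choices.\<close>

section \<open>Spheres with handles are surfaces\<close>

text \<open>Only an upper bound on the genus is needed, but \<open>Euler_genus\<close> is a least
  number over topologies, so a witness must be proved to be a compact connected Hausdorff space with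
  planar charts. This shapes the topological half: all caps share one small radius, and their
  centres are so far apart that every gluing circle has a collar of its own, on which a chart can be
  written down.

  The obstacle in the probabilistic half is that a vertex occurring in many lists would tie together
  the events of many pairs. At most \<open>m\<close> vertices of a side occur in more than
  \<open>K\<close> lists; they are given up both as vertices and as blockers, which only makes the
  event to be estimated smaller.

  The constants come from one budget. A vertex may spend \<open>T = log n / 8\<close> on its
  blocking probabilities, so the two ends of a pair cost a factor \<open>exp (- 2 * T)\<close>,
  which is the power -1/4 of \<open>n\<close>. On each side \<open>2 * m\<close> vertices are lost
  for being popular or lacking blockers, and \<open>m * (3 * log n) / T = 24 * m\<close> for
  exceeding the budget. Half of the vertices survive if \<open>26 * m\<close> is at most
  \<open>n / 2\<close>, whence 52.\<close>

lemma swap_reflection_diff: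
  "swap_reflection a b x - swap_reflection a b y = swap_reflection a b (x - y)"
proof -
  define d where "d = a - b"
  show ?thesis
    unfolding swap_reflection_def d_def[symmetric]
    by (simp add: inner_diff_left right_diff_distrib diff_divide_distrib scaleR_left_diff_distrib)
qed

lemma norm_swap_reflection:
  assumes "a \<noteq> b" shows "norm (swap_reflection a b x) = norm x"
proof -
  define d where "d = a - b"
  have d: "d \<bullet> d \<noteq> 0" using assms by (simp add: d_def)
  have "swap_reflection a b x \<bullet> swap_reflection a b x = x \<bullet> x"
    unfolding swap_reflection_def d_def[symmetric]
    using d by (simp add: inner_diff_left inner_diff_right inner_commute field_simps power2_eq_square)
  then show ?thesis by (simp add: norm_eq_sqrt_inner)
qed

lemma dist_swap_reflection:
  "a \<noteq> b \<Longrightarrow> dist (swap_reflection a b x) (swap_reflection a b y) = dist x y"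
  by (simp add: dist_norm swap_reflection_diff norm_swap_reflection)

lemma swap_reflection_swap_reflection:
  assumes "a \<noteq> b" shows "swap_reflection a b (swap_reflection a b x) = x"
proof -
  define d where "d = a - b"
  have d: "d \<bullet> d \<noteq> 0" using assms by (simp add: d_def)
  show ?thesis
    unfolding swap_reflection_def d_def[symmetric]
    using d by (simp add: inner_diff_left inner_diff_right inner_commute field_simps)
qed

lemma swap_reflection_left:
  assumes "norm a = norm b" "a \<noteq> b" shows "swap_reflection a b a = b"
proof -
  define d where "d = a - b"
  have d: "d \<bullet> d \<noteq> 0" using assms by (simp add: d_def)
  have "a \<bullet> a = b \<bullet> b" using assms by (simp add: norm_eq_sqrt_inner)
  then have "2 * (a \<bullet> d) = d \<bullet> d"
    by (simp add: d_def inner_diff_left inner_diff_right inner_commute)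
  then have "2 * (a \<bullet> d) / (d \<bullet> d) = 1" using d by (metis divide_self)
  then show ?thesis
    unfolding swap_reflection_def d_def[symmetric] using d_def by (metis scaleR_one diff_diff_eq2 add_diff_cancel_left')
qed

lemma swap_reflection_right:
  assumes "norm a = norm b" "a \<noteq> b" shows "swap_reflection a b b = a"
  by (metis assms swap_reflection_left swap_reflection_swap_reflection)

lemma continuous_on_swap_reflection: "continuous_on S (swap_reflection a b)"
  unfolding swap_reflection_def by (cases "a = b") (auto intro!: continuous_intros)

section \<open>Inversion of the unit sphere in a circle\<close>

lemma dist_unit_vectors:
  fixes x y :: "'a::real_inner"
  assumes "norm x = 1" "norm y = 1"
  shows "(dist x y)\<^sup>2 = 2 - 2 * (x \<bullet> y)"
proof -
  have "x \<bullet> x = 1" "y \<bullet> y = 1" using assms by (simp_all add: dot_square_norm)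
  then show ?thesis
    by (simp add: dist_norm power2_norm_eq_inner inner_diff_left inner_diff_right inner_commute)
qed

text \<open>The inversion in the sphere that meets the unit sphere orthogonally in the circle
  at distance \<open>r\<close> from \<open>a\<close>; its centre is \<open>a /\<^sub>R t\<close>, where \<open>t = 1 - r\<^sup>2 / 2\<close> is the height
  of the plane of the circle. It maps the unit sphere to itself and exchanges the two
  sides of the circle.\<close>

definition circle_inversion :: "'a::real_inner \<Rightarrow> real \<Rightarrow> 'a \<Rightarrow> 'a" where
  "circle_inversion a r y = (let t = 1 - r\<^sup>2 / 2 in
     a /\<^sub>R t + ((1 - t\<^sup>2) / (1 + t\<^sup>2 - 2 * t * (y \<bullet> a))) *\<^sub>R (y - a /\<^sub>R t))"

context
  fixes a :: "'a::real_inner" and r t :: real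
  assumes a: "norm a = 1" and r: "0 < r" "r < 1" and t_def: "t = 1 - r\<^sup>2 / 2"
begin

lemma circle_height: "0 < t" "t < 1" "t\<^sup>2 < 1"
proof -
  have "r\<^sup>2 < 1" using r by (simp add: power_less_one_iff)
  then show 1: "0 < t" "t < 1" using r by (auto simp: t_def)
  then show "t\<^sup>2 < 1" by (simp add: power_less_one_iff)
qed

text \<open>The denominator is \<open>t\<^sup>2\<close> times the squared distance from
  \<open>y\<close> to the centre \<open>a /\<^sub>R t\<close>, and the centre lies outside the unit
  sphere because \<open>t < 1\<close>.\<close>

lemma circle_inversion_denom:
  assumes "norm y = 1" shows "0 < 1 + t\<^sup>2 - 2 * t * (y \<bullet> a)"
proof -
  have "y \<bullet> a \<le> 1" using norm_cauchy_schwarz[of y a] assms a by simp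
  then have "t * (y \<bullet> a) \<le> t * 1" using circle_height by (intro mult_left_mono) auto
  moreover have "0 < (1 - t)\<^sup>2" using circle_height by simp
  ultimately show ?thesis by (simp add: power2_eq_square algebra_simps)
qed

text \<open>The signed height over the plane of the circle is multiplied by a negative factor; this
  is why the two sides of the circle are exchanged.\<close>

lemma circle_inversion_inner:
  assumes "norm y = 1"
  shows "circle_inversion a r y \<bullet> a
    = t + (1 - t\<^sup>2) / (1 + t\<^sup>2 - 2 * t * (y \<bullet> a)) * (t - y \<bullet> a)"
proof -
  define D where "D = 1 + t\<^sup>2 - 2 * t * (y \<bullet> a)"
  have D: "D \<noteq> 0" using circle_inversion_denom[OF assms] by (simp add: D_def)
  have aa: "a \<bullet> a = 1" using a by (simp add: dot_square_norm)
  have t: "t \<noteq> 0" using circle_height by simp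
  define k where "k = (1 - t\<^sup>2) / D"
  define u where "u = inverse t"
  have ut: "u * t = 1" using t by (simp add: u_def)
  have kD: "k * D = 1 - t\<^sup>2" using D by (simp add: k_def)
  have "circle_inversion a r y \<bullet> a = u + k * (y \<bullet> a - u)"
    by (simp add: circle_inversion_def Let_def t_def[symmetric] D_def[symmetric] k_def
        u_def inner_add_left inner_diff_left aa)
  also have "\<dots> = t + k * (t - y \<bullet> a)"
    using kD ut unfolding D_def by algebra
  finally show ?thesis by (simp add: D_def k_def)
qed

text \<open>The centre has power \<open>1 / t\<^sup>2 - 1\<close> with respect to the unit sphere,
  which is also the squared radius of the inversion, so the two spheres are orthogonal. In
  coordinates this is a polynomial consequence of \<open>k * D = 1 - t\<^sup>2\<close> and
  \<open>u * t = 1\<close>.\<close>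

lemma norm_circle_inversion:
  assumes "norm y = 1" shows "norm (circle_inversion a r y) = 1"
proof -
  define D where "D = 1 + t\<^sup>2 - 2 * t * (y \<bullet> a)"
  define k where "k = (1 - t\<^sup>2) / D"
  have D: "D \<noteq> 0" using circle_inversion_denom[OF assms] by (simp add: D_def)
  have aa: "a \<bullet> a = 1" "y \<bullet> y = 1" using a assms by (simp_all add: dot_square_norm)
  have t: "t \<noteq> 0" using circle_height by simp
  have kD: "k * D = 1 - t\<^sup>2" using D by (simp add: k_def)
  have e: "circle_inversion a r y = inverse t *\<^sub>R a + k *\<^sub>R (y - inverse t *\<^sub>R a)"
    by (simp add: circle_inversion_def Let_def t_def[symmetric] D_def k_def)
  define u where "u = inverse t"
  have ut: "u * t = 1" using t by (simp add: u_def)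
  have "circle_inversion a r y \<bullet> circle_inversion a r y
     = u\<^sup>2 + 2 * k * (u * (y \<bullet> a) - u\<^sup>2) + k\<^sup>2 * (1 - 2 * u * (y \<bullet> a) + u\<^sup>2)"
    unfolding e u_def[symmetric]
    by (simp add: inner_add_left inner_add_right inner_diff_left inner_diff_right aa
        inner_commute power2_eq_square algebra_simps)
  also have "\<dots> = 1"
    using kD ut unfolding D_def by algebra
  finally show ?thesis by (simp add: norm_eq_sqrt_inner)
qed

lemma circle_inversion_circle_inversion:
  assumes "norm y = 1" shows "circle_inversion a r (circle_inversion a r y) = y"
proof -
  define D where "D = 1 + t\<^sup>2 - 2 * t * (y \<bullet> a)"
  define k where "k = (1 - t\<^sup>2) / D"
  have D: "D \<noteq> 0" using circle_inversion_denom[OF assms] by (simp add: D_def)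
  have k: "k \<noteq> 0" using circle_height D by (simp add: k_def)
  define y' where "y' = circle_inversion a r y"
  define D' where "D' = 1 + t\<^sup>2 - 2 * t * (y' \<bullet> a)"
  have D': "D' \<noteq> 0"
    using circle_inversion_denom[OF norm_circle_inversion[OF assms]] by (simp add: D'_def y'_def)
  have kD: "k * D = 1 - t\<^sup>2" using D by (simp add: k_def)
  have "y' \<bullet> a = t + k * (t - y \<bullet> a)"
    unfolding y'_def circle_inversion_inner[OF assms] k_def D_def by simp
  \<comment> \<open>Vectors from the centre are scaled by \<open>k\<close>, so \<open>D'\<close> is
    \<open>k\<^sup>2 * D\<close>, and the second inversion scales by \<open>1 / k\<close>.\<close>
  then have "D' = k * (1 - t\<^sup>2)"
    using kD unfolding D'_def D_def by algebra
  then have "k * ((1 - t\<^sup>2) / D') = 1" using k D' by auto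
  then have kk: "(1 - t\<^sup>2) / D' = 1 / k" using k by (simp add: field_simps)
  have e: "y' = a /\<^sub>R t + k *\<^sub>R (y - a /\<^sub>R t)"
    by (simp add: y'_def circle_inversion_def Let_def t_def[symmetric] D_def k_def)
  have "circle_inversion a r y' = a /\<^sub>R t + (1 / k) *\<^sub>R (y' - a /\<^sub>R t)"
    unfolding circle_inversion_def Let_def t_def[symmetric] D'_def[symmetric] kk ..
  also have "\<dots> = y" unfolding e using k by simp
  finally show ?thesis by (simp add: y'_def)
qed

lemma dist_less_iff_inner:
  assumes "norm y = 1"
  shows "dist y a < r \<longleftrightarrow> t < y \<bullet> a" "dist y a = r \<longleftrightarrow> t = y \<bullet> a"
proof -
  have "dist y a < r \<longleftrightarrow> (dist y a)\<^sup>2 < r\<^sup>2"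
    using r power_strict_mono[of "dist y a" r 2] power2_less_imp_less[of "dist y a" r] by auto
  then show "dist y a < r \<longleftrightarrow> t < y \<bullet> a"
    unfolding dist_unit_vectors[OF assms a] t_def by auto
  have "dist y a = r \<longleftrightarrow> (dist y a)\<^sup>2 = r\<^sup>2"
    using r by (simp add: power2_eq_iff_nonneg)
  then show "dist y a = r \<longleftrightarrow> t = y \<bullet> a"
    unfolding dist_unit_vectors[OF assms a] t_def by auto
qed

lemma dist_circle_inversion:
  assumes "norm y = 1"
  shows "dist (circle_inversion a r y) a < r \<longleftrightarrow> r < dist y a"
    and "r < dist (circle_inversion a r y) a \<longleftrightarrow> dist y a < r"
proof -
  define k where "k = (1 - t\<^sup>2) / (1 + t\<^sup>2 - 2 * t * (y \<bullet> a))"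
  have k: "0 < k"
    using circle_inversion_denom[OF assms] circle_height by (simp add: k_def)
  have n: "norm (circle_inversion a r y) = 1" by (rule norm_circle_inversion[OF assms])
  have e: "circle_inversion a r y \<bullet> a = t + k * (t - y \<bullet> a)"
    unfolding circle_inversion_inner[OF assms] k_def ..
  have "t < circle_inversion a r y \<bullet> a \<longleftrightarrow> y \<bullet> a < t"
    using k unfolding e by (simp add: zero_less_mult_iff)
  moreover have "circle_inversion a r y \<bullet> a = t \<longleftrightarrow> y \<bullet> a = t"
    using k unfolding e by auto
  ultimately show "dist (circle_inversion a r y) a < r \<longleftrightarrow> r < dist y a"
    and "r < dist (circle_inversion a r y) a \<longleftrightarrow> dist y a < r"
    using dist_less_iff_inner[OF assms] dist_less_iff_inner[OF n] by linarith+
qed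

lemma circle_inversion_fixed:
  assumes "norm y = 1" "dist y a = r" shows "circle_inversion a r y = y"
proof -
  have ya: "y \<bullet> a = t" using dist_less_iff_inner(2)[OF assms(1)] assms(2) by simp
  have "1 - t\<^sup>2 \<noteq> 0" using circle_height by simp
  then have "(1 - t\<^sup>2) / (1 + t\<^sup>2 - 2 * t * (y \<bullet> a)) = 1"
    unfolding ya by (simp add: power2_eq_square)
  then show ?thesis
    unfolding circle_inversion_def Let_def t_def[symmetric] by simp
qed

lemma continuous_on_circle_inversion: "continuous_on (sphere 0 1) (circle_inversion a r)"
proof -
  have "1 + t\<^sup>2 - 2 * t * (y \<bullet> a) \<noteq> 0" if "y \<in> sphere 0 1" for y
    using circle_inversion_denom[of y] that by force
  then show ?thesis
    unfolding circle_inversion_def Let_def t_def[symmetric]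
    by (intro continuous_intros) blast
qed

end

section \<open>Connectedness of the sphere without caps\<close>

lemma path_connected_cap_boundary:
  assumes a: "norm a = 1" and r: "0 < r" "r < 1"
  shows "path_connected (cap_boundary a r)" "cap_boundary a r \<noteq> {}"
proof -
  define t where "t = 1 - r\<^sup>2 / 2"
  have t: "0 < t" "t < 1" using circle_height[OF a r t_def] by auto
  have a0: "a \<noteq> 0" using a by auto
  define U where "U = {x. a \<bullet> x = t}"
  have U: "affine U" "aff_dim U = 2"
    using aff_dim_hyperplane[of a t] a0 by (simp_all add: U_def affine_hyperplane)
  have "a \<bullet> a = 1" using a by (simp add: dot_square_norm)
  then have tU: "t *\<^sub>R a \<in> ball 0 1 \<inter> U" using t a by (simp add: U_def)
  then have ne: "interior (cball 0 1) \<inter> U \<noteq> {}" by (metis interior_cball empty_iff)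
  \<comment> \<open>The circle is the relative frontier of the flat disc that the plane at height
    \<open>t\<close> cuts out of the unit ball. The disc has dimension two, so its relative frontier
    is path connected; it is nonempty because a bounded affine set is at most a point.\<close>
  have "rel_frontier (cball 0 1 \<inter> U) = frontier (cball 0 1) \<inter> U"
    by (rule convex_affine_rel_frontier_Int) (use U ne in auto)
  also have "\<dots> = cap_boundary a r"
    using dist_less_iff_inner(2)[OF a r t_def]
    by (auto simp: cap_boundary_def U_def dist_commute inner_commute)
  finally have e: "rel_frontier (cball 0 1 \<inter> U) = cap_boundary a r" .
  have "affine hull (U \<inter> cball 0 1) = affine hull U"
    using U ne by (intro affine_hull_convex_Int_nonempty_interior affine_imp_convex) auto
  then have d: "aff_dim (cball 0 1 \<inter> U) = 2"
    using U by (metis aff_dim_affine_hull inf_commute)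
  have c: "convex (cball 0 1 \<inter> U)" "bounded (cball 0 1 \<inter> U)"
    using U affine_imp_convex by (auto intro!: convex_Int)
  show "path_connected (cap_boundary a r)"
    using path_connected_sphere_gen[OF c] d e by simp
  show "cap_boundary a r \<noteq> {}"
  proof
    assume "cap_boundary a r = {}"
    then have "affine (cball 0 1 \<inter> U)" using e rel_frontier_eq_empty by metis
    then have "cball 0 1 \<inter> U = {} \<or> (\<exists>x. cball 0 1 \<inter> U = {x})"
      using affine_bounded_eq_trivial c(2) by blast
    then show False using d by (metis aff_dim_empty aff_dim_sing zero_neq_numeral
      neg_one_neq_numeral)
  qed
qed

text \<open>The connected boundary lies on one side of any separation of \<open>T - D\<close>, so \<open>D\<close> can be added
  to that side.\<close>

lemma connected_Diff_connected_boundary: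
  fixes T :: "'a::topological_space set"
  assumes T: "connected T" "closed T" and C: "closed C" "C \<subseteq> T"
    and D: "D \<subseteq> C" and TD: "closed (T - D)" and F: "connected (C - D)" "C - D \<noteq> {}"
  shows "connected (T - D)"
  unfolding connected_closed
proof (rule notI, elim exE conjE)
  fix A B assume A: "closed A" and B: "closed B" and cov: "T - D \<subseteq> A \<union> B"
    and dis: "A \<inter> B \<inter> (T - D) = {}" and Ane: "A \<inter> (T - D) \<noteq> {}" and Bne: "B \<inter> (T - D) \<noteq> {}"
  have *: False if A: "closed A" and B: "closed B" and cov: "T - D \<subseteq> A \<union> B"
    and dis: "A \<inter> B \<inter> (T - D) = {}" and Ane: "A \<inter> (T - D) \<noteq> {}" and Bne: "B \<inter> (T - D) \<noteq> {}"
    and FA: "B \<inter> (C - D) = {}" for A B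
  proof -
    have 1: "closed ((A \<inter> (T - D)) \<union> C)" "closed (B \<inter> (T - D))"
      using A B TD C by auto
    have "T \<subseteq> ((A \<inter> (T - D)) \<union> C) \<union> (B \<inter> (T - D))" using cov D by auto
    moreover have "((A \<inter> (T - D)) \<union> C) \<inter> (B \<inter> (T - D)) \<inter> T = {}" using dis FA by auto
    moreover have "((A \<inter> (T - D)) \<union> C) \<inter> T \<noteq> {}" "(B \<inter> (T - D)) \<inter> T \<noteq> {}" using Ane Bne by auto
    ultimately show False using T(1) 1 unfolding connected_closed by blast
  qed
  have "C - D \<subseteq> A \<union> B" "A \<inter> B \<inter> (C - D) = {}" using cov dis C by auto
  then have "A \<inter> (C - D) = {} \<or> B \<inter> (C - D) = {}"
    using F A B unfolding connected_closed by blast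
  then show False using *[OF A B cov dis Ane Bne] *[of B A] A B cov dis Ane Bne by blast
qed


text \<open>The caps are removed one at a time. Centres more than \<open>2 * r\<close> apart keep
  the next closed cap inside the part that is left, and its boundary circle is the connected set on
  which the removal relies.\<close>

lemma connected_sphere_Diff_caps:
  assumes "finite C" "\<And>c. c \<in> C \<Longrightarrow> norm c = 1" "0 < r" "r < 1"
    and "\<And>c d. c \<in> C \<Longrightarrow> d \<in> C \<Longrightarrow> c \<noteq> d \<Longrightarrow> 2 * r < dist c d"
  shows "connected (unit_sphere - (\<Union>c\<in>C. open_cap c r))"
  using assms(1,2,5)
proof (induction C)
  case empty
  show ?case by (simp add: connected_sphere)
next
  case (insert c C)
  define T where "T = unit_sphere - (\<Union>c\<in>C. open_cap c r)"
  have T_eq: "T = unit_sphere - (\<Union>c\<in>C. ball c r)" by (auto simp: T_def open_cap_def)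
  have "closed T" unfolding T_eq by (intro closed_Diff) auto
  moreover have "cap c r \<subseteq> T"
  proof
    fix x assume x: "x \<in> cap c r"
    have "x \<notin> ball d r" if "d \<in> C" for d
    proof -
      have "2 * r < dist c d" using insert.prems(2)[of c d] insert.hyps(2) that by blast
      then show ?thesis using x dist_triangle[of c d x] by (auto simp: cap_def dist_commute)
    qed
    then show "x \<in> T" using x by (auto simp: T_eq cap_def)
  qed
  moreover have "cap c r - open_cap c r = cap_boundary c r"
    by (auto simp: cap_def open_cap_def cap_boundary_def)
  moreover have "closed (T - open_cap c r)"
  proof -
    have "T - open_cap c r = unit_sphere - (\<Union>c\<in>insert c C. ball c r)"
      by (auto simp: T_eq open_cap_def)
    then show ?thesis by (simp only:) (intro closed_Diff open_UN; simp)
  qed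
  moreover have "connected T"
    unfolding T_def using insert by auto
  moreover have "closed (cap c r)" "open_cap c r \<subseteq> cap c r"
    by (auto simp: cap_def open_cap_def intro!: closed_Int)
  moreover have "connected (cap_boundary c r)" "cap_boundary c r \<noteq> {}"
    using path_connected_cap_boundary[of c r] insert.prems(1)[of c] assms
    by (auto simp: path_connected_imp_connected)
  ultimately have "connected (T - open_cap c r)"
    by (intro connected_Diff_connected_boundary[of T "cap c r"]) auto
  moreover have "T - open_cap c r = unit_sphere - (\<Union>c\<in>insert c C. open_cap c r)"
    by (auto simp: T_def)
  ultimately show ?case by simp
qed

section \<open>Quotient topologies and their charts\<close>

definition quotient_space :: "'a topology \<Rightarrow> ('a \<Rightarrow> 'b) \<Rightarrow> 'b topology" where
  "quotient_space T q =
     topology (\<lambda>U. U \<subseteq> q ` topspace T \<and> openin T {x \<in> topspace T. q x \<in> U})"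

lemma openin_quotient_space:
  "openin (quotient_space T q) U \<longleftrightarrow>
     U \<subseteq> q ` topspace T \<and> openin T {x \<in> topspace T. q x \<in> U}"
proof -
  have "istopology (\<lambda>U. U \<subseteq> q ` topspace T \<and> openin T {x \<in> topspace T. q x \<in> U})"
    unfolding istopology_def
  proof (intro conjI allI impI)
    fix S U
    assume "S \<subseteq> q ` topspace T \<and> openin T {x \<in> topspace T. q x \<in> S}"
      and "U \<subseteq> q ` topspace T \<and> openin T {x \<in> topspace T. q x \<in> U}"
    moreover from this have "openin T ({x \<in> topspace T. q x \<in> S} \<inter> {x \<in> topspace T. q x \<in> U})"
      by blast
    moreover have "{x \<in> topspace T. q x \<in> S} \<inter> {x \<in> topspace T. q x \<in> U}
      = {x \<in> topspace T. q x \<in> S \<inter> U}" by auto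
    ultimately show "S \<inter> U \<subseteq> q ` topspace T" "openin T {x \<in> topspace T. q x \<in> S \<inter> U}"
      by auto
  next
    fix \<K> assume K: "\<forall>K\<in>\<K>. K \<subseteq> q ` topspace T \<and> openin T {x \<in> topspace T. q x \<in> K}"
    then show "\<Union>\<K> \<subseteq> q ` topspace T" by blast
    have "openin T (\<Union>K\<in>\<K>. {x \<in> topspace T. q x \<in> K})" using K by blast
    moreover have "(\<Union>K\<in>\<K>. {x \<in> topspace T. q x \<in> K}) = {x \<in> topspace T. q x \<in> \<Union>\<K>}" by auto
    ultimately show "openin T {x \<in> topspace T. q x \<in> \<Union>\<K>}" by simp
  qed
  then show ?thesis unfolding quotient_space_def by (simp add: topology_inverse')
qed

lemma topspace_quotient_space [simp]: "topspace (quotient_space T q) = q ` topspace T"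
proof -
  have "openin (quotient_space T q) (q ` topspace T)"
  proof -
    have "{x \<in> topspace T. q x \<in> q ` topspace T} = topspace T" by auto
    then show ?thesis by (simp add: openin_quotient_space)
  qed
  then show ?thesis
    by (metis openin_quotient_space openin_subset openin_topspace subset_antisym)
qed

lemma quotient_map_quotient_space: "quotient_map T (quotient_space T q) q"
  by (auto simp: quotient_map_def openin_quotient_space)

text \<open>As \<open>f\<close> is constant on the classes in the saturated open set
  \<open>N\<close>, it descends to the image of \<open>N\<close>, and \<open>g\<close> is the
  continuous inverse of the descended map. Charts of a glued space can thus be verified entirely on
  \<open>M\<close>, without naming points of \<open>X\<close>.\<close>

lemma homeomorphic_space_quotient_chart:
  assumes q: "quotient_map (top_of_set M) X q" and N: "openin (top_of_set M) N"
    and sat: "\<And>x y. x \<in> M \<Longrightarrow> y \<in> N \<Longrightarrow> q x = q y \<Longrightarrow> x \<in> N"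
    and f: "continuous_on N f" "\<And>x. x \<in> N \<Longrightarrow> f x \<in> W"
      "\<And>x y. x \<in> N \<Longrightarrow> y \<in> N \<Longrightarrow> q x = q y \<Longrightarrow> f x = f y"
    and g: "continuous_map (top_of_set W) X g" "\<And>x. x \<in> N \<Longrightarrow> g (f x) = q x"
    and W: "\<And>y. y \<in> W \<Longrightarrow> \<exists>x\<in>N. f x = y"
  shows "openin X (q ` N) \<and> subtopology X (q ` N) homeomorphic_space top_of_set W"
proof -
  have NM: "N \<subseteq> M" using N openin_imp_subset by blast
  have pre: "{x \<in> topspace (top_of_set M). q x \<in> q ` N} = N" using NM sat by auto
  have surj: "q ` M = topspace X" using quotient_imp_surjective_map[OF q] by simp
  then have o: "openin X (q ` N)"
  proof -
    have "q ` N \<subseteq> topspace X" using NM surj by blast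
    then have "openin (top_of_set M) {x \<in> topspace (top_of_set M). q x \<in> q ` N} \<longleftrightarrow> openin X (q ` N)"
      using q unfolding quotient_map_def by blast
    then show ?thesis using N unfolding pre by simp
  qed
  define F where "F = (\<lambda>z. f (SOME x. x \<in> N \<and> q x = z))"
  have F: "F (q x) = f x" if "x \<in> N" for x
    unfolding F_def
  proof (rule someI2[where a = x])
    show "f y = f x" if "y \<in> N \<and> q y = q x" for y
      using f(3)[of y x] that \<open>x \<in> N\<close> by blast
  qed (use that in simp)
  have "quotient_map (subtopology (top_of_set M) N) (subtopology X (q ` N)) q"
    by (rule quotient_map_restriction[OF q pre]) (use o in auto)
  then have "quotient_map (top_of_set N) (subtopology X (q ` N)) q"
    using NM by (simp add: subtopology_subtopology inf_absorb2)
  moreover have "continuous_map (top_of_set N) (top_of_set W) (F \<circ> q)"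
  proof -
    have "continuous_on N (F \<circ> q)"
      using continuous_on_cong[OF refl, of N "F \<circ> q" f] F f(1) by simp
    then show ?thesis
      using f(2) F by (simp add: continuous_map_in_subtopology image_subset_iff Pi_iff)
  qed
  ultimately have "continuous_map (subtopology X (q ` N)) (top_of_set W) F"
    by (rule continuous_compose_quotient_map)
  moreover have gW: "\<exists>x\<in>N. g y = q x \<and> f x = y" if "y \<in> W" for y
    using W[OF that] g(2) by blast
  then have "continuous_map (top_of_set W) (subtopology X (q ` N)) g"
    using g(1) by (auto simp: continuous_map_in_subtopology dest!: gW)
  moreover have "g (F z) = z" if "z \<in> q ` N" for z using that F g(2) by auto
  moreover have "F (g y) = y" if "y \<in> W" for y using gW[OF that] F by auto
  ultimately have "homeomorphic_maps (subtopology X (q ` N)) (top_of_set W) F g"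
    unfolding homeomorphic_maps_def by simp
  then show ?thesis using o unfolding homeomorphic_space_def by blast
qed

text \<open>Removing the antipode of the point under consideration leaves an open subset of a
  punctured sphere, which is homeomorphic to the plane. Charts may therefore take values in the
  sphere, where reflections and inversions act.\<close>

lemma plane_chart_from_sphere_chart:
  assumes U: "openin X U" "x \<in> U" and W: "openin (top_of_set unit_sphere) W"
    and h: "subtopology X U homeomorphic_space top_of_set W"
  shows "\<exists>U (W :: (real ^ 2) set).
    openin X U \<and> x \<in> U \<and> open W \<and> subtopology X U homeomorphic_space top_of_set W"
proof -
  obtain f g where fg: "homeomorphic_maps (subtopology X U) (top_of_set W) f g"
    using h unfolding homeomorphic_space_def by blast
  have tU: "topspace (subtopology X U) = U" using openin_subset[OF U(1)] by auto
  have fW: "f \<in> U \<rightarrow> W" using fg tU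
    unfolding homeomorphic_maps_def continuous_map_def by fastforce
  have WS: "W \<subseteq> unit_sphere" using W openin_imp_subset by blast
  define p where "p = - f x"
  have fx: "f x \<in> W" using fW U by auto
  then have nfx: "norm (f x) = 1" using WS by auto
  have p: "p \<in> unit_sphere" using nfx by (simp add: p_def)
  have fxp: "f x \<noteq> p"
  proof
    assume "f x = p"
    then have "2 *\<^sub>R f x = 0" by (simp add: p_def scaleR_2 eq_neg_iff_add_eq_0)
    then show False using nfx by simp
  qed
  define W1 where "W1 = W - {p}"
  have "unit_sphere - {p} homeomorphic (UNIV :: (real ^ 2) set)"
    by (rule homeomorphic_punctured_sphere_affine[OF zero_less_one p]) auto
  then obtain k l where kl: "homeomorphism (unit_sphere - {p}) (UNIV :: (real ^ 2) set) k l"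
    unfolding homeomorphic_def by blast
  have "openin (top_of_set unit_sphere) (W1)"
    unfolding W1_def using W by (rule openin_delete)
  then have W1: "openin (top_of_set (unit_sphere - {p})) W1"
  proof (rule openin_subset_trans)
    show "W1 \<subseteq> unit_sphere - {p}" unfolding W1_def by (rule Diff_mono[OF WS order_refl])
  qed (rule Diff_subset)
  then have "openin (top_of_set UNIV) (k ` W1)"
    using homeomorphism_imp_open_map[OF kl] by blast
  then have o: "open (k ` W1)" by simp
  have "homeomorphism W1 (k ` W1) k l"
    by (rule homeomorphism_of_subsets[OF kl]) (use WS in \<open>auto simp: W1_def\<close>)
  then have h1: "top_of_set W1 homeomorphic_space top_of_set (k ` W1)"
    unfolding homeomorphic_space_def homeomorphic_maps_def homeomorphism_def
    by (intro exI[of _ k] exI[of _ l]) auto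
  define U1 where "U1 = {u \<in> U. f u \<in> W1}"
  have "openin (subtopology X U) {u \<in> topspace (subtopology X U). f u \<in> W1}"
  proof (rule openin_continuous_map_preimage)
    show "continuous_map (subtopology X U) (top_of_set W) f"
      using fg by (simp add: homeomorphic_maps_def)
    show "openin (top_of_set W) W1" unfolding W1_def
      by (rule openin_delete) simp
  qed
  then have oU1: "openin X U1"
    using openin_trans_full[OF _ U(1)] unfolding tU U1_def by blast
  have "homeomorphic_maps (subtopology (subtopology X U) U1) (subtopology (top_of_set W) W1) f g"
  proof (rule homeomorphic_maps_subtopologies_alt[OF fg])
    show "f ` (topspace (subtopology X U) \<inter> U1) \<subseteq> W1" by (auto simp: U1_def)
    show "g ` (topspace (top_of_set W) \<inter> W1) \<subseteq> U1"
    proof clarify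
      fix y assume y: "y \<in> topspace (top_of_set W)" "y \<in> W1"
      then have "f (g y) = y" "g y \<in> topspace (subtopology X U)"
        using fg unfolding homeomorphic_maps_def continuous_map_def by fastforce+
      then show "g y \<in> U1" using y tU by (simp add: U1_def)
    qed
  qed
  moreover have "subtopology (subtopology X U) U1 = subtopology X U1"
    by (simp add: subtopology_subtopology inf_absorb2 U1_def subset_iff)
  moreover have "subtopology (top_of_set W) W1 = top_of_set W1"
    by (simp add: subtopology_subtopology inf_absorb2 W1_def Diff_subset)
  ultimately have "subtopology X U1 homeomorphic_space top_of_set W1"
    unfolding homeomorphic_space_def by auto
  then have "subtopology X U1 homeomorphic_space top_of_set (k ` W1)"
    using h1 homeomorphic_space_trans by blast
  moreover have "x \<in> U1" using U fx fxp by (auto simp: U1_def W1_def)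
  ultimately show ?thesis using o oU1 by blast
qed

section \<open>The sphere with handles as a quotient on representatives\<close>

locale handle_caps =
  fixes h :: nat and a b :: "nat \<Rightarrow> real ^ 3" and r :: real
  assumes a: "\<And>i. i < h \<Longrightarrow> norm (a i) = 1" and b: "\<And>i. i < h \<Longrightarrow> norm (b i) = 1"
    and r: "0 < r" "r < 1"
    and far_ab: "\<And>i j. i < h \<Longrightarrow> j < h \<Longrightarrow> 4 * r < dist (a i) (b j)"
    and far_aa: "\<And>i j. i < h \<Longrightarrow> j < h \<Longrightarrow> i \<noteq> j \<Longrightarrow> 4 * r < dist (a i) (a j)"
    and far_bb: "\<And>i j. i < h \<Longrightarrow> j < h \<Longrightarrow> i \<noteq> j \<Longrightarrow> 4 * r < dist (b i) (b j)"
begin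

definition M :: "(real ^ 3) set" where
  "M = unit_sphere - (\<Union>i<h. open_cap (a i) r \<union> open_cap (b i) r)"

lemma mem_M: "x \<in> M \<longleftrightarrow> norm x = 1 \<and> (\<forall>i<h. r \<le> dist (a i) x \<and> r \<le> dist (b i) x)"
  by (auto simp: M_def open_cap_def not_less)

abbreviation \<tau> :: "nat \<Rightarrow> real ^ 3 \<Rightarrow> real ^ 3" where
  "\<tau> i \<equiv> swap_reflection (a i) (b i)"

lemma a_neq_b: "i < h \<Longrightarrow> a i \<noteq> b i"
  using far_ab[of i i] r by auto

text \<open>Centres more than \<open>4 * r\<close> apart have disjoint closed caps of radius
  \<open>2 * r\<close>, so around each circle there is a collar of width \<open>r\<close> that meets
  no other cap.\<close>

lemma near_a:
  assumes "i < h" "dist (a i) x \<le> 2 * r" "j < h"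
  shows "2 * r < dist (b j) x" "j \<noteq> i \<Longrightarrow> 2 * r < dist (a j) x"
  using assms far_ab[of i j] far_aa[of i j] dist_triangle[of "a i" "b j" x]
    dist_triangle[of "a i" "a j" x] by (auto simp: dist_commute)

lemma near_b:
  assumes "i < h" "dist (b i) x \<le> 2 * r" "j < h"
  shows "2 * r < dist (a j) x" "j \<noteq> i \<Longrightarrow> 2 * r < dist (b j) x"
  using assms far_ab[of j i] far_bb[of i j] dist_triangle[of "b i" "b j" x]
    dist_triangle[of "b i" "a j" x] by (auto simp: dist_commute)

lemma tau:
  assumes "i < h"
  shows "norm (\<tau> i x) = norm x" "\<tau> i (\<tau> i x) = x"
    "dist (a i) (\<tau> i x) = dist (b i) x" "dist (b i) (\<tau> i x) = dist (a i) x"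
proof -
  note n = a_neq_b[OF assms] and e = a[OF assms, folded b[OF assms]]
  show "norm (\<tau> i x) = norm x" "\<tau> i (\<tau> i x) = x"
    using n by (simp_all add: norm_swap_reflection swap_reflection_swap_reflection)
  show "dist (a i) (\<tau> i x) = dist (b i) x"
    using dist_swap_reflection[OF n, of "b i" x] n e by (simp add: swap_reflection_right)
  show "dist (b i) (\<tau> i x) = dist (a i) x"
    using dist_swap_reflection[OF n, of "a i" x] n e by (simp add: swap_reflection_left)
qed

lemma tau_mem_M:
  assumes i: "i < h" and x: "norm x = 1" and "r \<le> dist (a i) x \<and> dist (a i) x \<le> 2 * r \<or> r \<le> dist (b i) x \<and> dist (b i) x \<le> 2 * r"
  shows "\<tau> i x \<in> M" "x \<in> M"
proof -
  have *: "y \<in> M" if y: "norm y = 1" and d: "r \<le> dist (a i) y \<and> dist (a i) y \<le> 2 * r \<or> r \<le> dist (b i) y \<and> dist (b i) y \<le> 2 * r" for y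
    unfolding mem_M
  proof (intro conjI allI impI y)
    fix j assume j: "j < h"
    have "r < 2 * r" using r by simp
    show "r \<le> dist (a j) y"
      using d near_a(2)[OF i _ j, of y] near_b(1)[OF i _ j, of y] \<open>r < 2 * r\<close> by (cases "j = i") auto
    show "r \<le> dist (b j) y"
      using d near_a(1)[OF i _ j, of y] near_b(2)[OF i _ j, of y] \<open>r < 2 * r\<close> by (cases "j = i") auto
  qed
  show "\<tau> i x \<in> M" "x \<in> M" using * assms tau[OF i] by auto
qed

text \<open>\<open>q\<close> represents the class of a point of the boundary of the cap around \<open>b i\<close> by the
  corresponding boundary point of the cap around \<open>a i\<close>.\<close>

definition q :: "real ^ 3 \<Rightarrow> real ^ 3" where
  "q x = (if \<exists>i<h. dist (b i) x = r then \<tau> (SOME i. i < h \<and> dist (b i) x = r) x else x)"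

lemma q_b:
  assumes "i < h" "dist (b i) x = r" shows "q x = \<tau> i x"
proof -
  have "(SOME i. i < h \<and> dist (b i) x = r) = i"
  proof (rule some_equality)
    show "j = i" if "j < h \<and> dist (b j) x = r" for j
      using near_b(2)[of i x j] assms that r by force
  qed (use assms in simp)
  then show ?thesis using assms by (auto simp: q_def)
qed

lemma q_id: "(\<And>i. i < h \<Longrightarrow> dist (b i) x \<noteq> r) \<Longrightarrow> q x = x"
  by (auto simp: q_def)

lemma q_a:
  assumes "i < h" "dist (a i) x \<le> 2 * r" shows "q x = x"
  by (rule q_id) (use near_a(1)[OF assms] r in force)

definition R :: "real ^ 3 \<Rightarrow> real ^ 3 \<Rightarrow> bool" where
  "R x y \<longleftrightarrow> (\<exists>i<h. x \<in> cap_boundary (a i) r \<and> y = \<tau> i x)"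

lemma RI: "i < h \<Longrightarrow> norm x = 1 \<Longrightarrow> dist (a i) x = r \<Longrightarrow> R x (\<tau> i x)"
  by (auto simp: R_def cap_boundary_def)

lemma RE:
  assumes "R x y"
  obtains i where "i < h" "norm x = 1" "norm y = 1" "dist (a i) x = r" "dist (b i) y = r"
    "y = \<tau> i x" "x = \<tau> i y"
proof -
  obtain i where i: "i < h" "norm x = 1" "dist (a i) x = r" "y = \<tau> i x"
    using assms by (auto simp: R_def cap_boundary_def)
  note t = tau[OF i(1), of x, folded i(4)]
  show ?thesis
    by (rule that[OF i(1,2) _ i(3) _ i(4)]) (use t i in auto)
qed

lemma R_imp_q_eq:
  assumes "R x y" shows "q x = q y"
proof -
  obtain i where i: "i < h" "dist (a i) x = r" "dist (b i) y = r" "x = \<tau> i y"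
    using assms by (rule RE)
  then have "q x = x" using q_a r by simp
  moreover have "q y = \<tau> i y" using q_b i by simp
  ultimately show ?thesis using i by simp
qed

lemma q_eq_iff:
  assumes "norm x = 1" "norm y = 1"
  shows "q x = q y \<longleftrightarrow> x = y \<or> R x y \<or> R y x"
proof
  assume eq: "q x = q y"
  have *: "x = y \<or> R x y \<or> R y x"
    if eq: "q x = q y" and x: "norm x = 1" and y: "norm y = 1" and i: "i < h" "dist (b i) x = r" for x y i
  proof (cases "\<exists>j<h. dist (b j) y = r")
    case True
    then obtain j where j: "j < h" "dist (b j) y = r" by blast
    have e: "\<tau> i x = \<tau> j y" using eq q_b i j by simp
    have "dist (a i) (\<tau> i x) = r" using tau(3)[OF i(1)] i(2) by simp
    moreover have "dist (a j) (\<tau> i x) = r" unfolding e using tau(3)[OF j(1)] j(2) by simp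
    \<comment> \<open>The common representative lies on the circles around \<open>a i\<close> and
      \<open>a j\<close>, which are disjoint for different handles.\<close>
    ultimately have "i = j" using near_a(2)[of i "\<tau> i x" j] i(1) j(1) r by (cases "i = j") auto
    then have "\<tau> i (\<tau> i x) = \<tau> i (\<tau> i y)" using e by simp
    then show ?thesis unfolding tau(2)[OF i(1)] by simp
  next
    case False
    then have "q y = y" using q_id by blast
    then have yx: "y = \<tau> i x" using eq q_b[OF i] by simp
    then have "dist (a i) y = r" using tau(3)[OF i(1)] i(2) by simp
    then have "R y (\<tau> i y)" using RI[OF i(1) y] by simp
    moreover have "\<tau> i y = x" unfolding yx by (rule tau(2)[OF i(1)])
    ultimately show ?thesis by simp
  qed
  show "x = y \<or> R x y \<or> R y x"
  proof (cases "\<exists>i<h. dist (b i) x = r")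
    case True
    then show ?thesis using * eq assms by blast
  next
    case x: False
    show ?thesis
    proof (cases "\<exists>i<h. dist (b i) y = r")
      case True
      then show ?thesis using *[of y x] eq assms by auto
    next
      case False
      then show ?thesis using x eq q_id by metis
    qed
  qed
next
  assume "x = y \<or> R x y \<or> R y x"
  then show "q x = q y" using R_imp_q_eq by metis
qed

definition X :: "(real ^ 3) topology" where
  "X = quotient_space (top_of_set M) q"

lemma quotient_q: "quotient_map (top_of_set M) X q"
  unfolding X_def by (rule quotient_map_quotient_space)

lemma topspace_X: "topspace X = q ` M"
  by (simp add: X_def)

lemma closed_M: "closed M"
proof -
  have "M = unit_sphere - (\<Union>i<h. ball (a i) r \<union> ball (b i) r)"
    by (auto simp: M_def open_cap_def)
  then show ?thesis by (simp only:) (intro closed_Diff open_UN; auto)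
qed

lemma compact_M: "compact M"
proof -
  have "bounded M" by (rule bounded_subset[OF bounded_sphere]) (auto simp: M_def)
  then show ?thesis using closed_M compact_eq_bounded_closed by blast
qed

lemma glued_X: "glued M R X"
  unfolding glued_def
  by (intro exI[of _ q] conjI quotient_q) (auto simp: q_eq_iff mem_M)

lemma sphere_with_handles_X: "sphere_with_handles h X"
  unfolding sphere_with_handles_def
proof (rule exI[of _ a], rule exI[of _ b], rule exI[of _ "\<lambda>_. r"], intro conjI allI impI)
  fix i assume i: "i < h"
  show "a i \<in> unit_sphere" "b i \<in> unit_sphere" using a b i by auto
  show "0 < r" by (rule r)
  show "cap (a i) r \<inter> cap (b i) r = {}"
  proof (intro equals0I)
    fix x assume "x \<in> cap (a i) r \<inter> cap (b i) r"
    then show False using near_a(1)[OF i _ i, of x] r by (simp add: cap_def)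
  qed
next
  show "disjoint_family_on (\<lambda>i. cap (a i) r \<union> cap (b i) r) {..<h}"
    unfolding disjoint_family_on_def
  proof (intro ballI impI equals0I)
    fix i j x assume *: "i \<in> {..<h}" "j \<in> {..<h}" "i \<noteq> j"
      "x \<in> (cap (a i) r \<union> cap (b i) r) \<inter> (cap (a j) r \<union> cap (b j) r)"
    then show False
      using near_a[of i x j] near_b[of i x j] r by (auto simp: cap_def)
  qed
  show "glued (unit_sphere - (\<Union>i<h. open_cap (a i) r \<union> open_cap (b i) r))
     (\<lambda>x y. \<exists>i<h. x \<in> cap_boundary (a i) r \<and> y = \<tau> i x) X"
    using glued_X unfolding M_def R_def .
qed

text \<open>The saturation of a closed set only adds the reflections of its intersections with
  finitely many circles. These are compact, so the saturation \<open>D\<close> is closed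
  again.\<close>

lemma closed_map_q: "closed_map (top_of_set M) X q"
  unfolding closed_map_def
proof (intro allI impI)
  fix C assume C: "closedin (top_of_set M) C"
  then have CM: "C \<subseteq> M" using closedin_imp_subset by blast
  have cC: "compact C" using C compact_M closedin_compact by blast
  define D where "D = C \<union> (\<Union>i<h. \<tau> i ` (C \<inter> (sphere (a i) r \<union> sphere (b i) r)))"
  have "compact (\<tau> i ` (C \<inter> (sphere (a i) r \<union> sphere (b i) r)))" for i
    by (intro compact_continuous_image continuous_on_swap_reflection compact_Int_closed cC)
      (intro closed_Un closed_sphere)
  then have "compact D" unfolding D_def by (intro compact_Un cC compact_UN) auto
  then have cD: "closed D" by (rule compact_imp_closed)
  have D: "{x \<in> M. q x \<in> q ` C} = M \<inter> D"
  proof (intro set_eqI iffI)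
    fix x assume "x \<in> {x \<in> M. q x \<in> q ` C}"
    then obtain y where y: "x \<in> M" "y \<in> C" "q x = q y" by auto
    then have "x = y \<or> R x y \<or> R y x" using q_eq_iff CM mem_M by blast
    then consider "x = y" | i where "i < h" "dist (a i) y = r \<or> dist (b i) y = r" "x = \<tau> i y"
      using RE by metis
    then have "x \<in> D"
    proof cases
      case 2
      then have "x \<in> \<tau> i ` (C \<inter> (sphere (a i) r \<union> sphere (b i) r))"
        using y(2) by (intro image_eqI[of _ _ y]) auto
      then show ?thesis using 2(1) by (auto simp: D_def)
    qed (use y in \<open>simp add: D_def\<close>)
    then show "x \<in> M \<inter> D" using y by auto
  next
    fix x assume x: "x \<in> M \<inter> D"
    then consider "x \<in> C" | i y where "i < h" "y \<in> C" "x = \<tau> i y" "dist (a i) y = r \<or> dist (b i) y = r"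
      by (auto simp: D_def)
    then have "q x \<in> q ` C"
    proof cases
      case 2
      then have n: "norm y = 1" using CM mem_M by auto
      have "R y x \<or> R x y"
      proof (cases "dist (a i) y = r")
        case True then show ?thesis using RI[of i y] 2 n by simp
      next
        case False
        then have "dist (b i) y = r" using 2(4) by simp
        then have "R x (\<tau> i x)"
          unfolding 2(3) by (intro RI 2(1)) (simp_all add: tau[OF 2(1)] n)
        moreover have "\<tau> i x = y" unfolding 2(3) by (rule tau(2)[OF 2(1)])
        ultimately show ?thesis by simp
      qed
      then show ?thesis using R_imp_q_eq 2(2) by (metis imageI)
    qed auto
    then show "x \<in> {x \<in> M. q x \<in> q ` C}" using x by auto
  qed
  have "openin X (topspace X - q ` C)"
  proof -
    have "{x \<in> M. q x \<in> topspace X - q ` C} = M \<inter> - D"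
      using D by (auto simp: topspace_X)
    moreover have "openin (top_of_set M) (M \<inter> - D)"
      using cD by (intro openin_open_Int) auto
    ultimately show ?thesis unfolding X_def by (simp add: openin_quotient_space)
  qed
  then show "closedin X (q ` C)" using CM by (auto simp: closedin_def topspace_X)
qed

text \<open>Being Hausdorff need not survive a quotient, but normality and closedness of points both
  pass to the image of a closed continuous map.\<close>

lemma Hausdorff_X: "Hausdorff_space X"
proof (rule normal_t1_imp_Hausdorff_space)
  have "normal_space (top_of_set M)"
    by (intro metrizable_imp_normal_space metrizable_space_subtopology metrizable_space_euclidean)
  then show "normal_space X"
    using normal_space_continuous_closed_map_image closed_map_q quotient_q
    by (metis quotient_imp_continuous_map quotient_imp_surjective_map)
  have "t1_space (top_of_set M)"
    by (intro t1_space_subtopology t1_space_euclidean)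
  then show "t1_space X"
    using t1_space_closed_map_image closed_map_q quotient_q
    by (metis quotient_imp_surjective_map)
qed

lemma compact_X: "compact_space X"
proof -
  have "compactin (top_of_set M) M" using compact_M by (simp add: compactin_subtopology)
  then have "compactin X (q ` M)"
    using image_compactin quotient_q quotient_imp_continuous_map by metis
  then show ?thesis by (simp add: compact_space_def topspace_X)
qed

lemma connected_X: "connected_space X"
proof -
  define C where "C = a ` {..<h} \<union> b ` {..<h}"
  have "connected (unit_sphere - (\<Union>c\<in>C. open_cap c r))"
  proof (rule connected_sphere_Diff_caps)
    show "2 * r < dist c d" if "c \<in> C" "d \<in> C" "c \<noteq> d" for c d
    proof -
      have "4 * r < dist c d"
        using that unfolding C_def
        by (elim UnE imageE) (metis far_ab far_aa far_bb dist_commute lessThan_iff)+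
      then show ?thesis using r by linarith
    qed
  qed (use a b r in \<open>auto simp: C_def\<close>)
  moreover have "unit_sphere - (\<Union>c\<in>C. open_cap c r) = M" by (auto simp: C_def M_def)
  ultimately have "connected_space (top_of_set M)" by (simp add: connected_space_subtopology)
  then show ?thesis using quotient_q connected_space_quotient_map_image by blast
qed

lemma topspace_X_nonempty: "topspace X \<noteq> {}"
proof (cases "h = 0")
  case True
  then have "M = unit_sphere" unfolding M_def by simp
  then show ?thesis by (simp add: topspace_X)
next
  case False
  then have h: "0 < h" by simp
  obtain x where "x \<in> cap_boundary (a 0) r"
    using path_connected_cap_boundary(2)[OF a[OF h] r] by blast
  then have "x \<in> M" using tau_mem_M(2)[OF h] r by (auto simp: cap_boundary_def)
  then show ?thesis by (auto simp: topspace_X)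
qed

end

section \<open>Charts off and on the gluing circles\<close>

context handle_caps begin

text \<open>Points off all circles are alone in their classes, so an open piece of the sphere serves
  as its own chart. Only the circles around the \<open>a i\<close> have to be avoided by
  \<open>z\<close>, since \<open>q\<close> moves the points on the other circles to them.\<close>

lemma sphere_chart:
  assumes "z \<in> topspace X" "\<And>i. i < h \<Longrightarrow> dist (a i) z \<noteq> r"
  shows "\<exists>U W. openin X U \<and> z \<in> U \<and> openin (top_of_set unit_sphere) W \<and>
    subtopology X U homeomorphic_space top_of_set W"
proof -
  define W where "W = unit_sphere \<inter> (\<Inter>i<h. - cball (a i) r \<inter> - cball (b i) r)"
  have memW: "x \<in> W \<longleftrightarrow> norm x = 1 \<and> (\<forall>i<h. r < dist (a i) x \<and> r < dist (b i) x)" for x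
    by (auto simp: W_def not_le)
  have WM: "W \<subseteq> M" by (auto simp: memW mem_M less_imp_le)
  have qW: "q x = x" if "x \<in> W" for x by (rule q_id) (use that memW in force)
  have "open (\<Inter>i<h. - cball (a i) r \<inter> - cball (b i) r)"
    by (intro open_INT) auto
  then have oW: "openin (top_of_set unit_sphere) W" by (simp add: W_def openin_open_Int)
  have nR: "\<not> R x y \<and> \<not> R y x" if "x \<in> W" for x y
    using that memW RE by (metis less_irrefl)
  have sat: "x = y" if "x \<in> M" "y \<in> W" "q x = q y" for x y
    using q_eq_iff[of x y] that nR[of y x] WM by (auto simp: mem_M)
  have *: "openin X (q ` W) \<and> subtopology X (q ` W) homeomorphic_space top_of_set W"
  proof (rule homeomorphic_space_quotient_chart[OF quotient_q, where f = "\<lambda>x. x" and g = q])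
    show "openin (top_of_set M) W"
      using oW WM by (rule openin_subset_trans) (auto simp: M_def)
    show "continuous_map (top_of_set W) X q"
      using quotient_imp_continuous_map[OF quotient_q] continuous_map_from_subtopology_mono WM by blast
    show "x \<in> W" if "x \<in> M" "y \<in> W" "q x = q y" for x y using sat[OF that] that by simp
    show "x = y" if "x \<in> W" "y \<in> W" "q x = q y" for x y using sat[of x y] that WM by blast
  qed auto
  moreover have "z \<in> q ` W"
  proof -
    obtain x where x: "x \<in> M" "z = q x" using assms(1) by (auto simp: topspace_X)
    have "dist (b i) x \<noteq> r" if "i < h" for i
      using assms(2)[OF that] q_b[OF that, of x] tau(3)[OF that, of x] x(2) by auto
    then have "z = x" "x \<in> W"
      using x q_id assms(2) mem_M memW by (auto simp: less_le)
    then show ?thesis using x(2) by blast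
  qed
  ultimately show ?thesis using oW by blast
qed

text \<open>Around the circle of a handle, a point near the cap at \<open>b i\<close> is carried by the gluing map
  and the inversion into the cap at \<open>a i\<close>.\<close>

lemma circle_chart:
  assumes i: "i < h" and z: "z \<in> topspace X" "dist (a i) z = r"
  shows "\<exists>U W. openin X U \<and> z \<in> U \<and> openin (top_of_set unit_sphere) W \<and>
    subtopology X U homeomorphic_space top_of_set W"
proof -
  define \<iota> where "\<iota> = circle_inversion (a i) r"
  note ai = a[OF i] and rr = r
  have iota: "norm (\<iota> y) = 1" "\<iota> (\<iota> y) = y"
    "dist (a i) (\<iota> y) < r \<longleftrightarrow> r < dist (a i) y" "r < dist (a i) (\<iota> y) \<longleftrightarrow> dist (a i) y < r"
    "dist (a i) y = r \<Longrightarrow> \<iota> y = y"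
    if "norm y = 1" for y
    using norm_circle_inversion[OF ai r refl that] circle_inversion_circle_inversion[OF ai r refl that]
      dist_circle_inversion[OF ai r refl that] circle_inversion_fixed[OF ai r refl that]
    by (simp_all add: \<iota>_def dist_commute)
  have ciota: "continuous_on unit_sphere \<iota>"
    unfolding \<iota>_def by (rule continuous_on_circle_inversion[OF ai r refl])
  define Na where "Na = M \<inter> ball (a i) (2 * r)"
  define Nb where "Nb = M \<inter> ball (b i) (2 * r)"
  define N where "N = Nb \<union> Na"
  \<comment> \<open>\<open>W\<close> is invariant under \<open>\<iota>\<close>: outside the circle
    it is the collar of radius \<open>2 * r\<close>, and inside it is the inverted collar, onto
    which the collar around \<open>b i\<close> is carried.\<close>
  define W where "W = unit_sphere \<inter> ball (a i) (2 * r) \<inter> \<iota> -` ball (a i) (2 * r)"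
  define f where "f = (\<lambda>x. if dist (b i) x < 2 * r then \<iota> (\<tau> i x) else x)"
  \<comment> \<open>Both formulas agree on the circle: there \<open>\<iota>\<close> is the identity,
    and \<open>\<tau> i\<close> does not change the class.\<close>
  define g where "g = (\<lambda>y. if r \<le> dist (a i) y then q y else q (\<tau> i (\<iota> y)))"
  have memNa: "x \<in> Na \<longleftrightarrow> norm x = 1 \<and> r \<le> dist (a i) x \<and> dist (a i) x < 2 * r" for x
    using tau_mem_M(2)[OF i, of x] i by (auto simp: Na_def mem_M)
  have memNb: "x \<in> Nb \<longleftrightarrow> norm x = 1 \<and> r \<le> dist (b i) x \<and> dist (b i) x < 2 * r" for x
    using tau_mem_M(2)[OF i, of x] i by (auto simp: Nb_def mem_M)
  have memW: "y \<in> W \<longleftrightarrow> norm y = 1 \<and> dist (a i) y < 2 * r \<and> dist (a i) (\<iota> y) < 2 * r" for y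
    by (auto simp: W_def)
  have fa: "f x = x" if "x \<in> Na" for x
    using near_a(1)[OF i _ i, of x] that by (auto simp: f_def memNa)
  have fb: "f x = \<iota> (\<tau> i x)" if "x \<in> Nb" for x
    using that by (auto simp: f_def memNb)
  have qtau: "q (\<tau> i x) = q x" if "norm x = 1" "dist (a i) x = r \<or> dist (b i) x = r" for x
  proof -
    have "R x (\<tau> i x) \<or> R (\<tau> i x) x"
      using that RI[OF i, of x] RI[OF i, of "\<tau> i x"] tau[OF i, of x] by auto
    then show ?thesis using R_imp_q_eq by metis
  qed
  have gt: "g y = q (\<tau> i (\<iota> y))" if "norm y = 1" "dist (a i) y \<le> r" for y
  proof (cases "dist (a i) y = r")
    case True
    then show ?thesis using qtau[of y] iota(5)[of y] that by (simp add: g_def)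
  qed (use that in \<open>simp add: g_def\<close>)
  have NM: "N \<subseteq> M" by (auto simp: N_def Na_def Nb_def)
  have cont_q: "continuous_map (top_of_set S) X (\<lambda>y. q (k y))"
    if "continuous_on S k" "k ` S \<subseteq> M" for S :: "(real ^ 3) set" and k
  proof -
    have "continuous_map (top_of_set S) (top_of_set M) k"
      using that by (auto simp: continuous_map_in_subtopology)
    then have "continuous_map (top_of_set S) X (q \<circ> k)"
      using quotient_imp_continuous_map[OF quotient_q] continuous_map_compose by blast
    then show ?thesis by (simp add: o_def)
  qed
  have oNa: "openin (top_of_set N) Na" and oNb: "openin (top_of_set N) Nb"
  proof -
    have "Na = N \<inter> ball (a i) (2 * r)" "Nb = N \<inter> ball (b i) (2 * r)"
      by (auto simp: N_def Na_def Nb_def)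
    then show "openin (top_of_set N) Na" "openin (top_of_set N) Nb"
      by (simp_all add: openin_open_Int)
  qed
  have oN: "openin (top_of_set M) N"
    unfolding N_def Na_def Nb_def by (intro openin_Un openin_open_Int) auto
  have *: "openin X (q ` N) \<and> subtopology X (q ` N) homeomorphic_space top_of_set W"
  proof (rule homeomorphic_space_quotient_chart[OF quotient_q oN, where f = f and g = g])
    show "x \<in> N" if x: "x \<in> M" and y: "y \<in> N" and e: "q x = q y" for x y
    proof -
      have n: "norm x = 1" "norm y = 1" using x y NM by (auto simp: mem_M)
      have *: "j = i" if "j < h" "dist (a j) y = r \<or> dist (b j) y = r" for j
        using y that near_a[OF i _ that(1), of y] near_b[OF i _ that(1), of y] r
        by (cases "j = i") (auto simp: N_def memNa memNb)
      have "x = y \<or> R x y \<or> R y x" using q_eq_iff[OF n] e by simp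
      then consider "x = y" | j where "j < h" "dist (a j) x = r \<or> dist (b j) x = r"
        "dist (a j) y = r \<or> dist (b j) y = r" using RE by metis
      then show "x \<in> N"
      proof cases
        case 2
        then have "dist (a i) x = r \<or> dist (b i) x = r" using *[of j] by auto
        then show ?thesis using r n by (auto simp: N_def memNa memNb)
      qed (use y in simp)
    qed
    show "continuous_on N f"
      unfolding N_def f_def
    proof (rule continuous_on_cases_local_open)
      show "continuous_on Nb (\<lambda>x. \<iota> (\<tau> i x))"
        by (rule continuous_on_compose2[OF ciota continuous_on_swap_reflection])
          (auto simp: memNb tau[OF i])
      show "\<iota> (\<tau> i x) = x" if "x \<in> Nb \<and> \<not> dist (b i) x < 2 * r \<or> x \<in> Na \<and> dist (b i) x < 2 * r" for x
        using that near_a(1)[OF i _ i, of x] by (auto simp: memNb memNa)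
    qed (use oNa oNb in \<open>auto simp: N_def\<close>)
    show "f x \<in> W" if "x \<in> N" for x
    proof (cases "x \<in> Na")
      case True
      have "norm x = 1" using True memNa by simp
      then show ?thesis
        using True fa[OF True] iota(4)[of x] r by (auto simp: memW memNa)
    next
      case False
      then have x: "x \<in> Nb" using that by (simp add: N_def)
      define y where "y = \<tau> i x"
      have y: "norm y = 1" "r \<le> dist (a i) y" "dist (a i) y < 2 * r"
        using x tau[OF i, of x] by (auto simp: y_def memNb)
      have "f x = \<iota> y" using fb[OF x] by (simp add: y_def)
      then show ?thesis
        using y iota(1,2,4)[OF y(1)] r by (auto simp: memW)
    qed
    show "f x = f y" if "x \<in> N" "y \<in> N" "q x = q y" for x y
    proof -
      have *: "f x = f y" if "R x y" "x \<in> N" "y \<in> N" for x y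
      proof -
        obtain j where j: "j < h" "norm x = 1" "norm y = 1" "dist (a j) x = r" "dist (b j) y = r"
          "y = \<tau> j x" "x = \<tau> j y" using \<open>R x y\<close> by (rule RE)
        have "j = i"
          using \<open>x \<in> N\<close> j(1,2,4) near_a[OF i _ j(1), of x] near_b[OF i _ j(1), of x] r
          by (cases "j = i") (auto simp: N_def memNa memNb)
        then have xy: "x \<in> Na" "y \<in> Nb" using j(2-5) r by (auto simp: memNa memNb)
        have "f y = \<iota> x" unfolding fb[OF xy(2)] using j(7) \<open>j = i\<close> by metis
        then show ?thesis using fa[OF xy(1)] iota(5)[OF j(2)] j(4) \<open>j = i\<close> by simp
      qed
      have "norm x = 1" "norm y = 1" using that NM by (auto simp: mem_M)
      then have "x = y \<or> R x y \<or> R y x" using q_eq_iff that by blast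
      then show ?thesis using *[of x y] *[of y x] that by metis
    qed
    show "continuous_map (top_of_set W) X g"
      unfolding g_def
    proof (rule continuous_map_cases_le)
      show "continuous_map (top_of_set W) euclideanreal (\<lambda>_. r)" by simp
      show "continuous_map (top_of_set W) euclideanreal (\<lambda>x. dist (a i) x)"
        by (simp add: continuous_on_dist)
      define S where "S = {x \<in> topspace (top_of_set W). r \<le> dist (a i) x}"
      define T where "T = {x \<in> topspace (top_of_set W). dist (a i) x \<le> r}"
      have "S \<inter> W = S" "T \<inter> W = T" by (auto simp: S_def T_def)
      have "continuous_map (top_of_set S) X q"
        by (rule cont_q[of _ "\<lambda>x. x"])
          (use tau_mem_M(2)[OF i] in \<open>auto simp: S_def memW less_imp_le\<close>)
      then show "continuous_map (subtopology (top_of_set W) {x \<in> topspace (top_of_set W). r \<le> dist (a i) x}) X q"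
        unfolding S_def[symmetric] by (simp add: subtopology_subtopology Int_commute \<open>S \<inter> W = S\<close>)
      have TS: "T \<subseteq> unit_sphere" by (auto simp: T_def memW)
      have "continuous_map (top_of_set T) X (\<lambda>y. q (\<tau> i (\<iota> y)))"
      proof (rule cont_q)
        show "continuous_on T (\<lambda>y. \<tau> i (\<iota> y))"
          by (rule continuous_on_compose2[OF continuous_on_swap_reflection continuous_on_subset[OF ciota TS] subset_UNIV])
        show "(\<lambda>y. \<tau> i (\<iota> y)) ` T \<subseteq> M"
        proof clarify
          fix y assume "y \<in> T"
          then have y: "norm y = 1" "dist (a i) y \<le> r" "dist (a i) (\<iota> y) < 2 * r"
            by (auto simp: T_def memW)
          then have "r \<le> dist (a i) (\<iota> y)" using iota(3)[OF y(1)] by linarith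
          then show "\<tau> i (\<iota> y) \<in> M" using tau_mem_M(1)[OF i iota(1)[OF y(1)]] y by auto
        qed
      qed
      then show "continuous_map (subtopology (top_of_set W) {x \<in> topspace (top_of_set W). dist (a i) x \<le> r}) X (\<lambda>y. q (\<tau> i (\<iota> y)))"
        unfolding T_def[symmetric] by (simp add: subtopology_subtopology Int_commute \<open>T \<inter> W = T\<close>)
      show "q x = q (\<tau> i (\<iota> x))" if "x \<in> topspace (top_of_set W)" "r = dist (a i) x" for x
        using gt[of x] that by (simp add: g_def memW)
    qed
    show "g (f x) = q x" if "x \<in> N" for x
    proof (cases "x \<in> Na")
      case True
      then show ?thesis using fa[OF True] by (simp add: g_def memNa)
    next
      case False
      then have x: "x \<in> Nb" using that by (simp add: N_def)
      define y where "y = \<tau> i x"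
      have y: "norm y = 1" "r \<le> dist (a i) y" "dist (a i) y < 2 * r"
        using x tau[OF i, of x] by (auto simp: y_def memNb)
      have fx: "f x = \<iota> y" using fb[OF x] by (simp add: y_def)
      have "\<not> r < dist (a i) (\<iota> y)" using y iota(4)[OF y(1)] by simp
      then have "g (\<iota> y) = q (\<tau> i y)" using gt[OF iota(1)[OF y(1)]] iota(2)[OF y(1)] by simp
      then show ?thesis using fx tau(2)[OF i] by (simp add: y_def)
    qed
    show "\<exists>x\<in>N. f x = y" if "y \<in> W" for y
    proof (cases "r \<le> dist (a i) y")
      case True
      then have "y \<in> Na" using that by (simp add: memNa memW)
      then show ?thesis using fa by (auto simp: N_def)
    next
      case False
      have y: "norm y = 1" "dist (a i) y < r" "dist (a i) (\<iota> y) < 2 * r" using that False by (auto simp: memW)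
      define x where "x = \<tau> i (\<iota> y)"
      have "x \<in> Nb"
        unfolding memNb x_def using iota(1,4)[OF y(1)] y tau[OF i] by auto
      moreover from this have "f x = y" using fb[of x] tau(2)[OF i] iota(2)[OF y(1)] by (simp add: x_def)
      ultimately show ?thesis by (auto simp: N_def)
    qed
  qed
  moreover have "z \<in> q ` N"
  proof -
    obtain x where x: "x \<in> M" "z = q x" using z(1) by (auto simp: topspace_X)
    have "norm z = 1"
    proof (cases "\<exists>j<h. dist (b j) x = r")
      case True
      then show ?thesis using x q_b tau(1) by (auto simp: mem_M)
    next
      case False
      then show ?thesis using x q_id[of x] by (auto simp: mem_M)
    qed
    then have "z \<in> N" using z(2) r by (simp add: N_def memNa)
    moreover have "q z = z" using q_a[OF i] z(2) r by simp
    ultimately show ?thesis by (metis imageI)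
  qed
  moreover have "openin (top_of_set unit_sphere) W"
  proof -
    have "openin (top_of_set unit_sphere) (unit_sphere \<inter> \<iota> -` ball (a i) (2 * r))"
      using ciota by (rule continuous_openin_preimage_gen) simp
    moreover have "openin (top_of_set unit_sphere) (unit_sphere \<inter> ball (a i) (2 * r))"
      by (rule openin_open_Int) simp
    ultimately have "openin (top_of_set unit_sphere)
        ((unit_sphere \<inter> ball (a i) (2 * r)) \<inter> (unit_sphere \<inter> \<iota> -` ball (a i) (2 * r)))"
      by (metis openin_Int)
    moreover have "(unit_sphere \<inter> ball (a i) (2 * r)) \<inter> (unit_sphere \<inter> \<iota> -` ball (a i) (2 * r)) = W"
      by (auto simp: W_def)
    ultimately show ?thesis by simp
  qed
  ultimately show ?thesis by blast
qed

lemma surface_X: "surface X"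
  unfolding surface_def
proof (intro conjI ballI topspace_X_nonempty compact_X connected_X Hausdorff_X)
  fix z assume z: "z \<in> topspace X"
  obtain U W where "openin X U" "z \<in> U" "openin (top_of_set unit_sphere) W"
    "subtopology X U homeomorphic_space top_of_set W"
    using sphere_chart[OF z] circle_chart[OF _ z] by metis
  then show "\<exists>U (W :: (real ^ 2) set). openin X U \<and> z \<in> U \<and> open W \<and>
      subtopology X U homeomorphic_space top_of_set W"
    by (rule plane_chart_from_sphere_chart)
qed

lemma surface_of_Euler_genus_X: "surface_of_Euler_genus (2 * h) X"
  using surface_X sphere_with_handles_X by (auto simp: surface_of_Euler_genus_def)

end

section \<open>Drawing a graph on a sphere with handles\<close>

text \<open>Compactness yields the least parameter at distance at most \<open>r\<close>, and the
  intermediate value theorem makes the distance equal to \<open>r\<close>. This cuts a half-edge at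
  its arrival at the circle of a cap, so that the part kept stays outside the open cap.\<close>

lemma first_hit:
  fixes g :: "real \<Rightarrow> 'a::metric_space"
  assumes g: "continuous_on {0..1} g" and "r < dist c (g 0)" "dist c (g 1) < r"
  obtains t where "0 < t" "t < 1" "dist c (g t) = r" "\<And>s. 0 \<le> s \<Longrightarrow> s < t \<Longrightarrow> r < dist c (g s)"
proof -
  define f where "f = (\<lambda>s. dist c (g s))"
  have f: "continuous_on {0..1} f" unfolding f_def by (intro continuous_intros g)
  define S where "S = {0..1} \<inter> f -` {..r}"
  have "closed S"
    unfolding S_def by (rule continuous_closed_preimage[OF f]) auto
  moreover have "bounded S"
    by (rule bounded_subset[of "{0..1}"]) (auto simp: S_def)
  ultimately have "compact S" by (simp add: compact_eq_bounded_closed)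
  moreover have "1 \<in> S" using assms(3) by (simp add: S_def f_def less_imp_le)
  then have "S \<noteq> {}" by blast
  ultimately obtain t where t: "t \<in> S" "\<And>s. s \<in> S \<Longrightarrow> t \<le> s"
    by (meson compact_attains_inf)
  have "continuous_on {0..t} f" using f t(1) by (intro continuous_on_subset[OF f]) (auto simp: S_def)
  then obtain s where s: "0 \<le> s" "s \<le> t" "f s = r"
    using IVT2'[of f t r 0] t(1) assms(2) by (auto simp: S_def f_def)
  then have "s \<in> S" using t(1) by (auto simp: S_def)
  then have "f t = r" using t(2)[of s] s by auto
  moreover have "t \<noteq> 0" "t \<noteq> 1" using \<open>f t = r\<close> assms by (auto simp: f_def)
  moreover have "r < f s" if "0 \<le> s" "s < t" for s
    using t(2)[of s] that t(1) by (auto simp: S_def not_le[symmetric])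
  ultimately show ?thesis using that[of t] t(1) by (auto simp: f_def S_def)
qed

text \<open>The curves \<open>\<alpha> (2 * i)\<close> and \<open>\<alpha> (2 * i + 1)\<close> are
  the two half-edges of edge \<open>i\<close>; they leave its two vertices and end at the centres of
  the caps of handle \<open>i\<close>. Half-edges share at most their starting points, and each end
  is far from all vertices and from every other half-edge, so a cap around it disturbs no other
  half-edge.\<close>

locale handle_drawing =
  fixes h :: nat and V :: "'v set" and P :: "'v \<Rightarrow> real ^ 3" and own :: "nat \<Rightarrow> 'v"
    and \<alpha> :: "nat \<Rightarrow> real \<Rightarrow> real ^ 3" and r :: real
  assumes r: "0 < r" "r < 1"
    and P: "\<And>v. v \<in> V \<Longrightarrow> norm (P v) = 1" "inj_on P V"
    and own: "\<And>j. j < 2 * h \<Longrightarrow> own j \<in> V" "\<And>i. i < h \<Longrightarrow> own (2 * i) \<noteq> own (2 * i + 1)"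
    and cont: "\<And>j. j < 2 * h \<Longrightarrow> continuous_on {0..1} (\<alpha> j)"
    and sphere: "\<And>j t. j < 2 * h \<Longrightarrow> t \<in> {0..1} \<Longrightarrow> norm (\<alpha> j t) = 1"
    and start: "\<And>j. j < 2 * h \<Longrightarrow> \<alpha> j 0 = P (own j)"
    and inj: "\<And>j k s t. j < 2 * h \<Longrightarrow> k < 2 * h \<Longrightarrow> s \<in> {0..1} \<Longrightarrow> t \<in> {0..1} \<Longrightarrow> \<alpha> j s = \<alpha> k t \<Longrightarrow>
       j = k \<and> s = t \<or> s = 0 \<and> t = 0"
    and off: "\<And>j t v. j < 2 * h \<Longrightarrow> t \<in> {0<..1} \<Longrightarrow> v \<in> V \<Longrightarrow> \<alpha> j t \<noteq> P v"
    and sep: "\<And>j k t. j < 2 * h \<Longrightarrow> k < 2 * h \<Longrightarrow> j \<noteq> k \<Longrightarrow> t \<in> {0..1} \<Longrightarrow> 4 * r < dist (\<alpha> j 1) (\<alpha> k t)"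
    and sepP: "\<And>j v. j < 2 * h \<Longrightarrow> v \<in> V \<Longrightarrow> 4 * r < dist (\<alpha> j 1) (P v)"
begin

definition a :: "nat \<Rightarrow> real ^ 3" where "a i = \<alpha> (2 * i) 1"
definition b :: "nat \<Rightarrow> real ^ 3" where "b i = \<alpha> (2 * i + 1) 1"

sublocale handle_caps h a b r
proof
  fix i j assume "i < h" "j < h"
  show "4 * r < dist (a i) (b j)" unfolding a_def b_def
    using \<open>i < h\<close> \<open>j < h\<close> by (intro sep) (auto, presburger)
  show "4 * r < dist (a i) (a j)" if "i \<noteq> j" unfolding a_def
    using \<open>i < h\<close> \<open>j < h\<close> that by (intro sep) auto
  show "4 * r < dist (b i) (b j)" if "i \<noteq> j" unfolding b_def
    using \<open>i < h\<close> \<open>j < h\<close> that by (intro sep) auto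
qed (use r sphere in \<open>auto simp: a_def b_def\<close>)

lemma far_from_a:
  assumes "i < h" "j < 2 * h" "j \<noteq> 2 * i" "t \<in> {0..1}" shows "r < dist (a i) (\<alpha> j t)"
  using sep[of "2 * i" j t] assms r by (auto simp: a_def)

lemma far_from_b:
  assumes "i < h" "j < 2 * h" "j \<noteq> 2 * i + 1" "t \<in> {0..1}" shows "r < dist (b i) (\<alpha> j t)"
  using sep[of "2 * i + 1" j t] assms r by (auto simp: b_def)

lemma P_far: "i < h \<Longrightarrow> v \<in> V \<Longrightarrow> r < dist (a i) (P v)" "i < h \<Longrightarrow> v \<in> V \<Longrightarrow> r < dist (b i) (P v)"
  using sepP[of "2 * i" v] sepP[of "2 * i + 1" v] r by (auto simp: a_def b_def)

lemma P_mem_M: "v \<in> V \<Longrightarrow> P v \<in> M"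
  using P_far P by (auto simp: mem_M less_imp_le)

lemma q_P: "v \<in> V \<Longrightarrow> q (P v) = P v"
  using P_far by (intro q_id) force

lemma q_eq_P: "norm x = 1 \<Longrightarrow> v \<in> V \<Longrightarrow> q x = P v \<longleftrightarrow> x = P v"
proof
  assume x: "norm x = 1" "v \<in> V" "q x = P v"
  then have "q x = q (P v)" by (simp add: q_P)
  then have "x = P v \<or> R x (P v) \<or> R (P v) x" using q_eq_iff x P by blast
  then show "x = P v" using P_far x(2) RE by (metis less_irrefl)
qed (simp add: q_P)

text \<open>Edge \<open>i\<close> runs along the ray towards \<open>a i\<close> up to the circle, jumps through the gluing to
  the circle around \<open>b i\<close>, and continues on an arc inside that circle and the other ray.\<close>

lemma edge_halves:
  assumes i: "i < h"
  obtains \<rho> \<beta> :: "real \<Rightarrow> real ^ 3" where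
    "continuous_on {0..1} \<rho>" "continuous_on {0..1} \<beta>" "inj_on \<rho> {0..1}" "inj_on \<beta> {0..1}"
    "\<rho> 0 = P (own (2 * i))" "\<beta> 0 = P (own (2 * i + 1))" "\<beta> 1 = \<tau> i (\<rho> 1)"
    "\<rho> ` {0..1} \<subseteq> \<alpha> (2 * i) ` {0..1}" "dist (a i) (\<rho> 1) = r"
    "\<forall>s\<in>{0..<1}. r < dist (a i) (\<rho> s)"
    "\<beta> ` {0..1} \<subseteq> (M \<inter> \<alpha> (2 * i + 1) ` {0..1}) \<union> cap_boundary (b i) r"
proof -
  have i2: "2 * i < 2 * h" "2 * i + 1 < 2 * h" using i by auto
  have va: "own (2 * i) \<in> V" "own (2 * i + 1) \<in> V" using own i2 by auto
  obtain ta where ta: "0 < ta" "ta < 1" "dist (a i) (\<alpha> (2 * i) ta) = r"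
    "\<And>s. 0 \<le> s \<Longrightarrow> s < ta \<Longrightarrow> r < dist (a i) (\<alpha> (2 * i) s)"
    by (rule first_hit[OF cont[OF i2(1)], of r "a i"])
      (use r P_far(1)[OF i va(1)] start i2 in \<open>auto simp: a_def b_def\<close>)
  obtain tb where tb: "0 < tb" "tb < 1" "dist (b i) (\<alpha> (2 * i + 1) tb) = r"
    "\<And>s. 0 \<le> s \<Longrightarrow> s < tb \<Longrightarrow> r < dist (b i) (\<alpha> (2 * i + 1) s)"
    by (rule first_hit[OF cont[OF i2(2)], of r "b i"])
      (use r P_far(2)[OF i va(2)] start i2 in \<open>auto simp: a_def b_def\<close>)
  define \<rho> where "\<rho> = (\<lambda>s. \<alpha> (2 * i) (ta * s))"
  have dom: "ta * s \<in> {0..1}" "ta * s \<le> ta" if "s \<in> {0..1}" for s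
  proof -
    have "0 \<le> ta * s" "ta * s \<le> ta" using that ta mult_left_mono[of s 1 ta] by auto
    moreover from this have "ta * s \<le> 1" using ta(2) by linarith
    ultimately show "ta * s \<in> {0..1}" "ta * s \<le> ta" by simp_all
  qed
  have c\<rho>: "continuous_on {0..1} \<rho>"
    unfolding \<rho>_def
    by (rule continuous_on_compose2[OF cont[OF i2(1)]]) (use dom in \<open>auto intro!: continuous_intros\<close>)
  have inj\<rho>: "inj_on \<rho> {0..1}"
  proof (rule inj_onI)
    fix s t assume "s \<in> {0..1}" "t \<in> {0..1}" "\<rho> s = \<rho> t"
    then have "ta * s = ta * t"
      using inj[OF i2(1) i2(1), of "ta * s" "ta * t"] dom unfolding \<rho>_def by metis
    then show "s = t" using ta by simp
  qed
  have z: "norm (\<rho> 1) = 1" "dist (a i) (\<rho> 1) = r"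
    using ta sphere[OF i2(1), of ta] by (auto simp: \<rho>_def)
  define z where "z = \<tau> i (\<rho> 1)"
  have zb: "norm z = 1" "dist (b i) z = r" using z tau[OF i] by (auto simp: z_def)
  \<comment> \<open>The reflected point \<open>z\<close> need not be the point where the second
    half-edge reaches its circle. The whole circle is therefore added, and an arc from the vertex to
    \<open>z\<close> is chosen in the path connected union.\<close>
  define S where "S = \<alpha> (2 * i + 1) ` {0..tb} \<union> cap_boundary (b i) r"
  have "path_connected S"
    unfolding S_def
  proof (rule path_connected_Un)
    show "path_connected (\<alpha> (2 * i + 1) ` {0..tb})"
      using tb by (intro path_connected_continuous_image continuous_on_subset[OF cont[OF i2(2)]]) auto
    show "path_connected (cap_boundary (b i) r)"
      by (rule path_connected_cap_boundary(1)[OF handle_caps.b[OF handle_caps_axioms i] r])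
    have "\<alpha> (2 * i + 1) tb \<in> \<alpha> (2 * i + 1) ` {0..tb} \<inter> cap_boundary (b i) r"
      using tb sphere[OF i2(2), of tb] by (auto simp: cap_boundary_def)
    then show "\<alpha> (2 * i + 1) ` {0..tb} \<inter> cap_boundary (b i) r \<noteq> {}" by blast
  qed
  moreover have "P (own (2 * i + 1)) \<in> S"
    using tb start[OF i2(2)] by (auto simp: S_def intro!: image_eqI[of _ _ 0])
  moreover have "z \<in> S" using zb by (auto simp: S_def cap_boundary_def)
  moreover have "P (own (2 * i + 1)) \<noteq> z" using zb P_far(2)[OF i va(2)] by auto
  ultimately obtain \<beta> where \<beta>: "arc \<beta>" "path_image \<beta> \<subseteq> S" "pathstart \<beta> = P (own (2 * i + 1))"
    "pathfinish \<beta> = z"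
    unfolding path_connected_arcwise by blast
  have "\<alpha> (2 * i + 1) s \<in> M" if "s \<in> {0..tb}" for s
    unfolding mem_M
  proof (intro conjI allI impI)
    have s: "s \<in> {0..1}" using that tb by auto
    show "norm (\<alpha> (2 * i + 1) s) = 1" by (rule sphere[OF i2(2) s])
    fix k assume k: "k < h"
    show "r \<le> dist (a k) (\<alpha> (2 * i + 1) s)"
    proof -
      have "2 * i + 1 \<noteq> 2 * k" by presburger
      then show ?thesis using far_from_a[OF k i2(2) _ s] by simp
    qed
    show "r \<le> dist (b k) (\<alpha> (2 * i + 1) s)"
    proof (cases "k = i")
      case True
      then show ?thesis using tb(3) tb(4)[of s] that by (cases "s = tb") auto
    qed (use far_from_b[OF k i2(2) _ s] in auto)
  qed
  then have "S \<subseteq> (M \<inter> \<alpha> (2 * i + 1) ` {0..1}) \<union> cap_boundary (b i) r"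
    using tb by (auto simp: S_def)
  then have \<beta>S: "\<beta> ` {0..1} \<subseteq> (M \<inter> \<alpha> (2 * i + 1) ` {0..1}) \<union> cap_boundary (b i) r"
    using \<beta>(2) by (auto simp: path_image_def)
  show ?thesis
  proof (rule that[OF c\<rho> _ inj\<rho> _ _ _ _ _ z(2) _ \<beta>S])
    show "continuous_on {0..1} \<beta>" "inj_on \<beta> {0..1}" using \<beta>(1) by (auto simp: arc_def path_def)
    show "\<beta> 0 = P (own (2 * i + 1))" "\<beta> 1 = \<tau> i (\<rho> 1)"
      using \<beta>(3,4) by (auto simp: pathstart_def pathfinish_def z_def)
    show "\<rho> 0 = P (own (2 * i))" using start[OF i2(1)] by (simp add: \<rho>_def)
    show "\<rho> ` {0..1} \<subseteq> \<alpha> (2 * i) ` {0..1}" using dom by (auto simp: \<rho>_def)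
    show "\<forall>s\<in>{0..<1}. r < dist (a i) (\<rho> s)"
      using ta(4) ta(1) by (auto simp: \<rho>_def)
  qed
qed

text \<open>The halves are joined at their last points, which the gluing identifies; no other point
  of one half is equal or glued to a point of the other, hence injectivity after applying
  \<open>q\<close>. The final inclusion records where the interior may lie, which is what separates
  different edges later.\<close>

lemma edge_path:
  assumes i: "i < h"
  obtains \<delta> :: "real \<Rightarrow> real ^ 3" where
    "\<delta> 0 = P (own (2 * i))" "\<delta> 1 = P (own (2 * i + 1))"
    "pathin X (q \<circ> \<delta>)" "inj_on (q \<circ> \<delta>) {0..1}" "\<delta> ` {0..1} \<subseteq> M"
    "\<delta> ` {0<..<1} \<subseteq> \<alpha> (2 * i) ` {0<..1} \<union> \<alpha> (2 * i + 1) ` {0<..1} \<union> cap_boundary (b i) r"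
proof -
  have i2: "2 * i < 2 * h" "2 * i + 1 < 2 * h" using i by auto
  obtain \<rho> \<beta> :: "real \<Rightarrow> real ^ 3" where
    c: "continuous_on {0..1} \<rho>" "continuous_on {0..1} \<beta>" and
    inj': "inj_on \<rho> {0..1}" "inj_on \<beta> {0..1}" and
    ends: "\<rho> 0 = P (own (2 * i))" "\<beta> 0 = P (own (2 * i + 1))" "\<beta> 1 = \<tau> i (\<rho> 1)" and
    \<rho>: "\<rho> ` {0..1} \<subseteq> \<alpha> (2 * i) ` {0..1}" "dist (a i) (\<rho> 1) = r"
      "\<forall>s\<in>{0..<1}. r < dist (a i) (\<rho> s)" and
    \<beta>: "\<beta> ` {0..1} \<subseteq> (M \<inter> \<alpha> (2 * i + 1) ` {0..1}) \<union> cap_boundary (b i) r"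
    by (rule edge_halves[OF i])
  have \<rho>': "norm (\<rho> s) = 1 \<and> \<rho> s \<in> \<alpha> (2 * i) ` {0..1} \<and>
      (\<forall>k<h. r < dist (b k) (\<rho> s)) \<and> (\<forall>k<h. k \<noteq> i \<longrightarrow> r < dist (a k) (\<rho> s)) \<and>
      r \<le> dist (a i) (\<rho> s)" if s: "s \<in> {0..1}" for s
  proof -
    obtain t where t: "\<rho> s = \<alpha> (2 * i) t" "t \<in> {0..1}" using \<rho>(1) s by blast
    have "r < dist (b k) (\<rho> s)" if "k < h" for k
    proof -
      have "2 * i \<noteq> 2 * k + 1" by presburger
      then show ?thesis unfolding t(1) by (rule far_from_b[OF that i2(1) _ t(2)])
    qed
    moreover have "r < dist (a k) (\<rho> s)" if "k < h" "k \<noteq> i" for k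
      unfolding t(1) using far_from_a[OF that(1) i2(1) _ t(2)] that(2) by simp
    moreover have "r \<le> dist (a i) (\<rho> s)"
      using \<rho>(2) \<rho>(3) s by (cases "s = 1") (auto simp: less_imp_le)
    ultimately show ?thesis using t sphere[OF i2(1) t(2)] by auto
  qed
  then have \<rho>M: "\<rho> s \<in> M" if "s \<in> {0..1}" for s
    unfolding mem_M using that by (metis less_imp_le)
  have cbM: "x \<in> M" if "x \<in> cap_boundary (b i) r" for x
    using that tau_mem_M(2)[OF i, of x] r by (auto simp: cap_boundary_def)
  then have \<beta>M: "\<beta> s \<in> M" if "s \<in> {0..1}" for s using \<beta> that by blast
  have \<beta>a: "r < dist (a k) (\<beta> s)" if s: "s \<in> {0..1}" and k: "k < h" for s k
  proof -
    have "\<beta> s \<in> \<alpha> (2 * i + 1) ` {0..1} \<or> dist (b i) (\<beta> s) = r"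
      using \<beta>[unfolded image_subset_iff, rule_format, OF s] by (auto simp: cap_boundary_def)
    then show ?thesis
    proof
      assume "\<beta> s \<in> \<alpha> (2 * i + 1) ` {0..1}"
      then obtain t where t: "\<beta> s = \<alpha> (2 * i + 1) t" "t \<in> {0..1}" by blast
      have "2 * i + 1 \<noteq> 2 * k" by presburger
      then show ?thesis unfolding t(1) by (rule far_from_a[OF k i2(2) _ t(2)])
    next
      assume "dist (b i) (\<beta> s) = r"
      then show ?thesis using near_b(1)[OF i _ k, of "\<beta> s"] r by simp
    qed
  qed
  have q\<rho>: "s = t" if "s \<in> {0..1}" "t \<in> {0..1}" "q (\<rho> s) = q (\<rho> t)" for s t
  proof -
    have "\<not> R x y" if "y \<in> \<rho> ` {0..1}" for x y
      using RE[of x y] \<rho>' that by (metis imageE less_irrefl)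
    then have "\<rho> s = \<rho> t" using q_eq_iff[of "\<rho> s" "\<rho> t"] that \<rho>' by blast
    then show ?thesis using inj'(1) that by (auto dest: inj_onD)
  qed
  have q\<beta>: "s = t" if "s \<in> {0..1}" "t \<in> {0..1}" "q (\<beta> s) = q (\<beta> t)" for s t
  proof -
    have "\<not> R x y" if "x \<in> \<beta> ` {0..1}" for x y
      using RE[of x y] \<beta>a that by (metis imageE less_irrefl)
    then have "\<beta> s = \<beta> t" using q_eq_iff[of "\<beta> s" "\<beta> t"] that \<beta>M mem_M by blast
    then show ?thesis using inj'(2) that by (auto dest: inj_onD)
  qed
  have q\<rho>\<beta>: "s = 1 \<and> t = 1" if s: "s \<in> {0..1}" and t: "t \<in> {0..1}" and e: "q (\<rho> s) = q (\<beta> t)" for s t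
  proof -
    have "\<rho> s \<noteq> \<beta> t"
    proof
      assume eq: "\<rho> s = \<beta> t"
      have "dist (b i) (\<rho> s) \<noteq> r" using \<rho>'[OF s] i by force
      then have "\<beta> t \<in> \<alpha> (2 * i + 1) ` {0..1}" using \<beta> t eq by (force simp: cap_boundary_def)
      then obtain t' where t': "\<beta> t = \<alpha> (2 * i + 1) t'" "t' \<in> {0..1}" by blast
      obtain s' where s': "\<rho> s = \<alpha> (2 * i) s'" "s' \<in> {0..1}" using \<rho>'[OF s] by blast
      have "\<alpha> (2 * i) s' = \<alpha> (2 * i + 1) t'" using eq s' t' by simp
      moreover from this have "s' = 0" "t' = 0" using inj[OF i2 s'(2) t'(2)] by auto
      ultimately have "P (own (2 * i)) = P (own (2 * i + 1))" using start i2 by simp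
      then show False using P(2) own i2 i by (meson inj_onD)
    qed
    moreover have "\<not> R (\<beta> t) (\<rho> s)" using RE[of "\<beta> t" "\<rho> s"] \<beta>a[OF t] by (metis less_irrefl)
    ultimately have "R (\<rho> s) (\<beta> t)"
      using q_eq_iff[of "\<rho> s" "\<beta> t"] e \<rho>'[OF s] \<beta>M[OF t] mem_M by blast
    then obtain k where k: "k < h" "dist (a k) (\<rho> s) = r" "\<beta> t = \<tau> k (\<rho> s)" by (rule RE)
    have "k = i" using \<rho>'[OF s] k(1,2) by force
    then have "s = 1" using \<rho>(3) s k(2) by (cases "s = 1") auto
    then have "\<beta> t = \<beta> 1" using k(3) \<open>k = i\<close> ends(3) by simp
    then have "t = 1" using inj'(2) t by (auto dest: inj_onD)
    then show ?thesis using \<open>s = 1\<close> by simp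
  qed
  \<comment> \<open>The second half is run backwards, from the glued point at parameter 1/2 to the
    other vertex at parameter 1.\<close>
  define \<delta> where "\<delta> = (\<lambda>s. if s \<le> 1 / 2 then \<rho> (2 * s) else \<beta> (2 - 2 * s))"
  have "pathin X (\<lambda>s. if s \<le> 1 / 2 then q (\<rho> (2 * s)) else q (\<beta> (2 - 2 * s)))"
    unfolding pathin_def
  proof (rule continuous_map_cases_le)
    have *: "continuous_map (top_of_set S) X (\<lambda>s. q (k s))"
      if "continuous_on S k" "k ` S \<subseteq> M" for S :: "real set" and k
    proof -
      have "continuous_map (top_of_set S) (top_of_set M) k"
        using that by (auto simp: continuous_map_in_subtopology)
      then have "continuous_map (top_of_set S) X (q \<circ> k)"
        using quotient_imp_continuous_map[OF quotient_q] continuous_map_compose by blast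
      then show ?thesis by (simp add: o_def)
    qed
    have 1: "{0..1} \<inter> {x \<in> topspace (top_of_set {0..1}). x \<le> 1 / 2} = {0..1/2::real}"
      and 2: "{0..1} \<inter> {x \<in> topspace (top_of_set {0..1}). 1 / 2 \<le> x} = {1/2..1::real}" by auto
    have "continuous_map (top_of_set {0..1/2}) X (\<lambda>s. q (\<rho> (2 * s)))"
    proof (rule *)
      show "continuous_on {0..1/2} (\<lambda>s. \<rho> (2 * s))"
        by (rule continuous_on_compose2[OF c(1)]) (auto intro!: continuous_intros)
    qed (use \<rho>M in auto)
    then show "continuous_map (subtopology (top_of_set {0..1}) {x \<in> topspace (top_of_set {0..1}). x \<le> 1 / 2}) X (\<lambda>s. q (\<rho> (2 * s)))"
      unfolding subtopology_subtopology 1 .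
    have "continuous_map (top_of_set {1/2..1}) X (\<lambda>s. q (\<beta> (2 - 2 * s)))"
    proof (rule *)
      show "continuous_on {1/2..1} (\<lambda>s. \<beta> (2 - 2 * s))"
        by (rule continuous_on_compose2[OF c(2)]) (auto intro!: continuous_intros)
    qed (use \<beta>M in auto)
    then show "continuous_map (subtopology (top_of_set {0..1}) {x \<in> topspace (top_of_set {0..1}). 1 / 2 \<le> x}) X (\<lambda>s. q (\<beta> (2 - 2 * s)))"
      unfolding subtopology_subtopology 2 .
    show "q (\<rho> (2 * x)) = q (\<beta> (2 - 2 * x))" if "x = 1 / 2" for x
    proof -
      have "R (\<rho> 1) (\<tau> i (\<rho> 1))" using RI[OF i] \<rho>'[of 1] \<rho>(2) by simp
      then have "q (\<rho> 1) = q (\<beta> 1)" using R_imp_q_eq ends(3) by simp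
      moreover have "2 * x = 1" "2 - 2 * x = 1" using that by simp_all
      ultimately show ?thesis by metis
    qed
  qed auto
  moreover have "(\<lambda>s. if s \<le> 1 / 2 then q (\<rho> (2 * s)) else q (\<beta> (2 - 2 * s))) = q \<circ> \<delta>"
    by (auto simp: \<delta>_def)
  ultimately have path: "pathin X (q \<circ> \<delta>)" by simp
  have inj\<delta>: "inj_on (q \<circ> \<delta>) {0..1}"
  proof (rule inj_onI)
    fix s t :: real assume st: "s \<in> {0..1}" "t \<in> {0..1}" "(q \<circ> \<delta>) s = (q \<circ> \<delta>) t"
    consider "s \<le> 1/2" "t \<le> 1/2" | "s \<le> 1/2" "1/2 < t" | "1/2 < s" "t \<le> 1/2" | "1/2 < s" "1/2 < t"
      by linarith
    then show "s = t"
    proof cases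
      case 1
      then show ?thesis using q\<rho>[of "2 * s" "2 * t"] st by (auto simp: \<delta>_def)
    next
      case 2
      then show ?thesis using q\<rho>\<beta>[of "2 * s" "2 - 2 * t"] st by (auto simp: \<delta>_def)
    next
      case 3
      then show ?thesis using q\<rho>\<beta>[of "2 * t" "2 - 2 * s"] st by (auto simp: \<delta>_def)
    next
      case 4
      then show ?thesis using q\<beta>[of "2 - 2 * s" "2 - 2 * t"] st by (auto simp: \<delta>_def)
    qed
  qed
  have "\<delta> s \<in> \<alpha> (2 * i) ` {0<..1} \<union> \<alpha> (2 * i + 1) ` {0<..1} \<union> cap_boundary (b i) r"
    if s: "s \<in> {0<..<1}" for s
  proof (cases "s \<le> 1 / 2")
    case True
    then have "\<rho> (2 * s) \<in> \<alpha> (2 * i) ` {0..1}" using s \<rho>(1) by auto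
    then obtain t where t: "\<rho> (2 * s) = \<alpha> (2 * i) t" "t \<in> {0..1}" by blast
    have "t \<noteq> 0"
    proof
      assume "t = 0"
      then have "\<rho> (2 * s) = \<rho> 0" using t ends(1) start[OF i2(1)] by simp
      then show False using inj'(1) True s by (auto dest: inj_onD)
    qed
    then show ?thesis using t True by (auto simp: \<delta>_def)
  next
    case False
    then have "2 - 2 * s \<in> {0..1}" using s by auto
    then have "\<beta> (2 - 2 * s) \<in> \<alpha> (2 * i + 1) ` {0..1} \<union> cap_boundary (b i) r"
      using \<beta>[unfolded image_subset_iff, rule_format] by blast
    then show ?thesis
    proof
      assume "\<beta> (2 - 2 * s) \<in> \<alpha> (2 * i + 1) ` {0..1}"
      then obtain t where t: "\<beta> (2 - 2 * s) = \<alpha> (2 * i + 1) t" "t \<in> {0..1}" by blast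
      have "t \<noteq> 0"
      proof
        assume "t = 0"
        then have "\<beta> (2 - 2 * s) = \<beta> 0" using t ends(2) start[OF i2(2)] by simp
        then show False using inj'(2) False s by (auto dest: inj_onD)
      qed
      then show ?thesis using t False by (auto simp: \<delta>_def)
    qed (use False in \<open>simp add: \<delta>_def\<close>)
  qed
  then have 6: "\<delta> ` {0<..<1} \<subseteq> \<alpha> (2 * i) ` {0<..1} \<union> \<alpha> (2 * i + 1) ` {0<..1} \<union> cap_boundary (b i) r"
    by blast
  show ?thesis
  proof (rule that[OF _ _ path inj\<delta> _ 6])
    show "\<delta> ` {0..1} \<subseteq> M" using \<rho>M \<beta>M by (auto simp: \<delta>_def)
  qed (use ends in \<open>auto simp: \<delta>_def\<close>)
qed

text \<open>The interior of edge \<open>i\<close> stays on its own half-edges and on the circle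
  around \<open>b i\<close>, so the only gluing circles it can touch are those of handle
  \<open>i\<close>. The gluing thus never identifies interior points of different edges, and
  disjointness is inherited from the half-edges.\<close>

lemma embeds_in_X:
  assumes e: "bij_betw e {..<h} E" "\<And>i. i < h \<Longrightarrow> e i = {own (2 * i), own (2 * i + 1)}"
  shows "embeds_in (V, E) X"
proof -
  have "\<forall>i\<in>{..<h}. \<exists>\<delta>. \<delta> 0 = P (own (2 * i)) \<and> \<delta> 1 = P (own (2 * i + 1)) \<and>
    pathin X (q \<circ> \<delta>) \<and> inj_on (q \<circ> \<delta>) {0..1} \<and> \<delta> ` {0..1} \<subseteq> M \<and>
    \<delta> ` {0<..<1} \<subseteq> \<alpha> (2 * i) ` {0<..1} \<union> \<alpha> (2 * i + 1) ` {0<..1} \<union> cap_boundary (b i) r"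
    using edge_path by (metis lessThan_iff)
  from bchoice[OF this] obtain \<delta> where \<delta>': "\<forall>i\<in>{..<h}. \<delta> i 0 = P (own (2 * i)) \<and>
    \<delta> i 1 = P (own (2 * i + 1)) \<and>
    pathin X (q \<circ> \<delta> i) \<and> inj_on (q \<circ> \<delta> i) {0..1} \<and> \<delta> i ` {0..1} \<subseteq> M \<and>
    \<delta> i ` {0<..<1} \<subseteq> \<alpha> (2 * i) ` {0<..1} \<union> \<alpha> (2 * i + 1) ` {0<..1} \<union> cap_boundary (b i) r"
    by blast
  then have \<delta>: "\<And>i. i < h \<Longrightarrow> \<delta> i 0 = P (own (2 * i))"
    "\<And>i. i < h \<Longrightarrow> \<delta> i 1 = P (own (2 * i + 1))"
    "\<And>i. i < h \<Longrightarrow> pathin X (q \<circ> \<delta> i)" "\<And>i. i < h \<Longrightarrow> inj_on (q \<circ> \<delta> i) {0..1}"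
    "\<And>i. i < h \<Longrightarrow> \<delta> i ` {0..1} \<subseteq> M"
    and loc: "\<And>i. i < h \<Longrightarrow> \<delta> i ` {0<..<1} \<subseteq> \<alpha> (2 * i) ` {0<..1} \<union> \<alpha> (2 * i + 1) ` {0<..1} \<union> cap_boundary (b i) r"
    by simp_all
  define ix where "ix = the_inv_into {..<h} e"
  have ix: "ix f < h" "e (ix f) = f" if "f \<in> E" for f
    using e(1) that f_the_inv_into_f_bij_betw[of e "{..<h}" E f] bij_betw_the_inv_into[OF e(1)]
    by (auto simp: ix_def bij_betw_def)
  have M1: "norm (\<delta> i s) = 1" if "i < h" "s \<in> {0<..<1}" for i s
  proof -
    have "\<delta> i s \<in> M" using \<delta>(5)[OF that(1)] that(2) by force
    then show ?thesis by (simp add: mem_M)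
  qed
  have noP: "q (\<delta> i s) \<noteq> P v" if "i < h" "s \<in> {0<..<1}" "v \<in> V" for i s v
  proof -
    have "\<delta> i s \<in> \<alpha> (2 * i) ` {0<..1} \<union> \<alpha> (2 * i + 1) ` {0<..1} \<union> cap_boundary (b i) r"
      using loc that by blast
    then have "\<delta> i s \<noteq> P v"
      using off[of "2 * i" _ v] off[of "2 * i + 1" _ v] that(1,3) P_far(2)[OF that(1,3)]
      by (auto simp: cap_boundary_def)
    then show ?thesis using q_eq_P M1 that by blast
  qed
  have circ: "k = i" if i: "i < h" and s: "s \<in> {0<..<1}" and k: "k < h"
    and d: "dist (a k) (\<delta> i s) = r \<or> dist (b k) (\<delta> i s) = r" for i k s
  proof (rule ccontr)
    assume "k \<noteq> i"
    have "\<delta> i s \<in> \<alpha> (2 * i) ` {0<..1} \<union> \<alpha> (2 * i + 1) ` {0<..1} \<union> cap_boundary (b i) r"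
      using loc i s by blast
    moreover have False if "\<delta> i s = \<alpha> j t" "t \<in> {0<..1}" "j = 2 * i \<or> j = 2 * i + 1" for j t
    proof -
      have "j \<noteq> 2 * k" "j \<noteq> 2 * k + 1" "j < 2 * h"
        using that(3) \<open>k \<noteq> i\<close> i by presburger+
      moreover have "t \<in> {0..1}" using that(2) by simp
      ultimately have *: "r < dist (a k) (\<alpha> j t)" "r < dist (b k) (\<alpha> j t)"
        using far_from_a[OF k] far_from_b[OF k] by simp_all
      then show False using d that(1) by auto
    qed
    moreover have False if "\<delta> i s \<in> cap_boundary (b i) r"
    proof -
      have "dist (b i) (\<delta> i s) \<le> 2 * r" using that r by (simp add: cap_boundary_def)
      then show False using near_b[OF i _ k] \<open>k \<noteq> i\<close> d r by fastforce
    qed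
    ultimately show False by blast
  qed
  have disj: "q (\<delta> i s) \<noteq> q (\<delta> k t)"
    if ik: "i < h" "k < h" "i \<noteq> k" and st: "s \<in> {0<..<1}" "t \<in> {0<..<1}" for i k s t
  proof
    assume "q (\<delta> i s) = q (\<delta> k t)"
    then have "\<delta> i s = \<delta> k t \<or> R (\<delta> i s) (\<delta> k t) \<or> R (\<delta> k t) (\<delta> i s)"
      using q_eq_iff M1 ik st by blast
    moreover have nR: "\<not> R (\<delta> i s) (\<delta> k t)"
      if "i < h" "k < h" "i \<noteq> k" "s \<in> {0<..<1}" "t \<in> {0<..<1}" for i k s t
      using RE[of "\<delta> i s" "\<delta> k t"] circ that by metis
    ultimately have eq: "\<delta> i s = \<delta> k t" using ik st by blast
    have "dist (b i) (\<delta> k t) \<noteq> r" "dist (b k) (\<delta> i s) \<noteq> r" using circ ik st by metis+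
    then have "\<delta> i s \<in> \<alpha> (2 * i) ` {0<..1} \<union> \<alpha> (2 * i + 1) ` {0<..1}"
      "\<delta> k t \<in> \<alpha> (2 * k) ` {0<..1} \<union> \<alpha> (2 * k + 1) ` {0<..1}"
      using loc[OF ik(1), unfolded image_subset_iff, rule_format, OF st(1)]
        loc[OF ik(2), unfolded image_subset_iff, rule_format, OF st(2)] eq
      by (simp_all add: cap_boundary_def)
    then obtain j l s' t' where "\<delta> i s = \<alpha> j s'" "\<delta> k t = \<alpha> l t'" "s' \<in> {0<..1}" "t' \<in> {0<..1}"
      "j \<in> {2 * i, 2 * i + 1}" "l \<in> {2 * k, 2 * k + 1}"
      by (auto simp del: greaterThanAtMost_iff)
    moreover from this(5,6) have "j \<noteq> l" "j < 2 * h" "l < 2 * h"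
      using ik unfolding insert_iff empty_iff by presburger+
    ultimately show False using inj[of j l s' t'] eq by auto
  qed
  have PX: "P ` V \<subseteq> topspace X"
    using P_mem_M q_P by (force simp: topspace_X)
  show ?thesis
    unfolding embeds_in.simps
  proof (intro exI[of _ P] exI[of _ "\<lambda>f. q \<circ> \<delta> (ix f)"] conjI ballI impI PX P(2))
    fix f assume f: "f \<in> E"
    note i = ix[OF f]
    show "pathin X (q \<circ> \<delta> (ix f))" "inj_on (q \<circ> \<delta> (ix f)) {0..1}" using \<delta> i by auto
    have "own (2 * ix f) \<in> V" "own (2 * ix f + 1) \<in> V" using own(1) i by auto
    moreover have "P ` f = {P (own (2 * ix f)), P (own (2 * ix f + 1))}"
      using e(2)[OF i(1)] unfolding i(2) by (metis image_insert image_empty)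
    ultimately show "{(q \<circ> \<delta> (ix f)) 0, (q \<circ> \<delta> (ix f)) 1} = P ` f"
      using \<delta>(1,2)[OF i(1)] q_P by simp
    show "(q \<circ> \<delta> (ix f)) ` {0<..<1} \<inter> P ` V = {}" using noP i by auto
  next
    fix f g assume fg: "f \<in> E" "g \<in> E" "f \<noteq> g"
    then have "ix f \<noteq> ix g" using ix by metis
    then show "(q \<circ> \<delta> (ix f)) ` {0<..<1} \<inter> (q \<circ> \<delta> (ix g)) ` {0<..<1} = {}"
      using disj[OF ix(1)[OF fg(1)] ix(1)[OF fg(2)]] by (auto simp del: greaterThanLessThan_iff)
  qed
qed

end

text \<open>The inverse of the gnomonic projection: the plane at height 1 is projected from the
  origin onto an open hemisphere. It transfers a drawing by straight segments to the sphere.\<close>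

definition gnomonic :: "real \<times> real \<Rightarrow> real ^ 3" where
  "gnomonic p = sgn (vector [fst p, snd p, 1])"

lemma norm_gnomonic: "norm (gnomonic p) = 1"
proof -
  have "(vector [fst p, snd p, 1] :: real ^ 3) $ 3 \<noteq> 0 $ 3" by simp
  then have "(vector [fst p, snd p, 1] :: real ^ 3) \<noteq> 0" by metis
  then show ?thesis by (simp add: gnomonic_def norm_sgn)
qed

lemma gnomonic_inject: "gnomonic p = gnomonic p' \<longleftrightarrow> p = p'"
proof
  assume eq: "gnomonic p = gnomonic p'"
  define v where "v = (\<lambda>p :: real \<times> real. vector [fst p, snd p, 1] :: real ^ 3)"
  have v: "v p $ 1 = fst p" "v p $ 2 = snd p" "v p $ 3 = 1" for p by (simp_all add: v_def)
  have g: "gnomonic p $ k = v p $ k / norm (v p)" for p k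
    by (simp add: gnomonic_def v_def sgn_div_norm divide_inverse mult.commute)
  have n: "norm (v p) \<noteq> 0" for p
    using v(3)[of p] by (metis norm_eq_zero zero_index zero_neq_one)
  have "1 / norm (v p) = 1 / norm (v p')" using eq g[of _ 3] v(3) by metis
  then have "norm (v p) = norm (v p')" by simp
  then have "v p $ k = v p' $ k" for k using eq g[of _ k] n by (metis nonzero_mult_div_cancel_right times_divide_eq_left)
  then show "p = p'" using v by (metis prod_eq_iff)
qed simp

lemma continuous_on_gnomonic: "continuous_on S gnomonic"
proof -
  have "continuous_on S (\<lambda>p :: real \<times> real. vector [fst p, snd p, 1] :: real ^ 3)"
    by (subst continuous_on_componentwise)
      (auto simp: Basis_vec_def inner_axis forall_3 intro!: continuous_intros)
  moreover have "(vector [fst p, snd p, 1] :: real ^ 3) \<noteq> 0" for p :: "real \<times> real"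
    by (metis vector_3(3) zero_index zero_neq_one)
  ultimately show ?thesis
    unfolding gnomonic_def by (intro continuous_on_sgn) auto
qed

text \<open>Recovers the number of the starting vertex from the horizontal coordinate of a point on
  a half-edge.\<close>

lemma nat_part_unique:
  fixes m n :: nat
  assumes "0 \<le> d" "d < 1" "0 \<le> e" "e < 1" "real m + d = real n + e"
  shows "m = n"
proof -
  have "real m < real n + 1" "real n < real m + 1" using assms by linarith+
  then show ?thesis by linarith
qed

text \<open>The vertices are spread along a line, and the ends of the half-edges at vertex number \<open>k\<close>
  lie on a parallel line, in the unit interval starting at \<open>k\<close>.\<close>

lemma exists_handle_drawing:
  fixes V :: "'v set"
  assumes V: "finite V" and own: "\<And>j. j < 2 * h \<Longrightarrow> own j \<in> V"
    "\<And>i. i < h \<Longrightarrow> own (2 * i) \<noteq> own (2 * i + 1)"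
  obtains P \<alpha> r where "handle_drawing h V P own \<alpha> r"
proof -
  obtain \<nu> :: "'v \<Rightarrow> nat" where \<nu>: "inj_on \<nu> V"
    using finite_imp_inj_to_nat_seg[OF V] by blast
  \<comment> \<open>The offsets are distinct, so segments from one vertex diverge, and they lie
    below 1, so segments from different vertices stay in disjoint strips. The added 1 also keeps the
    denominator positive for \<open>h = 0\<close>.\<close>
  define d where "d = (\<lambda>j. real j / (2 * real h + 1))"
  have d: "0 \<le> d j \<and> d j < 1" if "j < 2 * h" for j using that by (auto simp: d_def field_simps)
  have d_inj: "d j = d k \<longleftrightarrow> j = k" for j k by (simp add: d_def divide_eq_eq)
  define P where "P = (\<lambda>v. gnomonic (real (\<nu> v), 0))"
  define \<alpha> where "\<alpha> = (\<lambda>j t. gnomonic (real (\<nu> (own j)) + t * d j, t))"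
  have inj: "j = k \<and> s = t \<or> s = 0 \<and> t = 0"
    if jk: "j < 2 * h" "k < 2 * h" and st: "s \<in> {0..1}" "t \<in> {0..1}" and eq: "\<alpha> j s = \<alpha> k t" for j k s t
  proof -
    have st': "s = t" and e: "real (\<nu> (own j)) + t * d j = real (\<nu> (own k)) + t * d k"
      using eq by (auto simp: \<alpha>_def gnomonic_inject)
    have "0 \<le> t * d l \<and> t * d l < 1" if "l < 2 * h" for l
      using d[OF that] st(2) mult_left_le_one_le[of "d l" t] by auto
    then have "\<nu> (own j) = \<nu> (own k)" using nat_part_unique e jk by metis
    then have "t = 0 \<or> j = k" using e d_inj by simp
    then show ?thesis using st' by auto
  qed
  have off: "\<alpha> j t \<noteq> P v" if "t \<in> {0<..1}" for j t v
    using that by (simp add: \<alpha>_def P_def gnomonic_inject)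
  have cont: "continuous_on {0..1} (\<alpha> j)" for j
    unfolding \<alpha>_def
    by (rule continuous_on_compose2[OF continuous_on_gnomonic[of UNIV]]) (auto intro!: continuous_intros)
  have "\<exists>e>0. \<forall>y \<in> P ` V \<union> (\<Union>k\<in>{..<2 * h} - {j}. \<alpha> k ` {0..1}). e \<le> dist (\<alpha> j 1) y" if j: "j < 2 * h" for j
  proof -
    have "\<alpha> j 1 \<notin> P ` V" using off[of 1] by auto
    moreover have "\<alpha> j 1 \<notin> \<alpha> k ` {0..1}" if "k < 2 * h" "k \<noteq> j" for k
    proof
      assume "\<alpha> j 1 \<in> \<alpha> k ` {0..1}"
      then obtain t where "t \<in> {0..1}" "\<alpha> j 1 = \<alpha> k t" by blast
      then show False using inj[OF j that(1), of 1 t] that(2) by simp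
    qed
    ultimately have "\<alpha> j 1 \<notin> P ` V \<union> (\<Union>k\<in>{..<2 * h} - {j}. \<alpha> k ` {0..1})" by auto
    moreover have "closed (P ` V \<union> (\<Union>k\<in>{..<2 * h} - {j}. \<alpha> k ` {0..1}))"
      using V by (intro closed_Un closed_UN ballI compact_imp_closed compact_continuous_image cont)
        (auto intro: finite_imp_compact)
    ultimately show ?thesis by (metis separate_point_closed)
  qed
  then have "\<forall>j\<in>{..<2 * h}. \<exists>e>0. \<forall>y \<in> P ` V \<union> (\<Union>k\<in>{..<2 * h} - {j}. \<alpha> k ` {0..1}). e \<le> dist (\<alpha> j 1) y"
    by simp
  from bchoice[OF this] obtain e where e: "\<And>j. j < 2 * h \<Longrightarrow> 0 < e j"
    "\<And>j y. j < 2 * h \<Longrightarrow> y \<in> P ` V \<union> (\<Union>k\<in>{..<2 * h} - {j}. \<alpha> k ` {0..1}) \<Longrightarrow> e j \<le> dist (\<alpha> j 1) y"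
    by (metis lessThan_iff)
  \<comment> \<open>Inserting 1 covers the case \<open>h = 0\<close> and gives \<open>r < 1\<close>;
    dividing by 8 rather than 4 makes \<open>4 * r < e j\<close> strict.\<close>
  define r where "r = Min (insert 1 (e ` {..<2 * h})) / 8"
  have r: "0 < r" "r < 1"
  proof -
    have "0 < Min (insert 1 (e ` {..<2 * h}))" "Min (insert 1 (e ` {..<2 * h})) \<le> 1"
      using e(1) by (auto intro: Min_le)
    then show "0 < r" "r < 1" unfolding r_def by linarith+
  qed
  have re: "4 * r < e j" if "j < 2 * h" for j
  proof -
    have "8 * r \<le> e j" unfolding r_def using that by (auto intro: Min_le)
    then show ?thesis using r by linarith
  qed
  have "handle_drawing h V P own \<alpha> r"
  proof
    show "inj_on P V" using \<nu> by (auto simp: inj_on_def P_def gnomonic_inject)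
    show "4 * r < dist (\<alpha> j 1) (\<alpha> k t)" if "j < 2 * h" "k < 2 * h" "j \<noteq> k" "t \<in> {0..1}" for j k t
      using re[OF that(1)] e(2)[OF that(1), of "\<alpha> k t"] that by fastforce
    show "4 * r < dist (\<alpha> j 1) (P v)" if "j < 2 * h" "v \<in> V" for j v
      using re[OF that(1)] e(2)[OF that(1), of "P v"] that by fastforce
    show "\<alpha> j 0 = P (own j)" for j by (simp add: \<alpha>_def P_def)
  qed (use r own inj off cont in \<open>auto simp: P_def \<alpha>_def norm_gnomonic\<close>)
  then show ?thesis by (rule that)
qed

theorem Euler_genus_le_card_edges:
  assumes G: "finite_simple_graph (V, E)"
  shows "Euler_genus (V, E) \<le> 2 * card E"
proof -
  have V: "finite V" and E: "\<And>f. f \<in> E \<Longrightarrow> f \<subseteq> V \<and> card f = 2" using G by auto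
  have "E \<subseteq> Pow V" using E by auto
  then have fE: "finite E" using V by (meson finite_Pow_iff finite_subset)
  define h where "h = card E"
  obtain e where e: "bij_betw e {..<h} E"
    using ex_bij_betw_nat_finite[OF fE] by (auto simp: h_def atLeast0LessThan)
  have "\<forall>i\<in>{..<h}. \<exists>p. e i = {fst p, snd p} \<and> fst p \<noteq> snd p"
  proof
    fix i assume "i \<in> {..<h}"
    then have "card (e i) = 2" using e E by (auto simp: bij_betw_def)
    then obtain x y where "e i = {x, y}" "x \<noteq> y" by (auto simp: card_2_iff)
    then show "\<exists>p. e i = {fst p, snd p} \<and> fst p \<noteq> snd p" by (intro exI[of _ "(x, y)"]) simp
  qed
  from bchoice[OF this] obtain p where p: "\<forall>i\<in>{..<h}. e i = {fst (p i), snd (p i)} \<and> fst (p i) \<noteq> snd (p i)"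
    by blast
  define own where "own = (\<lambda>j. if even j then fst (p (j div 2)) else snd (p (j div 2)))"
  have own_ends: "e i = {own (2 * i), own (2 * i + 1)}" "own (2 * i) \<noteq> own (2 * i + 1)" if "i < h" for i
    using p that by (auto simp: own_def)
  have own: "own j \<in> V" if "j < 2 * h" for j
  proof -
    have i: "j div 2 < h" using that by auto
    then have "e (j div 2) \<subseteq> V" using e E by (auto simp: bij_betw_def)
    moreover have "own j \<in> e (j div 2)" using p i by (auto simp: own_def)
    ultimately show ?thesis by blast
  qed
  obtain P \<alpha> r where "handle_drawing h V P own \<alpha> r"
    using exists_handle_drawing[OF V own own_ends(2)] by blast
  then interpret handle_drawing h V P own \<alpha> r .
  have "surface_of_Euler_genus (2 * h) X \<and> embeds_in (V, E) X"
    using surface_of_Euler_genus_X embeds_in_X[OF e own_ends(1)] by blast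
  then show ?thesis unfolding Euler_genus_def h_def[symmetric] by (intro Least_le) blast
qed

section \<open>Boxicity and chain covers\<close>

lemma PiE_Int_boxes_nonempty:
  fixes x y :: "nat \<Rightarrow> real"
  assumes "\<And>i. i < d \<Longrightarrow> x i \<le> y i" "\<And>i. i < d \<Longrightarrow> x' i \<le> y' i"
  shows "(\<Pi>\<^sub>E i\<in>{..<d}. {x i..y i}) \<inter> (\<Pi>\<^sub>E i\<in>{..<d}. {x' i..y' i}) \<noteq> {} \<longleftrightarrow>
    (\<forall>i<d. x i \<le> y' i \<and> x' i \<le> y i)"
proof
  assume "(\<Pi>\<^sub>E i\<in>{..<d}. {x i..y i}) \<inter> (\<Pi>\<^sub>E i\<in>{..<d}. {x' i..y' i}) \<noteq> {}"
  then obtain z where z: "z \<in> (\<Pi>\<^sub>E i\<in>{..<d}. {x i..y i})" "z \<in> (\<Pi>\<^sub>E i\<in>{..<d}. {x' i..y' i})" by blast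
  show "\<forall>i<d. x i \<le> y' i \<and> x' i \<le> y i"
  proof (intro allI impI)
    fix i assume "i < d"
    then have "z i \<in> {x i..y i}" "z i \<in> {x' i..y' i}" using z by (auto simp: PiE_iff)
    then show "x i \<le> y' i \<and> x' i \<le> y i" by auto
  qed
next
  assume *: "\<forall>i<d. x i \<le> y' i \<and> x' i \<le> y i"
  have "(\<lambda>i\<in>{..<d}. max (x i) (x' i)) \<in> (\<Pi>\<^sub>E i\<in>{..<d}. {x i..y i}) \<inter> (\<Pi>\<^sub>E i\<in>{..<d}. {x' i..y' i})"
    using * assms by (auto simp: PiE_iff)
  then show "(\<Pi>\<^sub>E i\<in>{..<d}. {x i..y i}) \<inter> (\<Pi>\<^sub>E i\<in>{..<d}. {x' i..y' i}) \<noteq> {}" by blast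
qed

lemma has_box_representation_iff:
  "has_box_representation d (V, E) \<longleftrightarrow>
     (\<exists>x y :: 'a \<Rightarrow> nat \<Rightarrow> real. (\<forall>v\<in>V. \<forall>i<d. x v i \<le> y v i) \<and>
       (\<forall>u\<in>V. \<forall>v\<in>V. u \<noteq> v \<longrightarrow> ({u, v} \<in> E \<longleftrightarrow> (\<forall>i<d. x u i \<le> y v i \<and> x v i \<le> y u i))))"
  (is "?L \<longleftrightarrow> ?R")
proof
  assume ?L
  then obtain B where B: "\<forall>v\<in>V. is_box d (B v)"
    "\<forall>u\<in>V. \<forall>v\<in>V. u \<noteq> v \<longrightarrow> ({u, v} \<in> E \<longleftrightarrow> B u \<inter> B v \<noteq> {})"
    by auto
  have "\<forall>v\<in>V. \<exists>p. (\<forall>i<d. fst p i \<le> snd p i) \<and> B v = (\<Pi>\<^sub>E i\<in>{..<d}. {fst p i..snd p i})"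
  proof
    fix v assume "v \<in> V"
    then obtain x y where "\<forall>i<d. x i \<le> y i" "B v = (\<Pi>\<^sub>E i\<in>{..<d}. {x i..y i})"
      using B(1) unfolding is_box_def by blast
    then show "\<exists>p. (\<forall>i<d. fst p i \<le> snd p i) \<and> B v = (\<Pi>\<^sub>E i\<in>{..<d}. {fst p i..snd p i})"
      by (intro exI[of _ "(x, y)"]) simp
  qed
  from bchoice[OF this] obtain p where p: "\<forall>v\<in>V. (\<forall>i<d. fst (p v) i \<le> snd (p v) i) \<and>
      B v = (\<Pi>\<^sub>E i\<in>{..<d}. {fst (p v) i..snd (p v) i})" by blast
  show ?R
  proof (rule exI[of _ "\<lambda>v. fst (p v)"], rule exI[of _ "\<lambda>v. snd (p v)"], intro conjI ballI impI allI)
    show "fst (p v) i \<le> snd (p v) i" if "v \<in> V" "i < d" for v i using p that by blast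
    show "{u, v} \<in> E \<longleftrightarrow> (\<forall>i<d. fst (p u) i \<le> snd (p v) i \<and> fst (p v) i \<le> snd (p u) i)"
      if "u \<in> V" "v \<in> V" "u \<noteq> v" for u v
    proof -
      have "{u, v} \<in> E \<longleftrightarrow> (\<Pi>\<^sub>E i\<in>{..<d}. {fst (p u) i..snd (p u) i}) \<inter> (\<Pi>\<^sub>E i\<in>{..<d}. {fst (p v) i..snd (p v) i}) \<noteq> {}"
        using B(2) p that by metis
      then show ?thesis using PiE_Int_boxes_nonempty[of d "fst (p u)" "snd (p u)" "fst (p v)" "snd (p v)"] p that by blast
    qed
  qed
next
  assume ?R
  then obtain x y :: "'a \<Rightarrow> nat \<Rightarrow> real" where xy: "(\<forall>v\<in>V. \<forall>i<d. x v i \<le> y v i) \<and>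
    (\<forall>u\<in>V. \<forall>v\<in>V. u \<noteq> v \<longrightarrow> ({u, v} \<in> E \<longleftrightarrow> (\<forall>i<d. x u i \<le> y v i \<and> x v i \<le> y u i)))"
    by (elim exE)
  note xy = xy[THEN conjunct1, rule_format] xy[THEN conjunct2, rule_format]
  show ?L
    unfolding has_box_representation.simps
  proof (intro exI[of _ "\<lambda>v. \<Pi>\<^sub>E i\<in>{..<d}. {x v i..y v i}"] conjI ballI impI)
    show "is_box d (\<Pi>\<^sub>E i\<in>{..<d}. {x v i..y v i})" if "v \<in> V" for v
      unfolding is_box_def using xy(1)[OF that] by blast
    show "{u, v} \<in> E \<longleftrightarrow> (\<Pi>\<^sub>E i\<in>{..<d}. {x u i..y u i}) \<inter> (\<Pi>\<^sub>E i\<in>{..<d}. {x v i..y v i}) \<noteq> {}"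
      if "u \<in> V" "v \<in> V" "u \<noteq> v" for u v
      unfolding xy(2)[OF that]
      using PiE_Int_boxes_nonempty[of d "x u" "y u" "x v" "y v"] xy(1) that by simp
  qed
qed

text \<open>In the coordinate of a vertex \<open>u\<close>, the interval of \<open>u\<close> is \<open>{0}\<close>, its neighbours get
  \<open>[0, 1]\<close>, and all other vertices get \<open>{1}\<close>.\<close>

lemma has_box_representation_card:
  assumes "finite_simple_graph (V, E)"
  shows "has_box_representation (Suc (card V)) (V, E)"
proof -
  obtain e where e: "bij_betw e {..<card V} V"
    using ex_bij_betw_nat_finite[of V] assms by (auto simp: atLeast0LessThan)
  \<comment> \<open>In the additional last coordinate every vertex gets the interval from 0 to 1; it
    makes the dimension at least one even if \<open>V\<close> is empty.\<close>
  define x :: "'a \<Rightarrow> nat \<Rightarrow> real" where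
    "x = (\<lambda>v i. if i < card V \<and> e i \<noteq> v \<and> {e i, v} \<notin> E then 1 else 0)"
  define y :: "'a \<Rightarrow> nat \<Rightarrow> real" where
    "y = (\<lambda>v i. if i < card V \<and> e i = v then 0 else 1)"
  show ?thesis
    unfolding has_box_representation_iff
  proof (rule exI[of _ x], rule exI[of _ y], intro conjI ballI impI allI)
    show "x v i \<le> y v i" for v i by (auto simp: x_def y_def)
    fix u v assume uv: "u \<in> V" "v \<in> V" "u \<noteq> v"
    obtain i where i: "i < card V" "e i = u" using e uv(1) by (metis bij_betw_imp_surj_on imageE lessThan_iff)
    show "{u, v} \<in> E \<longleftrightarrow> (\<forall>i<Suc (card V). x u i \<le> y v i \<and> x v i \<le> y u i)"
    proof
      assume "{u, v} \<in> E"
      then show "\<forall>i<Suc (card V). x u i \<le> y v i \<and> x v i \<le> y u i"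
        by (auto simp: x_def y_def insert_commute)
    next
      assume "\<forall>i<Suc (card V). x u i \<le> y v i \<and> x v i \<le> y u i"
      then have "x v i \<le> y u i" using i by simp
      then show "{u, v} \<in> E" using i uv by (auto simp: x_def y_def split: if_splits)
    qed
  qed
qed

lemma has_box_representation_boxicity:
  assumes "finite_simple_graph G"
  shows "has_box_representation (boxicity G) G"
proof -
  obtain V E where G: "G = (V, E)" by (cases G)
  have "1 \<le> Suc (card V) \<and> has_box_representation (Suc (card V)) G"
    using has_box_representation_card assms G by auto
  then have "1 \<le> boxicity G \<and> has_box_representation (boxicity G) G"
    unfolding boxicity_def by (rule LeastI)
  then show ?thesis ..
qed

text \<open>Two intervals are disjoint iff one of them ends before the other begins. Index
  \<open>k < d\<close> records that the interval of the left vertex ends before that of the right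
  vertex in coordinate \<open>k\<close>; index \<open>k + d\<close> records the opposite order, with
  signs reversed so that it has the same form.\<close>

lemma bipartite_box_representation_imp_chains:
  assumes "has_box_representation d (bipartite_graph n f)"
  obtains R L :: "nat \<Rightarrow> nat \<Rightarrow> real" where
    "\<And>i j. i < n \<Longrightarrow> j < n \<Longrightarrow> \<not> f (i, j) \<longleftrightarrow> (\<exists>k<2 * d. R k i < L k j)"
proof -
  define E where "E = {{Inl i, Inr j :: nat + nat} | i j. i < n \<and> j < n \<and> f (i, j)}"
  have "has_box_representation d ({..<n} <+> {..<n}, E)"
    using assms by (simp add: bipartite_graph_def E_def)
  then obtain x y :: "nat + nat \<Rightarrow> nat \<Rightarrow> real" where
    "(\<forall>v\<in>{..<n} <+> {..<n}. \<forall>i<d. x v i \<le> y v i) \<and>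
     (\<forall>u\<in>{..<n} <+> {..<n}. \<forall>v\<in>{..<n} <+> {..<n}. u \<noteq> v \<longrightarrow>
       ({u, v} \<in> E \<longleftrightarrow> (\<forall>i<d. x u i \<le> y v i \<and> x v i \<le> y u i)))"
    unfolding has_box_representation_iff by (elim exE)
  note xy = this[THEN conjunct2, rule_format]
  define R where "R = (\<lambda>k i. if k < d then y (Inl i) k else - x (Inl i) (k - d))"
  define L where "L = (\<lambda>k j. if k < d then x (Inr j) k else - y (Inr j) (k - d))"
  have "\<not> f (i, j) \<longleftrightarrow> (\<exists>k<2 * d. R k i < L k j)" if "i < n" "j < n" for i j
  proof -
    have "f (i, j) \<longleftrightarrow> (\<forall>k<d. x (Inl i) k \<le> y (Inr j) k \<and> x (Inr j) k \<le> y (Inl i) k)"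
    proof -
      have "f (i, j) \<longleftrightarrow> {Inl i, Inr j} \<in> E" using that by (auto simp: E_def doubleton_eq_iff)
      also have "\<dots> \<longleftrightarrow> (\<forall>k<d. x (Inl i) k \<le> y (Inr j) k \<and> x (Inr j) k \<le> y (Inl i) k)"
        using that by (intro xy) auto
      finally show ?thesis .
    qed
    then have "\<not> f (i, j) \<longleftrightarrow> (\<exists>k<d. y (Inl i) k < x (Inr j) k) \<or> (\<exists>k<d. y (Inr j) k < x (Inl i) k)"
      by (auto simp: not_le)
    also have "(\<exists>k<d. y (Inl i) k < x (Inr j) k) \<longleftrightarrow> (\<exists>k<d. R k i < L k j)"
      by (auto simp: R_def L_def)
    also have "(\<exists>k<d. y (Inr j) k < x (Inl i) k) \<longleftrightarrow> (\<exists>k. d \<le> k \<and> k < 2 * d \<and> R k i < L k j)"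
    proof
      assume "\<exists>k<d. y (Inr j) k < x (Inl i) k"
      then obtain k where "k < d" "y (Inr j) k < x (Inl i) k" by blast
      then show "\<exists>k. d \<le> k \<and> k < 2 * d \<and> R k i < L k j"
        by (intro exI[of _ "k + d"]) (auto simp: R_def L_def)
    next
      assume "\<exists>k. d \<le> k \<and> k < 2 * d \<and> R k i < L k j"
      then obtain k where "d \<le> k" "k < 2 * d" "R k i < L k j" by blast
      then show "\<exists>k<d. y (Inr j) k < x (Inl i) k"
        by (intro exI[of _ "k - d"]) (auto simp: R_def L_def)
    qed
    finally have e: "\<not> f (i, j) \<longleftrightarrow> (\<exists>k<d. R k i < L k j) \<or> (\<exists>k. d \<le> k \<and> k < 2 * d \<and> R k i < L k j)" .
    show ?thesis unfolding e
      by (metis not_le less_le_trans mult_2 le_add1)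
  qed
  then show ?thesis by (rule that)
qed

section \<open>Initial segments of the orders of a staircase\<close>

definition preds :: "'a list \<Rightarrow> 'a \<Rightarrow> 'a set" where
  "preds xs x = set (takeWhile (\<lambda>y. y \<noteq> x) xs)"

lemma preds_subset: "preds xs x \<subseteq> set xs"
  by (auto simp: preds_def dest: set_takeWhileD)

lemma self_notin_preds: "x \<notin> preds xs x"
  by (auto simp: preds_def dest: set_takeWhileD)

lemma preds_take:
  assumes "x \<in> set (take k xs)" shows "preds (take k xs) x = preds xs x"
proof -
  have "takeWhile (\<lambda>y. y \<noteq> x) (take k xs @ drop k xs) = takeWhile (\<lambda>y. y \<noteq> x) (take k xs)"
    by (rule takeWhile_append1[OF assms]) simp
  then show ?thesis by (simp add: preds_def)
qed

lemma preds_Cons: "preds (z # xs) x = (if z = x then {} else insert z (preds xs x))"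
  unfolding preds_def takeWhile.simps by (cases "z = x") auto

lemma preds_linear:
  assumes "x \<in> set xs" "y \<in> set xs" "x \<noteq> y"
  shows "x \<in> preds xs y \<and> preds xs x \<subseteq> preds xs y \<or> y \<in> preds xs x \<and> preds xs y \<subseteq> preds xs x"
  using assms
proof (induction xs)
  case (Cons z xs)
  consider "z = x" | "z = y" | "z \<noteq> x" "z \<noteq> y" by blast
  then show ?case
  proof cases
    case 3
    then have "x \<in> set xs" "y \<in> set xs" using Cons.prems by simp_all
    then show ?thesis using Cons.IH Cons.prems(3) 3 by (auto simp: preds_Cons)
  qed (use Cons.prems in \<open>auto simp: preds_Cons\<close>)
qed simp

lemma preds_sorted:
  assumes "sorted (map f xs)" "x \<in> set xs" "y \<in> preds xs x"
  shows "f y \<le> f x"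
  using assms
proof (induction xs)
  case (Cons z xs)
  then have "z \<noteq> x" "y = z \<or> y \<in> preds xs x" "x \<in> set xs" by (auto simp: preds_Cons split: if_splits)
  then show ?case using Cons by auto
qed simp

text \<open>The lists \<open>A k\<close> and \<open>B k\<close> are the initial segments of the two orders of a staircase.\<close>

definition chain_cover ::
    "nat \<Rightarrow> nat \<Rightarrow> (nat \<Rightarrow> nat list) \<Rightarrow> (nat \<Rightarrow> nat list) \<Rightarrow> (nat \<times> nat \<Rightarrow> bool) \<Rightarrow> bool" where
  "chain_cover n m A B f \<longleftrightarrow> (\<forall>i<n. \<forall>j<n. \<not> f (i, j) \<longrightarrow>
     (\<exists>k<m. i \<in> set (A k) \<and> (\<forall>i'\<in>preds (A k) i. \<not> f (i', j)) \<or>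
            j \<in> set (B k) \<and> (\<forall>j'\<in>preds (B k) j. \<not> f (i, j'))))"

definition short_lists :: "nat \<Rightarrow> nat \<Rightarrow> nat list set" where
  "short_lists n K = {xs. distinct xs \<and> set xs \<subseteq> {..<n} \<and> length xs = K}"

lemma short_lists_subset: "short_lists n K \<subseteq> {xs. set xs \<subseteq> {..<n} \<and> length xs = K}"
  by (auto simp: short_lists_def)

lemma finite_short_lists: "finite (short_lists n K)"
  by (rule finite_subset[OF short_lists_subset finite_lists_length_eq]) simp

lemma card_short_lists: "card (short_lists n K) \<le> n ^ K"
  using card_mono[OF finite_lists_length_eq short_lists_subset, of n K] card_lists_length_eq[of "{..<n}" K]
  by simp

text \<open>With the left side sorted by increasing \<open>R k\<close> and the right side by
  decreasing \<open>L k\<close>, a staircase is closed under passing to predecessors in either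
  order. If both ends of one of its pairs lay beyond the first \<open>K\<close> entries, it would
  contain the product of the two initial segments, an empty \<open>K\<close> by \<open>K\<close>
  rectangle. So one end is listed, and all its predecessors are non-adjacent to the other
  end.\<close>

lemma chains_imp_chain_cover:
  fixes R L :: "nat \<Rightarrow> nat \<Rightarrow> real"
  assumes RL: "\<And>i j. i < n \<Longrightarrow> j < n \<Longrightarrow> \<not> f (i, j) \<longleftrightarrow> (\<exists>k<m. R k i < L k j)"
    and K: "K \<le> n"
    and rect: "\<not> (\<exists>xs\<in>short_lists n K. \<exists>ys\<in>short_lists n K. \<forall>i\<in>set xs. \<forall>j\<in>set ys. \<not> f (i, j))"
  obtains A B where "\<And>k. A k \<in> short_lists n K" "\<And>k. B k \<in> short_lists n K" "chain_cover n m A B f"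
proof -
  define A' where "A' = (\<lambda>k. sort_key (R k) [0..<n])"
  define B' where "B' = (\<lambda>k. sort_key (\<lambda>j. - L k j) [0..<n])"
  define A where "A = (\<lambda>k. take K (A' k))"
  define B where "B = (\<lambda>k. take K (B' k))"
  have A': "set (A' k) = {..<n}" "distinct (A' k)" "sorted (map (R k) (A' k))" "length (A' k) = n" for k
    by (auto simp: A'_def)
  have B': "set (B' k) = {..<n}" "distinct (B' k)" "sorted (map (\<lambda>j. - L k j) (B' k))" "length (B' k) = n" for k
    by (auto simp: B'_def)
  have As: "A k \<in> short_lists n K" and Bs: "B k \<in> short_lists n K" for k
    using A'[of k] B'[of k] K set_take_subset[of K "A' k"] set_take_subset[of K "B' k"]
    by (auto simp: short_lists_def A_def B_def)
  have tail: "x \<in> preds xs y" if "x \<in> set (take K xs)" "y \<in> set xs" "y \<notin> set (take K xs)"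
    for x y :: nat and xs
  proof -
    have "takeWhile (\<lambda>z. z \<noteq> y) xs = take K xs @ takeWhile (\<lambda>z. z \<noteq> y) (drop K xs)"
    proof -
      have "takeWhile (\<lambda>z. z \<noteq> y) (take K xs @ drop K xs) = take K xs @ takeWhile (\<lambda>z. z \<noteq> y) (drop K xs)"
        by (rule takeWhile_append2) (use that(3) in blast)
      then show ?thesis by simp
    qed
    then show ?thesis using that(1) by (simp add: preds_def)
  qed
  have "chain_cover n m A B f"
    unfolding chain_cover_def
  proof (intro allI impI)
    fix i j assume ij: "i < n" "j < n" "\<not> f (i, j)"
    then obtain k where k: "k < m" "R k i < L k j" using RL by blast
    have 1: "R k i' \<le> R k i" if "i' \<in> preds (A' k) i" for i'
      using preds_sorted[OF A'(3)] A'(1) ij that by auto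
    have 2: "L k j \<le> L k j'" if "j' \<in> preds (B' k) j" for j'
      using preds_sorted[OF B'(3), of j k j'] B'(1) ij that by auto
    have lt: "i' < n" if "i' \<in> preds (A' k) i" for i' using subsetD[OF preds_subset that] A'(1) by simp
    have lt': "j' < n" if "j' \<in> preds (B' k) j" for j' using subsetD[OF preds_subset that] B'(1) by simp
    have "i \<in> set (A k) \<or> j \<in> set (B k)"
    proof (rule ccontr)
      assume out: "\<not> (i \<in> set (A k) \<or> j \<in> set (B k))"
      have "\<not> f (i', j')" if "i' \<in> set (A k)" "j' \<in> set (B k)" for i' j'
      proof -
        have p: "i' \<in> preds (A' k) i" "j' \<in> preds (B' k) j"
          using tail that out A'(1) B'(1) ij by (auto simp: A_def B_def)
        have "R k i' < L k j'" using 1[OF p(1)] 2[OF p(2)] k(2) by linarith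
        then show ?thesis using RL[OF lt[OF p(1)] lt'[OF p(2)]] k(1) by blast
      qed
      then show False using rect As Bs by blast
    qed
    moreover have "\<not> f (i', j)" if "i \<in> set (A k)" "i' \<in> preds (A k) i" for i'
    proof -
      have p: "i' \<in> preds (A' k) i" using that preds_take[of i K "A' k"] by (simp add: A_def)
      then have "R k i' < L k j" using 1[OF p] k(2) by linarith
      then show ?thesis using RL[OF lt[OF p] ij(2)] k(1) by blast
    qed
    moreover have "\<not> f (i, j')" if "j \<in> set (B k)" "j' \<in> preds (B k) j" for j'
    proof -
      have p: "j' \<in> preds (B' k) j" using that preds_take[of j K "B' k"] by (simp add: B_def)
      then have "R k i < L k j'" using 2[OF p] k(2) by linarith
      then show ?thesis using RL[OF ij(1) lt'[OF p]] k(1) by blast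
    qed
    ultimately show "\<exists>k<m. i \<in> set (A k) \<and> (\<forall>i'\<in>preds (A k) i. \<not> f (i', j)) \<or>
            j \<in> set (B k) \<and> (\<forall>j'\<in>preds (B k) j. \<not> f (i, j'))" using k(1) by blast
  qed
  with As Bs show ?thesis by (rule that)
qed

text \<open>Missing chains are filled up with empty ones.\<close>

lemma boxicity_imp_chain_cover:
  assumes "2 * boxicity (bipartite_graph n f) \<le> m" "K \<le> n"
    and rect: "\<not> (\<exists>xs\<in>short_lists n K. \<exists>ys\<in>short_lists n K. \<forall>i\<in>set xs. \<forall>j\<in>set ys. \<not> f (i, j))"
  obtains A B where "\<And>k. A k \<in> short_lists n K" "\<And>k. B k \<in> short_lists n K" "chain_cover n m A B f"
proof -
  define d where "d = boxicity (bipartite_graph n f)"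
  have "finite_simple_graph (bipartite_graph n f)"
    by (auto simp: bipartite_graph_def card_insert_if)
  then have "has_box_representation d (bipartite_graph n f)"
    unfolding d_def by (rule has_box_representation_boxicity)
  then obtain R L :: "nat \<Rightarrow> nat \<Rightarrow> real" where
    RL: "\<And>i j. i < n \<Longrightarrow> j < n \<Longrightarrow> \<not> f (i, j) \<longleftrightarrow> (\<exists>k<2 * d. R k i < L k j)"
    by (rule bipartite_box_representation_imp_chains) blast
  define L' where "L' = (\<lambda>k j. if k < 2 * d then L k j else 0)"
  define R' where "R' = (\<lambda>k i. if k < 2 * d then R k i else 0)"
  have "\<not> f (i, j) \<longleftrightarrow> (\<exists>k<m. R' k i < L' k j)" if "i < n" "j < n" for i j
    unfolding RL[OF that] using assms(1) by (force simp: R'_def L'_def d_def)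
  then show ?thesis using chains_imp_chain_cover[OF _ assms(2) rect] that by blast
qed

section \<open>Independent edges\<close>

abbreviation random_subset :: "real \<Rightarrow> 'a set \<Rightarrow> ('a \<Rightarrow> bool) pmf" where
  "random_subset p I \<equiv> Pi_pmf I False (\<lambda>_. bernoulli_pmf p)"

lemma prob_random_subset_insert:
  assumes "finite I" "x \<notin> I" "0 \<le> p" "p \<le> 1"
  shows "measure_pmf.prob (random_subset p (insert x I)) {f. Q f} =
    p * measure_pmf.prob (random_subset p I) {f. Q (f(x := True))} +
    (1 - p) * measure_pmf.prob (random_subset p I) {f. Q (f(x := False))}"
proof -
  have "random_subset p (insert x I) =
      bind_pmf (bernoulli_pmf p) (\<lambda>v. map_pmf (\<lambda>f. f(x := v)) (random_subset p I))"
    unfolding Pi_pmf_insert'[OF assms(1,2)] map_pmf_def ..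
  then have "emeasure (random_subset p (insert x I)) {f. Q f} =
      ennreal p * emeasure (map_pmf (\<lambda>f. f(x := True)) (random_subset p I)) {f. Q f} +
      ennreal (1 - p) * emeasure (map_pmf (\<lambda>f. f(x := False)) (random_subset p I)) {f. Q f}"
    using assms by (simp add: mult.commute)
  then have "ennreal (measure_pmf.prob (random_subset p (insert x I)) {f. Q f}) =
      ennreal (p * measure_pmf.prob (map_pmf (\<lambda>f. f(x := True)) (random_subset p I)) {f. Q f} +
      (1 - p) * measure_pmf.prob (map_pmf (\<lambda>f. f(x := False)) (random_subset p I)) {f. Q f})"
    using assms by (simp add: measure_pmf.emeasure_eq_measure ennreal_mult ennreal_plus del: emeasure_map_pmf measure_map_pmf)
  then have "measure_pmf.prob (random_subset p (insert x I)) {f. Q f} =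
      p * measure_pmf.prob (map_pmf (\<lambda>f. f(x := True)) (random_subset p I)) {f. Q f} +
      (1 - p) * measure_pmf.prob (map_pmf (\<lambda>f. f(x := False)) (random_subset p I)) {f. Q f}"
    using assms by (subst (asm) ennreal_inj) auto
  then show ?thesis by (simp add: vimage_def)
qed

text \<open>After conditioning on one coordinate, the induction hypothesis applies to both
  conditional events. What remains is the covariance of the two conditional probabilities,
  \<open>p * (1 - p) * ((a1 - a0) * (b1 - b0))\<close>, which is nonnegative because both events are
  increasing.\<close>

lemma Harris_inequality:
  assumes "finite I" "0 \<le> p" "p \<le> 1"
    and "\<And>f x. A (f(x := False)) \<Longrightarrow> A (f(x := True))"
    and "\<And>f x. B (f(x := False)) \<Longrightarrow> B (f(x := True))"
  shows "measure_pmf.prob (random_subset p I) {f. A f} * measure_pmf.prob (random_subset p I) {f. B f}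
    \<le> measure_pmf.prob (random_subset p I) {f. A f \<and> B f}"
  using assms(1,4,5)
proof (induction I arbitrary: A B rule: finite_induct)
  case empty
  then show ?case by (auto simp: indicator_def)
next
  case (insert x I)
  let ?P = "\<lambda>Q. measure_pmf.prob (random_subset p I) {f. Q f}"
  define a1 where "a1 = ?P (\<lambda>f. A (f(x := True)))"
  define a0 where "a0 = ?P (\<lambda>f. A (f(x := False)))"
  define b1 where "b1 = ?P (\<lambda>f. B (f(x := True)))"
  define b0 where "b0 = ?P (\<lambda>f. B (f(x := False)))"
  have mono: "C ((f(y := False))(x := v)) \<Longrightarrow> C ((f(y := True))(x := v))"
    if "\<And>f x. C (f(x := False)) \<Longrightarrow> C (f(x := True))" for C :: "('a \<Rightarrow> bool) \<Rightarrow> bool" and f y v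
    using that[of "f(x := v)" y] by (cases "y = x") (simp_all add: fun_upd_twist)
  have IH: "?P (\<lambda>f. A (f(x := v))) * ?P (\<lambda>f. B (f(x := v))) \<le> ?P (\<lambda>f. A (f(x := v)) \<and> B (f(x := v)))" for v
    using insert.IH[of "\<lambda>f. A (f(x := v))" "\<lambda>f. B (f(x := v))"]
      mono[of A] mono[of B] insert.prems by blast
  have *: "?P (\<lambda>f. C (f(x := False))) \<le> ?P (\<lambda>f. C (f(x := True)))"
    if "\<And>f x. C (f(x := False)) \<Longrightarrow> C (f(x := True))" for C
    using that by (intro measure_pmf.finite_measure_mono subsetI CollectI) auto
  have le: "a0 \<le> a1" "b0 \<le> b1"
    unfolding a0_def a1_def b0_def b1_def
    by (rule *, rule insert.prems(1), assumption, rule *, rule insert.prems(2), assumption)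
  have "(p * a1 + (1 - p) * a0) * (p * b1 + (1 - p) * b0)
     = p * (a1 * b1) + (1 - p) * (a0 * b0) - p * (1 - p) * ((a1 - a0) * (b1 - b0))"
    by algebra
  also have "\<dots> \<le> p * (a1 * b1) + (1 - p) * (a0 * b0)"
    using assms le by simp
  also have "\<dots> \<le> p * ?P (\<lambda>f. A (f(x := True)) \<and> B (f(x := True))) +
      (1 - p) * ?P (\<lambda>f. A (f(x := False)) \<and> B (f(x := False)))"
    using IH[of True] IH[of False] assms unfolding a1_def a0_def b1_def b0_def
    by (intro add_mono mult_left_mono) auto
  finally show ?case
    unfolding prob_random_subset_insert[OF insert.hyps assms(2,3)] a1_def a0_def b1_def b0_def .
qed

text \<open>The computation of Harris' inequality with equality: a coordinate that is irrelevant to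
  \<open>A\<close> or to \<open>B\<close> makes one of the differences \<open>a1 - a0\<close> and
  \<open>b1 - b0\<close> vanish.\<close>

lemma prob_random_subset_indep:
  assumes "finite I" "0 \<le> p" "p \<le> 1"
    and "\<And>x. (\<forall>f v. A (f(x := v)) \<longleftrightarrow> A f) \<or> (\<forall>f v. B (f(x := v)) \<longleftrightarrow> B f)"
  shows "measure_pmf.prob (random_subset p I) {f. A f \<and> B f} =
    measure_pmf.prob (random_subset p I) {f. A f} * measure_pmf.prob (random_subset p I) {f. B f}"
  using assms(1,4)
proof (induction I arbitrary: A B rule: finite_induct)
  case empty
  then show ?case by (auto simp: indicator_def)
next
  case (insert x I)
  let ?P = "\<lambda>Q. measure_pmf.prob (random_subset p I) {f. Q f}"
  define a1 where "a1 = ?P (\<lambda>f. A (f(x := True)))"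
  define a0 where "a0 = ?P (\<lambda>f. A (f(x := False)))"
  define b1 where "b1 = ?P (\<lambda>f. B (f(x := True)))"
  define b0 where "b0 = ?P (\<lambda>f. B (f(x := False)))"
  have upd: "\<forall>f w. C ((f(y := w))(x := v)) \<longleftrightarrow> C (f(x := v))"
    if "\<forall>f w. C (f(y := w)) \<longleftrightarrow> C f" for C :: "('a \<Rightarrow> bool) \<Rightarrow> bool" and y v
    using that by (cases "y = x") (simp_all add: fun_upd_twist)
  have IH: "?P (\<lambda>f. A (f(x := v)) \<and> B (f(x := v))) = ?P (\<lambda>f. A (f(x := v))) * ?P (\<lambda>f. B (f(x := v)))" for v
  proof (rule insert.IH)
    fix y
    show "(\<forall>f w. A ((f(y := w))(x := v)) \<longleftrightarrow> A (f(x := v))) \<or> (\<forall>f w. B ((f(y := w))(x := v)) \<longleftrightarrow> B (f(x := v)))"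
      using insert.prems[of y] upd[of A y v] upd[of B y v] by argo
  qed
  have eq: "a1 = a0 \<or> b1 = b0"
    using insert.prems[of x]
  proof
    assume "\<forall>f v. A (f(x := v)) \<longleftrightarrow> A f"
    then show ?thesis unfolding a0_def a1_def by simp
  next
    assume "\<forall>f v. B (f(x := v)) \<longleftrightarrow> B f"
    then show ?thesis unfolding b0_def b1_def by simp
  qed
  have "p * (a1 * b1) + (1 - p) * (a0 * b0)
     = (p * a1 + (1 - p) * a0) * (p * b1 + (1 - p) * b0) + p * (1 - p) * ((a1 - a0) * (b1 - b0))"
    by algebra
  also have "\<dots> = (p * a1 + (1 - p) * a0) * (p * b1 + (1 - p) * b0)"
    using eq by auto
  finally show ?case
    unfolding prob_random_subset_insert[OF insert.hyps assms(2,3)] IH a1_def a0_def b1_def b0_def .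
qed

lemma prob_random_subset_disjoint_supports:
  assumes I: "finite I" "0 \<le> p" "p \<le> 1" and Q: "finite Q"
    and dep: "\<And>q x f v. q \<in> Q \<Longrightarrow> x \<notin> S q \<Longrightarrow> E q (f(x := v)) \<longleftrightarrow> E q f"
    and disj: "disjoint_family_on S Q"
  shows "measure_pmf.prob (random_subset p I) {f. \<forall>q\<in>Q. E q f} =
    (\<Prod>q\<in>Q. measure_pmf.prob (random_subset p I) {f. E q f})"
  using Q dep disj
proof (induction Q rule: finite_induct)
  case (insert q Q)
  have "measure_pmf.prob (random_subset p I) {f. E q f \<and> (\<forall>q\<in>Q. E q f)} =
    measure_pmf.prob (random_subset p I) {f. E q f} * measure_pmf.prob (random_subset p I) {f. \<forall>q\<in>Q. E q f}"
  proof (rule prob_random_subset_indep[OF I])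
    fix x
    show "(\<forall>f v. E q (f(x := v)) \<longleftrightarrow> E q f) \<or> (\<forall>f v. (\<forall>q\<in>Q. E q (f(x := v))) \<longleftrightarrow> (\<forall>q\<in>Q. E q f))"
    proof (cases "x \<in> S q")
      case True
      have "E q' (f(x := v)) \<longleftrightarrow> E q' f" if "q' \<in> Q" for q' f v
      proof -
        have "S q \<inter> S q' = {}"
          using disjoint_family_onD[OF insert.prems(2), of q q'] insert.hyps(2) that by auto
        then have "x \<notin> S q'" using True by blast
        with that show ?thesis by (intro insert.prems(1)) auto
      qed
      then have "(\<forall>q\<in>Q. E q (f(x := v))) \<longleftrightarrow> (\<forall>q\<in>Q. E q f)" for f v by (rule ball_cong[OF refl])
      then show ?thesis by blast
    next
      case False
      then have "E q (f(x := v)) \<longleftrightarrow> E q f" for f v by (intro insert.prems(1)) auto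
      then show ?thesis by blast
    qed
  qed
  also have "measure_pmf.prob (random_subset p I) {f. \<forall>q\<in>Q. E q f} =
      (\<Prod>q\<in>Q. measure_pmf.prob (random_subset p I) {f. E q f})"
  proof (rule insert.IH)
    show "disjoint_family_on S Q"
      using insert.prems(2) by (rule disjoint_family_on_mono[rotated]) auto
    show "E q' (f(x := v)) \<longleftrightarrow> E q' f" if "q' \<in> Q" "x \<notin> S q'" for q' x f v
      using that by (intro insert.prems(1)) auto
  qed
  finally show ?case using insert.hyps by simp
qed simp

lemma prob_random_subset_none:
  assumes "finite I" "S \<subseteq> I" "0 \<le> p" "p \<le> 1"
  shows "measure_pmf.prob (random_subset p I) {f. \<forall>x\<in>S. \<not> f x} = (1 - p) ^ card S"
proof -
  have fS: "finite S" using assms finite_subset by blast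
  have "measure_pmf.prob (random_subset p I) {f. \<forall>x\<in>S. \<not> f x} =
      (\<Prod>x\<in>S. measure_pmf.prob (random_subset p I) {f. \<not> f x})"
    using assms fS
    by (intro prob_random_subset_disjoint_supports[where S = "\<lambda>x. {x}"]) (auto simp: disjoint_family_on_def)
  also have "\<dots> = (\<Prod>x\<in>S. 1 - p)"
  proof (rule prod.cong)
    fix x assume "x \<in> S"
    then have "x \<in> I" using assms by blast
    have "{f. \<not> f x} = (\<lambda>f. f x) -` {False}" by auto
    then have "measure_pmf.prob (random_subset p I) {f. \<not> f x} =
        measure_pmf.prob (map_pmf (\<lambda>f. f x) (random_subset p I)) {False}" by simp
    also have "map_pmf (\<lambda>f. f x) (random_subset p I) = bernoulli_pmf p"
      using Pi_pmf_component[OF assms(1), of x] \<open>x \<in> I\<close> by simp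
    also have "measure_pmf.prob (bernoulli_pmf p) {False} = 1 - p"
      using assms by (simp add: measure_pmf_single)
    finally show "measure_pmf.prob (random_subset p I) {f. \<not> f x} = 1 - p" .
  qed simp
  finally show ?thesis by simp
qed

text \<open>Hitting a set is an increasing event, so Harris' inequality permits multiplying the
  probabilities although the sets \<open>S k\<close> may overlap.\<close>

lemma prob_random_subset_hits:
  assumes I: "finite I" "0 \<le> p" "p \<le> 1" and T: "finite T" and S: "\<And>k. k \<in> T \<Longrightarrow> S k \<subseteq> I"
  shows "(\<Prod>k\<in>T. 1 - (1 - p) ^ card (S k)) \<le>
    measure_pmf.prob (random_subset p I) {f. \<forall>k\<in>T. \<exists>x\<in>S k. f x}"
  using T S
proof (induction T rule: finite_induct)
  case (insert k T)
  let ?P = "measure_pmf.prob (random_subset p I)"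
  have "?P {f. \<exists>x\<in>S k. f x} = 1 - ?P {f. \<forall>x\<in>S k. \<not> f x}"
  proof -
    have "{f. \<exists>x\<in>S k. f x} = UNIV - {f. \<forall>x\<in>S k. \<not> f x}" by auto
    then show ?thesis using measure_pmf.prob_compl[of "{f. \<forall>x\<in>S k. \<not> f x}" "random_subset p I"] by simp
  qed
  then have k: "?P {f. \<exists>x\<in>S k. f x} = 1 - (1 - p) ^ card (S k)"
    using prob_random_subset_none[of I "S k" p] I insert.prems by simp
  have "(\<Prod>k\<in>insert k T. 1 - (1 - p) ^ card (S k)) \<le>
      ?P {f. \<exists>x\<in>S k. f x} * ?P {f. \<forall>k\<in>T. \<exists>x\<in>S k. f x}"
    unfolding k prod.insert[OF insert.hyps] using insert I
    by (intro mult_left_mono) (auto simp: power_le_one)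
  also have "\<dots> \<le> ?P {f. (\<exists>x\<in>S k. f x) \<and> (\<forall>k\<in>T. \<exists>x\<in>S k. f x)}"
    by (rule Harris_inequality[OF I]) (auto simp: fun_upd_def split: if_splits)
  finally show ?case by simp
qed simp

text \<open>Markov's inequality for 2 to the number of chosen elements, whose expectation is
  \<open>(1 + p) ^ card I\<close>. In the induction a new element contributes the factor
  \<open>2 * p + (1 - p)\<close>.\<close>

lemma prob_random_subset_card_ge:
  assumes "finite I" "0 \<le> p" "p \<le> 1"
  shows "measure_pmf.prob (random_subset p I) {f. t \<le> card {x\<in>I. f x}} \<le> (1 + p) ^ card I / 2 ^ t"
  using assms(1)
proof (induction I arbitrary: t rule: finite_induct)
  case empty
  show ?case by (cases t) (auto simp: indicator_def)
next
  case (insert x I)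
  let ?P = "\<lambda>t. measure_pmf.prob (random_subset p I) {f. t \<le> card {y\<in>I. f y}}"
  show ?case
  proof (cases t)
    case 0
    have "1 \<le> (1 + p) ^ card (insert x I)" using assms by (intro one_le_power) simp
    then show ?thesis using 0 by (simp add: order_trans[OF measure_pmf.prob_le_1])
  next
    case (Suc s)
    have "{y \<in> insert x I. (f(x := True)) y} = insert x {y\<in>I. f y}"
      "{y \<in> insert x I. (f(x := False)) y} = {y\<in>I. f y}" for f
      using insert.hyps by auto
    then have "measure_pmf.prob (random_subset p (insert x I)) {f. t \<le> card {y\<in>insert x I. f y}}
      = p * ?P s + (1 - p) * ?P t"
      unfolding prob_random_subset_insert[OF insert.hyps assms(2,3)]
      using insert.hyps Suc by simp
    also have "\<dots> \<le> p * ((1 + p) ^ card I / 2 ^ s) + (1 - p) * ((1 + p) ^ card I / 2 ^ t)"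
      using assms by (intro add_mono mult_left_mono insert.IH) auto
    also have "\<dots> = (1 + p) ^ card (insert x I) / 2 ^ t"
      using insert.hyps Suc by (simp add: field_simps)
    finally show ?thesis .
  qed
qed

section \<open>Few chains do not cover the non-edges\<close>

text \<open>The term for \<open>k = 0\<close> is zero by the convention for division by zero, so the
  series may start there.\<close>

lemma neg_ln_one_minus_sums:
  assumes "0 \<le> y" "y < (1::real)"
  shows "(\<lambda>k. y ^ k / real k) sums (- ln (1 - y))"
proof -
  have "(\<lambda>k. - ((- (- y)) ^ k) / of_nat k) sums ln (1 + - y)"
    by (rule ln_series') (use assms in auto)
  then have "(\<lambda>k. - (- ((- (- y)) ^ k) / of_nat k)) sums (- ln (1 + - y))"
    by (rule sums_minus)
  then show ?thesis by simp
qed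

text \<open>Expanding the logarithm and exchanging sums leaves \<open>\<Sum>k. q ^ k / (k * (1 - q ^ k))\<close>,
  and \<open>1 - q ^ k \<ge> k * q ^ k * (1 - q)\<close>.\<close>

lemma sum_neg_ln_one_minus_power_le:
  assumes q: "0 < q" "q < (1::real)"
  shows "(\<Sum>s=1..N. - ln (1 - q ^ s)) \<le> 3 / (1 - q)"
proof -
  have qs: "0 \<le> q ^ s" "q ^ s < 1" if "1 \<le> s" for s
    using q that by (auto simp: power_less_one_iff)
  have lhs: "(\<lambda>k. \<Sum>s=1..N. (q ^ s) ^ k / real k) sums (\<Sum>s=1..N. - ln (1 - q ^ s))"
    by (rule sums_sum) (use qs in \<open>auto intro: neg_ln_one_minus_sums\<close>)
  have rhs: "(\<lambda>k. (1 / (1 - q)) * (1 / (real k)\<^sup>2)) sums ((1 / (1 - q)) * (pi\<^sup>2 / 6))"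
  proof (rule sums_mult)
    have "(\<lambda>k. 1 / (real (Suc k))\<^sup>2) sums (pi\<^sup>2 / 6)"
      using inverse_squares_sums by (simp add: add.commute)
    then show "(\<lambda>k. 1 / (real k)\<^sup>2) sums (pi\<^sup>2 / 6)"
      using sums_Suc[of "\<lambda>k. 1 / (real k)\<^sup>2" "pi\<^sup>2 / 6"] by simp
  qed
  have "(\<Sum>s=1..N. (q ^ s) ^ k / real k) \<le> (1 / (1 - q)) * (1 / (real k)\<^sup>2)" for k
  proof (cases "k = 0")
    case False
    define x where "x = q ^ k"
    have x: "0 < x" "x < 1" using q False by (auto simp: x_def power_less_one_iff)
    have "(\<Sum>s=1..N. (q ^ s) ^ k / real k) = (\<Sum>s=1..N. x ^ s) / real k"
      by (simp add: x_def sum_divide_distrib flip: power_mult) (simp add: mult.commute)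
    also have "(\<Sum>s=1..N. x ^ s) \<le> x / (1 - x)"
    proof -
      have "(1 - x) * (\<Sum>s=1..N. x ^ s) = x - x ^ Suc N"
      proof (induction N)
        case (Suc N)
        have "(1 - x) * (\<Sum>s=1..Suc N. x ^ s) = (1 - x) * (\<Sum>s=1..N. x ^ s) + (1 - x) * x ^ Suc N"
          by (simp add: distrib_left)
        also have "\<dots> = (x - x ^ Suc N) + (1 - x) * x ^ Suc N" using Suc.IH by simp
        also have "\<dots> = x - x ^ Suc (Suc N)" by (simp add: algebra_simps)
        finally show ?case .
      qed simp
      then have "(\<Sum>s=1..N. x ^ s) = (x - x ^ Suc N) / (1 - x)"
        using x by (simp add: field_simps)
      also have "\<dots> \<le> x / (1 - x)" using x by (intro divide_right_mono) auto
      finally show ?thesis .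
    qed
    also have "x / (1 - x) \<le> 1 / (real k * (1 - q))"
    proof -
      have "real k * x = (\<Sum>i<k. x)" by simp
      also have "\<dots> \<le> (\<Sum>i<k. q ^ i)"
        unfolding x_def using q by (intro sum_mono power_decreasing) auto
      finally have "(1 - q) * (real k * x) \<le> (1 - q) * (\<Sum>i<k. q ^ i)"
        using q by (intro mult_left_mono) auto
      also have "\<dots> = 1 - x" by (simp add: x_def one_diff_power_eq)
      finally show ?thesis using x q False by (simp add: field_simps)
    qed
    finally show ?thesis using False by (simp add: divide_right_mono power2_eq_square mult_ac)
  qed simp
  from sums_le[OF this lhs rhs] have "(\<Sum>s=1..N. - ln (1 - q ^ s)) \<le> (1 / (1 - q)) * (pi\<^sup>2 / 6)" .
  also have "\<dots> \<le> (1 / (1 - q)) * 3"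
  proof -
    \<comment> \<open>The constant 3 is a rounded \<open>pi\<^sup>2 / 6\<close>, the value of the
      sum of inverse squares.\<close>
    have "pi\<^sup>2 \<le> 4\<^sup>2" using pi_less_4 pi_gt_zero by (intro power_mono) auto
    then show ?thesis using q by (intro mult_left_mono) auto
  qed
  finally show ?thesis by simp
qed

text \<open>In a maximal disjoint subfamily \<open>Q\<close> every \<open>S p\<close> meets some
  \<open>S q\<close> with \<open>q\<close> in \<open>Q\<close>. Each such \<open>q\<close> has at
  most \<open>s\<close> points, each lying in at most \<open>t\<close> sets of the family, so it
  accounts for at most \<open>s * t\<close> members of \<open>P\<close>.\<close>

lemma exists_disjoint_subfamily:
  fixes S :: "'a \<Rightarrow> 'b set"
  assumes P: "finite P" and S: "\<And>p. p \<in> P \<Longrightarrow> finite (S p) \<and> card (S p) \<le> s \<and> S p \<noteq> {}"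
    and t: "\<And>c. card {p\<in>P. c \<in> S p} \<le> t"
  obtains Q where "Q \<subseteq> P" "disjoint_family_on S Q" "card P \<le> card Q * (s * t)"
proof -
  define F where "F = {Q. Q \<subseteq> P \<and> disjoint_family_on S Q}"
  have "finite F" using P by (intro finite_subset[of F "Pow P"]) (auto simp: F_def)
  moreover have "{} \<in> F" by (simp add: F_def disjoint_family_on_def)
  ultimately obtain Q where Q: "Q \<in> F" "\<And>Q'. Q' \<in> F \<Longrightarrow> Q \<subseteq> Q' \<Longrightarrow> Q = Q'"
    by (metis finite_has_maximal empty_iff)
  have QP: "Q \<subseteq> P" and disj: "disjoint_family_on S Q" using Q(1) by (auto simp: F_def)
  have fQ: "finite Q" using P QP finite_subset by blast
  have "P \<subseteq> (\<Union>q\<in>Q. \<Union>c\<in>S q. {p\<in>P. c \<in> S p})"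
  proof
    fix p assume p: "p \<in> P"
    show "p \<in> (\<Union>q\<in>Q. \<Union>c\<in>S q. {p\<in>P. c \<in> S p})"
    proof (cases "p \<in> Q")
      case True
      then show ?thesis using S[OF p] p by blast
    next
      case False
      have "\<not> disjoint_family_on S (insert p Q)"
      proof
        assume "disjoint_family_on S (insert p Q)"
        then have "insert p Q \<in> F" using p QP by (simp add: F_def)
        then show False using Q(2)[of "insert p Q"] False by blast
      qed
      then obtain q where "q \<in> Q" "S p \<inter> S q \<noteq> {}"
        using disj unfolding disjoint_family_on_def by blast
      then show ?thesis using p by blast
    qed
  qed
  then have "card P \<le> card (\<Union>q\<in>Q. \<Union>c\<in>S q. {p\<in>P. c \<in> S p})"
    using P fQ S QP by (intro card_mono) auto
  also have "\<dots> \<le> (\<Sum>q\<in>Q. card (\<Union>c\<in>S q. {p\<in>P. c \<in> S p}))" by (rule card_UN_le[OF fQ])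
  also have "\<dots> \<le> (\<Sum>q\<in>Q. s * t)"
  proof (rule sum_mono)
    fix q assume "q \<in> Q"
    then have q: "finite (S q)" "card (S q) \<le> s" using S QP by auto
    have "card (\<Union>c\<in>S q. {p\<in>P. c \<in> S p}) \<le> (\<Sum>c\<in>S q. card {p\<in>P. c \<in> S p})"
      by (rule card_UN_le[OF q(1)])
    also have "\<dots> \<le> (\<Sum>c\<in>S q. t)" by (rule sum_mono[OF t])
    also have "\<dots> \<le> s * t" using q(2) by simp
    finally show "card (\<Union>c\<in>S q. {p\<in>P. c \<in> S p}) \<le> s * t" .
  qed
  finally have "card P \<le> card Q * (s * t)" by simp
  with QP disj show ?thesis by (rule that)
qed

text \<open>Popular entries, which occur in many lists, are few. Ignoring them bounds the dependence
  between the events considered below.\<close>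

locale chain_family =
  fixes n m K :: nat and A :: "nat \<Rightarrow> nat list"
  assumes A: "\<And>k. A k \<in> short_lists n K" and K: "0 < K"
begin

definition occ :: "nat \<Rightarrow> nat set" where
  "occ i = {k. k < m \<and> i \<in> set (A k)}"

definition popular :: "nat set" where
  "popular = {i. i < n \<and> K < card (occ i)}"

definition blockers :: "nat \<Rightarrow> nat \<Rightarrow> nat set" where
  "blockers k i = preds (A k) i - popular"

text \<open>With \<open>q = 1 - p\<close>, the argument of the logarithm is the probability that
  some blocker is adjacent to a fixed vertex of the other side; the product over all lists is thus
  at least \<open>exp (- T)\<close>. Nonempty blocker sets are required separately since
  \<open>ln 0 = 0\<close> would hide a vanishing factor.\<close>

definition good :: "real \<Rightarrow> real \<Rightarrow> nat set" where
  "good q T = {i. i < n \<and> i \<notin> popular \<and> (\<forall>k\<in>occ i. blockers k i \<noteq> {}) \<and>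
     (\<Sum>k\<in>occ i. - ln (1 - q ^ card (blockers k i))) \<le> T}"

lemma set_A: "set (A k) \<subseteq> {..<n}" "card (set (A k)) = K"
  using A[of k] by (auto simp: short_lists_def distinct_card)

lemma occ_eq: "occ i = {k \<in> {..<m}. i \<in> set (A k)}"
  by (auto simp: occ_def)

lemma finite_occ [simp]: "finite (occ i)"
  by (simp add: occ_def)

lemma blockers_subset: "blockers k i \<subseteq> set (A k)"
  using preds_subset by (fastforce simp: blockers_def)

lemma finite_blockers [simp]: "finite (blockers k i)"
  using blockers_subset finite_subset by blast

lemma card_blockers_le: "card (blockers k i) \<le> K"
  using card_mono[OF _ blockers_subset] set_A(2) by (metis List.finite_set)

lemma self_notin_blockers: "i \<notin> blockers k i"
  using self_notin_preds by (fastforce simp: blockers_def)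

text \<open>Of two non-popular entries of a list, the earlier one is itself a blocker of the later
  one, so the blocker sets strictly increase along the list.\<close>

lemma inj_on_card_blockers: "inj_on (\<lambda>i. card (blockers k i)) (set (A k) - popular)"
proof (rule inj_onI, rule ccontr)
  fix i j assume i: "i \<in> set (A k) - popular" and j: "j \<in> set (A k) - popular"
    and eq: "card (blockers k i) = card (blockers k j)" and ne: "i \<noteq> j"
  have *: "card (blockers k x) < card (blockers k y)"
    if "x \<in> preds (A k) y" "preds (A k) x \<subseteq> preds (A k) y" "x \<notin> popular" for x y
  proof (rule psubset_card_mono)
    have "x \<in> blockers k y" "blockers k x \<subseteq> blockers k y" using that by (auto simp: blockers_def)
    then show "blockers k x \<subset> blockers k y" using self_notin_blockers by blast
  qed simp
  show False
    using preds_linear[of i "A k" j] *[of i j] *[of j i] i j eq ne by auto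
qed

text \<open>The \<open>m\<close> lists have \<open>m * K\<close> entries altogether, and every
  popular vertex uses up more than \<open>K\<close> of them.\<close>

lemma card_popular_le: "card popular \<le> m"
proof -
  have "card popular * K = (\<Sum>i\<in>popular. K)" by simp
  also have "\<dots> \<le> (\<Sum>i\<in>popular. card (occ i))" by (intro sum_mono) (simp add: popular_def)
  also have "\<dots> \<le> (\<Sum>i<n. card (occ i))"
    by (intro sum_mono2) (auto simp: popular_def)
  also have "\<dots> = (\<Sum>i<n. \<Sum>k<m. if i \<in> set (A k) then 1 else 0)"
    by (intro sum.cong refl) (simp add: occ_def sum.If_cases lessThan_def Collect_conj_eq)
  also have "\<dots> = (\<Sum>k<m. \<Sum>i<n. if i \<in> set (A k) then 1 else 0)" by (rule sum.swap)
  also have "\<dots> = (\<Sum>k<m. K)"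
  proof (intro sum.cong refl)
    fix k
    have "(\<Sum>i<n. if i \<in> set (A k) then 1 else 0) = card ({..<n} \<inter> set (A k))"
      by (simp add: sum.If_cases)
    also have "{..<n} \<inter> set (A k) = set (A k)" using set_A(1)[of k] by blast
    finally show "(\<Sum>i<n. if i \<in> set (A k) then 1 else 0) = K" using set_A(2) by simp
  qed
  also have "\<dots> = m * K" by simp
  finally show ?thesis using K by simp
qed

text \<open>Only the earliest non-popular entry of a list can lack blockers, so each list is
  responsible for at most one such vertex.\<close>

lemma card_unblocked_le: "card {i. i < n \<and> i \<notin> popular \<and> (\<exists>k\<in>occ i. blockers k i = {})} \<le> m"
proof -
  define F where "F = (\<lambda>k. {i \<in> set (A k) - popular. blockers k i = {}})"
  have "card (F k) \<le> 1" for k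
  proof -
    have "i = j" if "i \<in> F k" "j \<in> F k" for i j
      using inj_onD[OF inj_on_card_blockers, of k i j] that by (auto simp: F_def)
    then show ?thesis by (metis card_le_Suc0_iff_eq One_nat_def F_def finite_Diff finite_set finite_Collect_conjI Collect_mem_eq)
  qed
  then have "card (\<Union>k<m. F k) \<le> (\<Sum>k<m. 1)"
    using card_UN_le[of "{..<m}" F] sum_mono[of "{..<m}" "\<lambda>k. card (F k)" "\<lambda>_. 1"] by (meson finite_lessThan order_trans)
  moreover have "card {i. i < n \<and> i \<notin> popular \<and> (\<exists>k\<in>occ i. blockers k i = {})} \<le> card (\<Union>k<m. F k)"
    by (rule card_mono) (auto simp: F_def occ_def)
  ultimately show ?thesis by simp
qed

text \<open>Popular vertices and vertices without blockers in some list account for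
  \<open>2 * m\<close>. The others that exceed \<open>T\<close> are counted by Markov's inequality:
  within one list the numbers of blockers are distinct and positive, so the list contributes at most
  \<open>3 / (1 - q)\<close> to the total cost.\<close>

lemma card_good_ge:
  assumes q: "0 < q" "q < 1" and T: "0 < T"
  shows "real n - 2 * real m - real m * (3 / (1 - q)) / T \<le> real (card (good q T))"
proof -
  define c where "c = (\<lambda>s. - ln (1 - q ^ s))"
  have c: "0 \<le> c s" for s
  proof (cases "s = 0")
    case False
    then have "q ^ s < 1" "0 < q ^ s" using q by (auto simp: power_less_one_iff)
    then show ?thesis by (simp add: c_def)
  qed (simp add: c_def)
  define U where "U = {i. i < n \<and> i \<notin> popular \<and> (\<exists>k\<in>occ i. blockers k i = {})}"
  define W where "W = {i. i < n \<and> i \<notin> popular \<and> (\<forall>k\<in>occ i. blockers k i \<noteq> {}) \<and>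
    T < (\<Sum>k\<in>occ i. c (card (blockers k i)))}"
  have fW: "finite W" by (simp add: W_def)
  have "real (card W) * T = (\<Sum>i\<in>W. T)" by simp
  also have "\<dots> \<le> (\<Sum>i\<in>W. \<Sum>k\<in>occ i. c (card (blockers k i)))"
    by (intro sum_mono) (auto simp: W_def)
  also have "\<dots> = (\<Sum>i\<in>W. \<Sum>k<m. if i \<in> set (A k) then c (card (blockers k i)) else 0)"
    unfolding occ_eq by (rule sum.cong[OF refl], rule sum.inter_filter) simp
  also have "\<dots> = (\<Sum>k<m. \<Sum>i\<in>W. if i \<in> set (A k) then c (card (blockers k i)) else 0)" by (rule sum.swap)
  also have "\<dots> \<le> (\<Sum>k<m. 3 / (1 - q))"
  proof (rule sum_mono)
    fix k assume k: "k \<in> {..<m}"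
    have "(\<Sum>i\<in>W. if i \<in> set (A k) then c (card (blockers k i)) else 0)
        = (\<Sum>i\<in>W \<inter> set (A k). c (card (blockers k i)))"
      using fW by (simp add: sum.If_cases)
    also have "\<dots> = sum c ((\<lambda>i. card (blockers k i)) ` (W \<inter> set (A k)))"
      by (subst sum.reindex) (auto intro!: inj_on_subset[OF inj_on_card_blockers] simp: W_def)
    also have "\<dots> \<le> sum c {1..K}"
    proof (rule sum_mono2)
      show "(\<lambda>i. card (blockers k i)) ` (W \<inter> set (A k)) \<subseteq> {1..K}"
      proof clarify
        fix i assume "i \<in> W" "i \<in> set (A k)"
        then have "blockers k i \<noteq> {}" using k by (auto simp: W_def occ_def)
        then have "0 < card (blockers k i)" by (simp add: card_gt_0_iff)
        then show "card (blockers k i) \<in> {1..K}" using card_blockers_le[of k i] by simp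
      qed
    qed (use c in auto)
    also have "\<dots> \<le> 3 / (1 - q)"
      unfolding c_def by (rule sum_neg_ln_one_minus_power_le[OF q])
    finally show "(\<Sum>i\<in>W. if i \<in> set (A k) then c (card (blockers k i)) else 0) \<le> 3 / (1 - q)" .
  qed
  finally have "real (card W) * T \<le> real m * (3 / (1 - q))" by simp
  then have W: "real (card W) \<le> real m * (3 / (1 - q)) / T"
    using pos_le_divide_eq[OF T] by blast
  have "{..<n} \<subseteq> popular \<union> U \<union> W \<union> good q T"
    by (auto simp: U_def W_def good_def c_def)
  moreover have "finite (popular \<union> U \<union> W \<union> good q T)"
    by (simp add: popular_def U_def W_def good_def)
  ultimately have "n \<le> card (popular \<union> U \<union> W \<union> good q T)"
    by (metis card_lessThan card_mono)
  also have "\<dots> \<le> card popular + card U + card W + card (good q T)"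
    by (meson card_Un_le order_trans add_mono order_refl)
  finally have "real n \<le> real (card popular) + real (card U) + real (card W) + real (card (good q T))"
    by linarith
  then show ?thesis
    using W card_popular_le card_unblocked_le unfolding U_def[symmetric] by linarith
qed

lemma card_Union_blockers_le:
  assumes "i < n" "i \<notin> popular" shows "card (\<Union>k\<in>occ i. blockers k i) \<le> K * K"
proof -
  have "card (\<Union>k\<in>occ i. blockers k i) \<le> (\<Sum>k\<in>occ i. card (blockers k i))"
    by (rule card_UN_le) simp
  also have "\<dots> \<le> (\<Sum>k\<in>occ i. K)" by (rule sum_mono[OF card_blockers_le])
  also have "\<dots> \<le> K * K" using assms by (simp add: popular_def)
  finally show ?thesis .
qed

text \<open>A blocker is not popular, so it occurs in at most \<open>K\<close> lists, and it blocks
  only entries of those lists.\<close>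

lemma card_blocked_le: "card {i. \<exists>k\<in>occ i. x \<in> blockers k i} \<le> K * K"
proof (cases "x < n \<and> x \<notin> popular")
  case True
  have "{i. \<exists>k\<in>occ i. x \<in> blockers k i} \<subseteq> (\<Union>k\<in>occ x. set (A k))"
    using blockers_subset by (fastforce simp: occ_def)
  then have "card {i. \<exists>k\<in>occ i. x \<in> blockers k i} \<le> card (\<Union>k\<in>occ x. set (A k))"
    by (intro card_mono) auto
  also have "\<dots> \<le> (\<Sum>k\<in>occ x. card (set (A k)))" by (rule card_UN_le) simp
  also have "\<dots> = card (occ x) * K" by (simp add: set_A)
  also have "\<dots> \<le> K * K" using True by (intro mult_le_mono1) (auto simp: popular_def not_less)
  finally show ?thesis .
next
  case False
  then have "{i. \<exists>k\<in>occ i. x \<in> blockers k i} = {}"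
    using blockers_subset set_A(1) by (fastforce simp: blockers_def)
  then show ?thesis by simp
qed

end

section \<open>Uncovered pairs and their dependence\<close>

locale chain_family_pair = L: chain_family n m K A + R: chain_family n m K B
  for n m K A B +
  fixes p T :: real
  assumes p: "0 < p" "p < 1"
begin

definition cells :: "(nat \<times> nat) set" where
  "cells = {..<n} \<times> {..<n}"

text \<open>Stronger than not being covered by any list: the adjacent predecessor must be
  non-popular. This restriction keeps \<open>support\<close> small.\<close>

definition uncovered :: "nat \<times> nat \<Rightarrow> (nat \<times> nat \<Rightarrow> bool) \<Rightarrow> bool" where
  "uncovered e f \<longleftrightarrow> \<not> f e \<and>
     (\<forall>k\<in>L.occ (fst e). \<exists>x\<in>L.blockers k (fst e) \<times> {snd e}. f x) \<and>
     (\<forall>k\<in>R.occ (snd e). \<exists>x\<in>{fst e} \<times> R.blockers k (snd e). f x)"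

definition support :: "nat \<times> nat \<Rightarrow> (nat \<times> nat) set" where
  "support e = {e} \<union> (\<Union>k\<in>L.occ (fst e). L.blockers k (fst e)) \<times> {snd e}
     \<union> {fst e} \<times> (\<Union>k\<in>R.occ (snd e). R.blockers k (snd e))"

definition good_pairs :: "(nat \<times> nat) set" where
  "good_pairs = L.good (1 - p) T \<times> R.good (1 - p) T"

lemma uncovered_imp_not_chain_cover:
  assumes "e \<in> good_pairs" "uncovered e f" shows "\<not> chain_cover n m A B f"
proof
  assume c: "chain_cover n m A B f"
  obtain i j where e: "e = (i, j)" by (cases e)
  have ij: "i < n" "j < n" "\<not> f (i, j)"
    using assms by (auto simp: good_pairs_def L.good_def R.good_def uncovered_def e)
  then obtain k where "k < m" "i \<in> set (A k) \<and> (\<forall>i'\<in>preds (A k) i. \<not> f (i', j)) \<or>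
            j \<in> set (B k) \<and> (\<forall>j'\<in>preds (B k) j. \<not> f (i, j'))"
    using c unfolding chain_cover_def by metis
  then consider "k \<in> L.occ i" "\<forall>i'\<in>preds (A k) i. \<not> f (i', j)"
    | "k \<in> R.occ j" "\<forall>j'\<in>preds (B k) j. \<not> f (i, j')"
    by (auto simp: L.occ_def R.occ_def)
  then show False
    using assms(2) by cases (auto simp: uncovered_def e L.blockers_def R.blockers_def)
qed

lemma uncovered_support:
  assumes "x \<notin> support e" shows "uncovered e (f(x := v)) \<longleftrightarrow> uncovered e f"
proof -
  define g where "g = f(x := v)"
  have eq: "g y = f y" if "y \<in> support e" for y using assms that by (auto simp: g_def)
  have "uncovered e g \<longleftrightarrow> uncovered e f"
    unfolding uncovered_def
    by (intro arg_cong2[where f = "(\<and>)"] arg_cong[where f = Not] ball_cong bex_cong refl eq)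
      (auto simp: support_def)
  then show ?thesis by (simp add: g_def)
qed

lemma finite_support: "finite (support e)"
  by (simp add: support_def)

lemma card_support_le:
  assumes "e \<in> good_pairs" shows "card (support e) \<le> 1 + 2 * (K * K)"
proof -
  have "fst e < n" "fst e \<notin> L.popular" "snd e < n" "snd e \<notin> R.popular"
    using assms by (auto simp: good_pairs_def L.good_def R.good_def)
  then have "card (\<Union>k\<in>L.occ (fst e). L.blockers k (fst e)) \<le> K * K"
    "card (\<Union>k\<in>R.occ (snd e). R.blockers k (snd e)) \<le> K * K"
    using L.card_Union_blockers_le R.card_Union_blockers_le by auto
  then have "card {e} + card ((\<Union>k\<in>L.occ (fst e). L.blockers k (fst e)) \<times> {snd e})
     + card ({fst e} \<times> (\<Union>k\<in>R.occ (snd e). R.blockers k (snd e))) \<le> 1 + 2 * (K * K)"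
    unfolding card_cartesian_product by simp
  then show ?thesis
    unfolding support_def by (meson card_Un_le order_trans add_mono order_refl)
qed

text \<open>Apart from \<open>c\<close> itself, only pairs in the row or column of \<open>c\<close>
  qualify, and their other coordinate is a vertex blocked by a coordinate of \<open>c\<close>.
  Together with the bound on the size of a support this limits the dependence between the
  events.\<close>

lemma card_support_containing_le: "card {e\<in>good_pairs. c \<in> support e} \<le> 1 + 2 * (K * K)"
proof -
  have fin: "finite {i. \<exists>k\<in>L.occ i. x \<in> L.blockers k i}" "finite {j. \<exists>k\<in>R.occ j. x \<in> R.blockers k j}" for x
    using L.set_A(1) R.set_A(1) by (auto intro!: finite_subset[of _ "{..<n}"] simp: L.occ_def R.occ_def)
  have "{e\<in>good_pairs. c \<in> support e} \<subseteq> {c} \<union> {i. \<exists>k\<in>L.occ i. fst c \<in> L.blockers k i} \<times> {snd c}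
    \<union> {fst c} \<times> {j. \<exists>k\<in>R.occ j. snd c \<in> R.blockers k j}"
    by (auto simp: support_def)
  then have "card {e\<in>good_pairs. c \<in> support e} \<le> card ({c} \<union> {i. \<exists>k\<in>L.occ i. fst c \<in> L.blockers k i} \<times> {snd c}
    \<union> {fst c} \<times> {j. \<exists>k\<in>R.occ j. snd c \<in> R.blockers k j})"
    by (rule card_mono[rotated]) (use fin in auto)
  also have "\<dots> \<le> card {c} + card ({i. \<exists>k\<in>L.occ i. fst c \<in> L.blockers k i} \<times> {snd c})
    + card ({fst c} \<times> {j. \<exists>k\<in>R.occ j. snd c \<in> R.blockers k j})"
    by (meson card_Un_le order_trans add_mono order_refl)
  also have "\<dots> \<le> 1 + 2 * (K * K)"
    unfolding card_cartesian_product using L.card_blocked_le[of "fst c"] R.card_blocked_le[of "snd c"] by simp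
  finally show ?thesis .
qed

text \<open>No vertex blocks itself, so the cell \<open>e\<close> belongs to none of the sets to be
  hit, and its being a non-edge is an independent event of probability \<open>1 - p\<close>. The
  hitting events may overlap and are handled by Harris' inequality; each end of the pair contributes
  a factor of at least \<open>exp (- T)\<close>.\<close>

lemma prob_uncovered_ge:
  assumes e: "e \<in> good_pairs"
  shows "(1 - p) * exp (- 2 * T) \<le> measure_pmf.prob (random_subset p cells) {f. uncovered e f}"
proof -
  let ?P = "\<lambda>Q. measure_pmf.prob (random_subset p cells) {f. Q f}"
  obtain i j where ij: "e = (i, j)" by (cases e)
  have g: "i \<in> L.good (1 - p) T" "j \<in> R.good (1 - p) T" using e by (auto simp: good_pairs_def ij)
  then have n: "i < n" "j < n" by (auto simp: L.good_def R.good_def)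
  have fin: "finite cells" by (simp add: cells_def)
  \<comment> \<open>The lists of both sides are indexed by one disjoint sum, so that all hitting
    events are multiplied at once.\<close>
  define S where "S = (\<lambda>x. case x of Inl k \<Rightarrow> L.blockers k i \<times> {j} | Inr k \<Rightarrow> {i} \<times> R.blockers k j)"
  define hit where "hit = (\<lambda>f. \<forall>x\<in>L.occ i <+> R.occ j. \<exists>c\<in>S x. f c)"
  have q: "0 < 1 - p" "1 - p < 1" using p by auto
  have SI: "S x \<subseteq> cells" for x
    using L.blockers_subset L.set_A(1) R.blockers_subset R.set_A(1) n
    by (fastforce simp: S_def cells_def split: sum.splits)
  have "(\<Prod>x\<in>L.occ i <+> R.occ j. 1 - (1 - p) ^ card (S x)) \<le> ?P hit"
    unfolding hit_def using p by (intro prob_random_subset_hits fin SI) auto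
  moreover have "(\<Prod>x\<in>L.occ i <+> R.occ j. 1 - (1 - p) ^ card (S x)) =
      (\<Prod>k\<in>L.occ i. 1 - (1 - p) ^ card (L.blockers k i)) * (\<Prod>k\<in>R.occ j. 1 - (1 - p) ^ card (R.blockers k j))"
    by (simp add: prod.Plus S_def card_cartesian_product)
  moreover have "exp (- T) * exp (- T) \<le> \<dots>"
  proof -
    have pos: "0 < 1 - (1 - p) ^ c" if "c \<noteq> 0" for c :: nat
      using q that by (simp add: power_less_one_iff)
    have "exp (- T) \<le> (\<Prod>k\<in>L.occ i. 1 - (1 - p) ^ card (L.blockers k i))"
    proof -
      have "exp (- T) \<le> exp (\<Sum>k\<in>L.occ i. ln (1 - (1 - p) ^ card (L.blockers k i)))"
        using g(1) by (simp add: L.good_def sum_negf)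
      also have "\<dots> = (\<Prod>k\<in>L.occ i. 1 - (1 - p) ^ card (L.blockers k i))"
        unfolding exp_sum[OF L.finite_occ]
        by (intro prod.cong refl exp_ln pos) (use g(1) in \<open>auto simp: L.good_def\<close>)
      finally show ?thesis .
    qed
    moreover have "exp (- T) \<le> (\<Prod>k\<in>R.occ j. 1 - (1 - p) ^ card (R.blockers k j))"
    proof -
      have "exp (- T) \<le> exp (\<Sum>k\<in>R.occ j. ln (1 - (1 - p) ^ card (R.blockers k j)))"
        using g(2) by (simp add: R.good_def sum_negf)
      also have "\<dots> = (\<Prod>k\<in>R.occ j. 1 - (1 - p) ^ card (R.blockers k j))"
        unfolding exp_sum[OF R.finite_occ]
        by (intro prod.cong refl exp_ln pos) (use g(2) in \<open>auto simp: R.good_def\<close>)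
      finally show ?thesis .
    qed
    ultimately show ?thesis by (intro mult_mono) (auto intro: order_trans[OF exp_ge_zero])
  qed
  ultimately have hit: "exp (- 2 * T) \<le> ?P hit"
    by (simp flip: exp_add)
  have miss: "?P (\<lambda>f. \<not> f (i, j)) = 1 - p"
    using prob_random_subset_none[OF fin, of "{(i, j)}" p] n p by (simp add: cells_def)
  have "(i, j) \<notin> S x" for x
    using L.self_notin_blockers R.self_notin_blockers by (auto simp: S_def split: sum.splits)
  then have hit_upd: "hit (f((i, j) := v)) \<longleftrightarrow> hit f" for f v
    unfolding hit_def by (intro ball_cong bex_cong refl) (metis fun_upd_other)
  have "?P (\<lambda>f. \<not> f (i, j) \<and> hit f) = ?P (\<lambda>f. \<not> f (i, j)) * ?P hit"
  proof (rule prob_random_subset_indep[OF fin])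
    show "(\<forall>f v. (\<not> (f(x := v)) (i, j)) = (\<not> f (i, j))) \<or> (\<forall>f v. hit (f(x := v)) = hit f)" for x
      using hit_upd by (cases "x = (i, j)") auto
  qed (use p in auto)
  moreover have "uncovered e f \<longleftrightarrow> \<not> f (i, j) \<and> hit f" for f
  proof -
    have "hit f \<longleftrightarrow> (\<forall>k\<in>L.occ i. \<exists>c\<in>S (Inl k). f c) \<and> (\<forall>k\<in>R.occ j. \<exists>c\<in>S (Inr k). f c)"
      unfolding hit_def Plus_def ball_Un by simp
    then show ?thesis by (simp add: uncovered_def S_def ij)
  qed
  ultimately have "?P (uncovered e) = (1 - p) * ?P hit" using miss by simp
  then show ?thesis using hit q by simp
qed

text \<open>A cover forces every good pair to fail \<open>uncovered\<close>. Among the good pairs a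
  fraction \<open>1 / (1 + 2 * (real K)\<^sup>2)\<^sup>2\<close> has pairwise disjoint supports, and
  there the failures are independent, each of probability at most
  \<open>1 - c \<le> exp (- c)\<close>.\<close>

lemma prob_chain_cover_le:
  "measure_pmf.prob (random_subset p cells) {f. chain_cover n m A B f} \<le>
    exp (- ((1 - p) * exp (- 2 * T) *
      (real (card (L.good (1 - p) T)) * real (card (R.good (1 - p) T)) / (1 + 2 * (real K)\<^sup>2)\<^sup>2)))"
proof -
  let ?P = "\<lambda>Q. measure_pmf.prob (random_subset p cells) {f. Q f}"
  have fin: "finite cells" by (simp add: cells_def)
  have fgood: "finite good_pairs" by (simp add: good_pairs_def L.good_def R.good_def)
  obtain Q where Q: "Q \<subseteq> good_pairs" "disjoint_family_on support Q"
    "card good_pairs \<le> card Q * ((1 + 2 * (K * K)) * (1 + 2 * (K * K)))"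
  proof (rule exists_disjoint_subfamily[OF fgood, of support])
    show "finite (support e) \<and> card (support e) \<le> 1 + 2 * (K * K) \<and> support e \<noteq> {}" if "e \<in> good_pairs" for e
      using that finite_support card_support_le by (auto simp: support_def)
  qed (rule card_support_containing_le)
  define c where "c = (1 - p) * exp (- 2 * T)"
  have c: "0 \<le> c" using p by (simp add: c_def)
  have fQ: "finite Q" using Q(1) fgood finite_subset by blast
  have le: "?P (\<lambda>f. \<not> uncovered e f) \<le> exp (- c)" if "e \<in> Q" for e
  proof -
    have "{f. \<not> uncovered e f} = UNIV - {f. uncovered e f}" by auto
    then have "?P (\<lambda>f. \<not> uncovered e f) = 1 - ?P (uncovered e)"
      using measure_pmf.prob_compl[of "{f. uncovered e f}" "random_subset p cells"] by simp
    also have "\<dots> \<le> 1 - c" using prob_uncovered_ge[of e] that Q(1) by (auto simp: c_def)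
    also have "\<dots> \<le> exp (- c)" using exp_ge_add_one_self[of "- c"] by simp
    finally show ?thesis .
  qed
  have "?P (chain_cover n m A B) \<le> ?P (\<lambda>f. \<forall>e\<in>Q. \<not> uncovered e f)"
    using uncovered_imp_not_chain_cover Q(1) by (intro measure_pmf.finite_measure_mono) auto
  also have "\<dots> = (\<Prod>e\<in>Q. ?P (\<lambda>f. \<not> uncovered e f))"
    using p by (intro prob_random_subset_disjoint_supports[OF fin _ _ fQ _ Q(2)]) (auto simp: uncovered_support simp del: fun_upd_apply)
  also have "\<dots> \<le> (\<Prod>e\<in>Q. exp (- c))" using le by (intro prod_mono) auto
  also have "\<dots> = exp (- (c * real (card Q)))" by (simp flip: exp_of_nat_mult)
  also have "\<dots> \<le> exp (- (c * (real (card (L.good (1 - p) T)) * real (card (R.good (1 - p) T)) / (1 + 2 * (real K)\<^sup>2)\<^sup>2)))"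
  proof -
    have "real (card good_pairs) \<le> real (card Q) * (1 + 2 * (real K)\<^sup>2)\<^sup>2"
    proof -
      have "real (card good_pairs) \<le> real (card Q * ((1 + 2 * (K * K)) * (1 + 2 * (K * K))))"
        using Q(3) by (rule of_nat_mono)
      also have "\<dots> = real (card Q) * (1 + 2 * (real K)\<^sup>2)\<^sup>2"
        by (simp add: power2_eq_square algebra_simps)
      finally show ?thesis .
    qed
    moreover have "0 < 1 + 2 * (real K)\<^sup>2" by (rule add_pos_nonneg) auto
    ultimately have "real (card good_pairs) / (1 + 2 * (real K)\<^sup>2)\<^sup>2 \<le> real (card Q)"
      by (simp add: divide_le_eq)
    then have "c * (real (card good_pairs) / (1 + 2 * (real K)\<^sup>2)\<^sup>2) \<le> c * real (card Q)"
      using c by (rule mult_left_mono)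
    then show ?thesis by (simp add: good_pairs_def card_cartesian_product)
  qed
  finally show ?thesis by (simp add: c_def)
qed

end

section \<open>Union bounds and asymptotics\<close>

lemma prob_exists_le_sum:
  assumes "finite S"
  shows "measure_pmf.prob M {x. \<exists>s\<in>S. Q s x} \<le> (\<Sum>s\<in>S. measure_pmf.prob M {x. Q s x})"
proof -
  have "{x. \<exists>s\<in>S. Q s x} = (\<Union>s\<in>S. {x. Q s x})" by auto
  then show ?thesis using measure_pmf.finite_measure_subadditive_finite[OF assms, of "\<lambda>s. {x. Q s x}" M] by simp
qed

text \<open>A fixed rectangle is empty with probability at most \<open>exp (- (p * K * K))\<close>.
  The lower bound on \<open>K\<close> turns the exponent into at least \<open>4 * K * ln n\<close>,
  twice the \<open>2 * K * ln n\<close> needed for the number of rectangles.\<close>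

lemma prob_empty_rectangle_le:
  assumes p: "0 < p" "p < 1" and n: "0 < n" and K: "4 * (ln n)\<^sup>2 \<le> real K" "0 < ln (real n)" and pn: "p = 1 / ln (real n)"
  shows "measure_pmf.prob (random_subset p ({..<n} \<times> {..<n}))
      {f. \<exists>xs\<in>short_lists n K. \<exists>ys\<in>short_lists n K. \<forall>i\<in>set xs. \<forall>j\<in>set ys. \<not> f (i, j)}
    \<le> exp (- (2 * real K * ln n))"
proof -
  define I where "I = {..<n} \<times> {..<n}"
  let ?P = "\<lambda>Q. measure_pmf.prob (random_subset p I) {f. Q f}"
  define S where "S = short_lists n K \<times> short_lists n K"
  define Q where "Q = (\<lambda>(xs, ys) f. \<forall>x \<in> set xs \<times> set ys. \<not> (f :: nat \<times> nat \<Rightarrow> bool) x)"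
  have fS: "finite S" by (simp add: S_def finite_short_lists)
  have cS: "real (card S) \<le> exp (2 * real K * ln n)"
  proof -
    have "card S \<le> n ^ K * n ^ K"
      unfolding S_def card_cartesian_product by (intro mult_mono card_short_lists) auto
    then have "real (card S) \<le> real (n ^ K * n ^ K)" by (rule of_nat_mono)
    also have "\<dots> = exp (2 * real K * ln n)"
    proof -
      have "exp (2 * real K * ln n) = exp (ln n) ^ (K + K)"
        unfolding exp_of_nat_mult[symmetric] by simp
      then show ?thesis using n by (simp add: power_add)
    qed
    finally show ?thesis .
  qed
  have one: "?P (Q s) \<le> exp (- (4 * real K * ln n))" if "s \<in> S" for s
  proof -
    obtain xs ys where s: "s = (xs, ys)" by (cases s)
    have "set xs \<times> set ys \<subseteq> I" "card (set xs \<times> set ys) = K * K"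
      using that by (auto simp: S_def s short_lists_def I_def distinct_card card_cartesian_product)
    then have "?P (Q s) = (1 - p) ^ (K * K)"
      using prob_random_subset_none[of I "set xs \<times> set ys" p] p by (simp add: Q_def s I_def)
    also have "\<dots> \<le> exp (- p) ^ (K * K)"
      using p exp_ge_add_one_self[of "- p"] by (intro power_mono) auto
    also have "\<dots> = exp (- (p * (real K * real K)))"
      unfolding exp_of_nat_mult[symmetric] by (simp add: mult_ac)
    also have "\<dots> \<le> exp (- (4 * real K * ln n))"
    proof -
      have "4 * real K * ln n = p * (real K * (4 * (ln n)\<^sup>2))"
        using K(2) by (simp add: pn power2_eq_square)
      also have "\<dots> \<le> p * (real K * real K)" using K(1) p by (intro mult_left_mono) auto
      finally show ?thesis by simp
    qed
    finally show ?thesis .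
  qed
  have "?P (\<lambda>f. \<exists>s\<in>S. Q s f) \<le> (\<Sum>s\<in>S. ?P (Q s))" by (rule prob_exists_le_sum[OF fS])
  also have "\<dots> \<le> (\<Sum>s\<in>S. exp (- (4 * real K * ln n)))" by (rule sum_mono[OF one])
  also have "\<dots> \<le> exp (2 * real K * ln n) * exp (- (4 * real K * ln n))"
    using cS by (simp add: mult_right_mono)
  also have "\<dots> = exp (- (2 * real K * ln n))" by (simp flip: exp_add)
  also have "{f. \<exists>s\<in>S. Q s f} =
    {f. \<exists>xs\<in>short_lists n K. \<exists>ys\<in>short_lists n K. \<forall>i\<in>set xs. \<forall>j\<in>set ys. \<not> f (i, j)}"
    by (auto simp: S_def Q_def)
  finally show ?thesis by (simp add: I_def)
qed

text \<open>A union bound: \<open>2 * m\<close> lists of length \<open>K\<close> can be chosen in at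
  most \<open>exp (2 * K * m * ln n)\<close> ways. The 8 in the denominator collects
  \<open>1 - p \<ge> 1 / 2\<close> and the two factors \<open>n / 2\<close> for the good vertices of
  each side.\<close>

lemma prob_exists_chain_cover_le:
  assumes p: "0 < p" "p < 1 / 2" and n: "1 < n" and pn: "p = 1 / ln (real n)" and K: "0 < K" "K \<le> n"
    and m: "52 * m \<le> n"
  shows "measure_pmf.prob (random_subset p ({..<n} \<times> {..<n}))
      {f. \<exists>A B. (\<forall>k. A k \<in> short_lists n K) \<and> (\<forall>k. B k \<in> short_lists n K) \<and> chain_cover n m A B f}
    \<le> exp (2 * real K * real m * ln n - exp (- ln n / 4) * (real n)\<^sup>2 / (8 * (1 + 2 * (real K)\<^sup>2)\<^sup>2))"
proof -
  define I where "I = {..<n} \<times> {..<n}"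
  let ?P = "\<lambda>Q. measure_pmf.prob (random_subset p I) {f. Q f}"
  have L: "0 < ln (real n)" using n by simp
  \<comment> \<open>Setting the lists from index \<open>m\<close> on to a fixed default leaves
    finitely many families, while \<open>chain_cover n m\<close> is unaffected.\<close>
  define F where "F = (\<lambda>g k. if k < m then g k else [0..<K]) ` (\<Pi>\<^sub>E k\<in>{..<m}. short_lists n K)"
  have dflt: "[0..<K] \<in> short_lists n K" using K by (auto simp: short_lists_def)
  have F: "A k \<in> short_lists n K" if "A \<in> F" for A k
  proof -
    obtain g where g: "g \<in> (\<Pi>\<^sub>E k\<in>{..<m}. short_lists n K)" "A = (\<lambda>k. if k < m then g k else [0..<K])"
      using \<open>A \<in> F\<close> unfolding F_def by blast
    then show ?thesis using PiE_mem[OF g(1), of k] dflt by simp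
  qed
  have fF: "finite F" unfolding F_def by (intro finite_imageI finite_PiE finite_short_lists) auto
  have "card F \<le> card (\<Pi>\<^sub>E k\<in>{..<m}. short_lists n K)"
    unfolding F_def by (intro card_image_le finite_PiE finite_short_lists) auto
  also have "\<dots> = card (short_lists n K) ^ m" by (simp add: card_PiE)
  also have "\<dots> \<le> (n ^ K) ^ m" by (intro power_mono card_short_lists) auto
  finally have "real (card F) \<le> real ((n ^ K) ^ m)" by (rule of_nat_mono)
  also have "\<dots> = exp (real K * real m * ln n)"
  proof -
    have "exp (real K * real m * ln n) = exp (ln n) ^ (K * m)"
      unfolding exp_of_nat_mult[symmetric] by simp
    then show ?thesis using n by (simp add: power_mult)
  qed
  finally have cF: "real (card F) \<le> exp (real K * real m * ln n)" .
  define b where "b = exp (- ln n / 4) * (real n)\<^sup>2 / (8 * (1 + 2 * (real K)\<^sup>2)\<^sup>2)"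
  have one: "?P (\<lambda>f. chain_cover n m (fst s) (snd s) f) \<le> exp (- b)" if "s \<in> F \<times> F" for s
  proof -
    define T where "T = ln (real n) / 8"
    have T: "0 < T" using L by (simp add: T_def)
    have half: "1 / 2 \<le> 1 - p" using p by simp
    interpret chain_family_pair n m K "fst s" "snd s" p T
      using that F p K by unfold_locales auto
    have *: "real n / 2 \<le> real n - 2 * real m - real m * (3 / (1 - (1 - p))) / T"
    proof -
      have "real m * (3 / (1 - (1 - p))) / T = 24 * real m"
        using L by (simp add: pn T_def)
      moreover have "52 * real m \<le> real n" using m by linarith
      ultimately show ?thesis by linarith
    qed
    have g: "real n / 2 \<le> real (card (L.good (1 - p) T))" "real n / 2 \<le> real (card (R.good (1 - p) T))"
      using L.card_good_ge[of "1 - p" T] R.card_good_ge[of "1 - p" T] * p T by linarith+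
    have D: "0 < (1 + 2 * (real K)\<^sup>2)\<^sup>2"
      by (intro zero_less_power add_pos_nonneg) auto
    have "b = 1 / 2 * exp (- 2 * T) * ((real n / 2) * (real n / 2) / (1 + 2 * (real K)\<^sup>2)\<^sup>2)"
      by (simp add: b_def T_def power2_eq_square)
    also have "\<dots> \<le> (1 - p) * exp (- 2 * T) *
      (real (card (L.good (1 - p) T)) * real (card (R.good (1 - p) T)) / (1 + 2 * (real K)\<^sup>2)\<^sup>2)"
      using g half D by (intro mult_mono divide_right_mono) auto
    finally have "exp (- ((1 - p) * exp (- 2 * T) *
      (real (card (L.good (1 - p) T)) * real (card (R.good (1 - p) T)) / (1 + 2 * (real K)\<^sup>2)\<^sup>2))) \<le> exp (- b)" by simp
    then show ?thesis using prob_chain_cover_le unfolding cells_def I_def by linarith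
  qed
  have "?P (\<lambda>f. \<exists>A B. (\<forall>k. A k \<in> short_lists n K) \<and> (\<forall>k. B k \<in> short_lists n K) \<and> chain_cover n m A B f)
    \<le> ?P (\<lambda>f. \<exists>s\<in>F \<times> F. chain_cover n m (fst s) (snd s) f)"
  proof (intro measure_pmf.finite_measure_mono subsetI)
    fix f assume "f \<in> {f. \<exists>A B. (\<forall>k. A k \<in> short_lists n K) \<and> (\<forall>k. B k \<in> short_lists n K) \<and> chain_cover n m A B f}"
    then obtain A B where AB: "\<And>k. A k \<in> short_lists n K" "\<And>k. B k \<in> short_lists n K" "chain_cover n m A B f" by blast
    define c where "c = (\<lambda>(A :: nat \<Rightarrow> nat list) k. if k < m then A k else [0..<K])"
    have "c A \<in> F" if "\<And>k. A k \<in> short_lists n K" for A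
    proof -
      have "c A = (\<lambda>k. if k < m then restrict A {..<m} k else [0..<K])" by (auto simp: c_def)
      moreover have "restrict A {..<m} \<in> (\<Pi>\<^sub>E k\<in>{..<m}. short_lists n K)" using that by auto
      ultimately show ?thesis unfolding F_def by (rule image_eqI)
    qed
    moreover have "chain_cover n m (c A) (c B) f"
      using AB(3) unfolding chain_cover_def c_def by (simp cong: conj_cong)
    ultimately have "(c A, c B) \<in> F \<times> F \<and> chain_cover n m (fst (c A, c B)) (snd (c A, c B)) f" using AB by simp
    then show "f \<in> {f. \<exists>s\<in>F \<times> F. chain_cover n m (fst s) (snd s) f}" by blast
  qed auto
  also have "\<dots> \<le> (\<Sum>s\<in>F \<times> F. ?P (\<lambda>f. chain_cover n m (fst s) (snd s) f))"
    by (rule prob_exists_le_sum) (simp add: fF)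
  also have "\<dots> \<le> (\<Sum>s\<in>F \<times> F. exp (- b))" by (rule sum_mono[OF one])
  also have "\<dots> = (real (card F) * real (card F)) * exp (- b)" by (simp add: card_cartesian_product)
  also have "\<dots> \<le> (exp (real K * real m * ln n) * exp (real K * real m * ln n)) * exp (- b)"
    using cF by (intro mult_right_mono mult_mono) auto
  also have "\<dots> = exp (2 * real K * real m * ln n - b)" by (simp flip: exp_add)
  finally show ?thesis by (simp add: I_def b_def)
qed

lemma prob_many_edges_le:
  assumes p: "0 < p" "p < 1" and t: "4 * p * (real n)\<^sup>2 \<le> real t"
  shows "measure_pmf.prob (random_subset p ({..<n} \<times> {..<n}))
      {f. t \<le> card {x \<in> {..<n} \<times> {..<n}. f x}} \<le> exp (- (p * (real n)\<^sup>2))"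
proof -
  have "(1 + p) ^ (n * n) \<le> exp p ^ (n * n)"
    using p exp_ge_add_one_self[of p] by (intro power_mono) auto
  also have "\<dots> = exp (p * (real n)\<^sup>2)" 
    unfolding exp_of_nat_mult[symmetric] by (simp add: power2_eq_square mult_ac)
  finally have 1: "(1 + p) ^ (n * n) \<le> exp (p * (real n)\<^sup>2)" .
  \<comment> \<open>The factor 4 in the threshold is chosen so that \<open>2 ^ t\<close> exceeds the
    square of the bound on \<open>(1 + p) ^ (n * n)\<close>, as \<open>4 * (2 / 3)\<close> is more
    than 2.\<close>
  have "2 * (p * (real n)\<^sup>2) \<le> real t * (2 / 3)" using t p by simp
  also have "\<dots> \<le> real t * ln 2" using ln2_ge_two_thirds by (intro mult_left_mono) auto
  finally have "exp (2 * (p * (real n)\<^sup>2)) \<le> exp (real t * ln 2)" by simp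
  then have 2: "exp (2 * (p * (real n)\<^sup>2)) \<le> 2 ^ t" by (simp add: exp_of_nat_mult)
  have "measure_pmf.prob (random_subset p ({..<n} \<times> {..<n}))
      {f. t \<le> card {x \<in> {..<n} \<times> {..<n}. f x}} \<le> (1 + p) ^ (n * n) / 2 ^ t"
    using prob_random_subset_card_ge[of "{..<n} \<times> {..<n}" p t] p by (simp add: card_cartesian_product)
  also have "\<dots> \<le> exp (p * (real n)\<^sup>2) / exp (2 * (p * (real n)\<^sup>2))"
    using 1 2 by (intro frac_le) auto
  also have "\<dots> = exp (- (p * (real n)\<^sup>2))" by (simp flip: exp_diff)
  finally show ?thesis .
qed

text \<open>The deterministic part. The genus is at most \<open>8 * p * n\<^sup>2\<close>; as
  \<open>8 \<le> ln n\<close>, this is at most \<open>n\<^sup>2\<close>, so its logarithm is at most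
  \<open>2 * ln n\<close>, and this factor cancels the one in \<open>p\<close>. A boxicity of at
  most \<open>m / 2\<close> would produce a chain cover.\<close>

lemma boxicity_ge_if_no_chain_cover:
  assumes n: "8 \<le> ln (real n)" and p: "p = 1 / ln (real n)" and K: "K \<le> n" and m: "m = n div 52"
    and edges: "card {x \<in> {..<n} \<times> {..<n}. f x} < nat \<lceil>4 * p * (real n)\<^sup>2\<rceil>"
    and rect: "\<not> (\<exists>xs\<in>short_lists n K. \<exists>ys\<in>short_lists n K. \<forall>i\<in>set xs. \<forall>j\<in>set ys. \<not> f (i, j))"
    and cover: "\<not> (\<exists>A B. (\<forall>k. A k \<in> short_lists n K) \<and> (\<forall>k. B k \<in> short_lists n K) \<and> chain_cover n m A B f)"
  shows "1 / 208 / 2 * sqrt (real (Euler_genus (bipartite_graph n f)) * ln (real (Euler_genus (bipartite_graph n f))))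
    \<le> real (boxicity (bipartite_graph n f))"
proof -
  define g where "g = Euler_genus (bipartite_graph n f)"
  define b where "b = boxicity (bipartite_graph n f)"
  have "m < 2 * b"
  proof (rule ccontr)
    assume "\<not> m < 2 * b"
    then have "2 * boxicity (bipartite_graph n f) \<le> m" by (simp add: b_def)
    then obtain A B where "\<And>k. A k \<in> short_lists n K" "\<And>k. B k \<in> short_lists n K" "chain_cover n m A B f"
      using boxicity_imp_chain_cover[OF _ K rect] by metis
    then show False using cover by blast
  qed
  \<comment> \<open>Rounding is harmless: \<open>n < 52 * (m + 1)\<close> and
    \<open>m + 1 \<le> 2 * b\<close>.\<close>
  moreover have "n < 52 + n div 52 * 52" by (rule dividend_less_div_times) simp
  ultimately have "n \<le> 104 * b" unfolding m by linarith
  then have b: "real n / 104 \<le> real b" by linarith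
  obtain V E where VE: "bipartite_graph n f = (V, E)" by (cases "bipartite_graph n f")
  have fin: "finite_simple_graph (V, E)"
    unfolding VE[symmetric] by (auto simp: bipartite_graph_def card_insert_if)
  have "E = (\<lambda>(i, j). {Inl i, Inr j}) ` {x \<in> {..<n} \<times> {..<n}. f x}"
    using VE by (fastforce simp: bipartite_graph_def)
  then have "card E \<le> card {x \<in> {..<n} \<times> {..<n}. f x}" by (simp add: card_image_le)
  then have "g \<le> 2 * card {x \<in> {..<n} \<times> {..<n}. f x}"
    using Euler_genus_le_card_edges[OF fin] by (simp add: g_def VE)
  moreover have "real (card {x \<in> {..<n} \<times> {..<n}. f x}) < 4 * p * (real n)\<^sup>2"
    using edges by linarith
  ultimately have g: "real g \<le> 8 * p * (real n)\<^sup>2" by linarith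
  have "real g * ln (real g) \<le> (4 * real n)\<^sup>2"
  proof (cases "g = 0")
    case False
    have n0: "0 < real n" using n by (cases "n = 0") auto
    have "8 * p \<le> 1" using n by (simp add: p field_simps)
    then have "8 * p * (real n)\<^sup>2 \<le> 1 * (real n)\<^sup>2" by (intro mult_right_mono) auto
    then have "real g \<le> (real n)\<^sup>2" using g by linarith
    then have "ln (real g) \<le> ln ((real n)\<^sup>2)" using False n0 by (intro ln_mono) auto
    also have "\<dots> = 2 * ln (real n)" using n0 by (simp add: ln_realpow)
    finally have "real g * ln (real g) \<le> (8 * p * (real n)\<^sup>2) * (2 * ln (real n))"
      using g False by (intro mult_mono) (auto simp: p)
    also have "\<dots> = (4 * real n)\<^sup>2" using n by (simp add: p power2_eq_square)
    finally show ?thesis .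
  qed simp
  then have "sqrt (real g * ln (real g)) \<le> 4 * real n" by (simp add: real_le_lsqrt)
  then show ?thesis using b unfolding g_def[symmetric] b_def[symmetric] by linarith
qed

text \<open>The three error terms bound the probabilities of too many edges (\<open>E1\<close>), an
  empty \<open>K\<close> by \<open>K\<close> rectangle (\<open>E2\<close>) and a chain cover
  (\<open>E3\<close>).\<close>

lemma prob_boxicity_ge:
  assumes n: "8 \<le> ln (real n)" and K: "5 * (ln (real n))\<^sup>2 \<le> real n"
  defines "L \<equiv> ln (real n)"
  shows "1 - (exp (- ((real n)\<^sup>2 / L)) + exp (- (8 * L ^ 3)) +
      exp (10 * L ^ 3 * real n - exp (- L / 4) * (real n)\<^sup>2 / (8 * (1 + 50 * L ^ 4)\<^sup>2)))
    \<le> measure_pmf.prob (random_bipartite_graph n (1 / ln (real n)))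
       {G. 1 / 208 / 2 * sqrt (real (Euler_genus G) * ln (real (Euler_genus G))) \<le> real (boxicity G)}"
proof -
  have L: "8 \<le> L" using n by (simp add: L_def)
  define p where "p = 1 / L"
  have p: "0 < p" "p < 1" "p < 1 / 2" using L by (auto simp: p_def field_simps)
  have n1: "1 < n"
  proof (rule ccontr)
    assume "\<not> 1 < n"
    then have "n = 0 \<or> n = 1" by linarith
    then show False using n by auto
  qed
  \<comment> \<open>Rounding up adds less than \<open>1 \<le> L\<^sup>2\<close>, so \<open>K\<close>
    is at most \<open>5 * L\<^sup>2\<close>; hence the coefficients \<open>10 = 2 * 5\<close> and
    \<open>50 = 2 * 25\<close> in the third error term.\<close>
  define K where "K = nat \<lceil>4 * L\<^sup>2\<rceil>"
  have L2: "1 \<le> L\<^sup>2" using L by (simp add: one_le_power)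
  have K1: "4 * L\<^sup>2 \<le> real K" "real K \<le> 5 * L\<^sup>2" using L2 unfolding K_def by linarith+
  have K0: "0 < K" using K1 L2 by (cases "K = 0") auto
  have Kn: "K \<le> n" using K1(2) K unfolding L_def by linarith
  define m where "m = n div 52"
  define I where "I = {..<n} \<times> {..<n}"
  let ?P = "\<lambda>Q. measure_pmf.prob (random_subset p I) {f. Q f}"
  define E1 where "E1 = (\<lambda>f. nat \<lceil>4 * p * (real n)\<^sup>2\<rceil> \<le> card {x \<in> I. f x})"
  define E2 where "E2 = (\<lambda>f :: nat \<times> nat \<Rightarrow> bool. \<exists>xs\<in>short_lists n K. \<exists>ys\<in>short_lists n K. \<forall>i\<in>set xs. \<forall>j\<in>set ys. \<not> f (i, j))"
  define E3 where "E3 = (\<lambda>f. \<exists>A B. (\<forall>k. A k \<in> short_lists n K) \<and> (\<forall>k. B k \<in> short_lists n K) \<and> chain_cover n m A B f)"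
  define Q where "Q = (\<lambda>f. 1 / 208 / 2 * sqrt (real (Euler_genus (bipartite_graph n f)) * ln (real (Euler_genus (bipartite_graph n f))))
    \<le> real (boxicity (bipartite_graph n f)))"
  have e1: "?P E1 \<le> exp (- ((real n)\<^sup>2 / L))"
  proof -
    have "?P E1 \<le> exp (- (p * (real n)\<^sup>2))"
      unfolding E1_def I_def by (rule prob_many_edges_le[OF p(1,2)]) linarith
    then show ?thesis by (simp add: p_def)
  qed
  have e2: "?P E2 \<le> exp (- (8 * L ^ 3))"
  proof -
    have "?P E2 \<le> exp (- (2 * real K * ln n))"
      unfolding E2_def I_def using p n1 K1 L by (intro prob_empty_rectangle_le) (auto simp: p_def L_def)
    also have "\<dots> \<le> exp (- (8 * L ^ 3))"
    proof -
      have "8 * L ^ 3 = 2 * (4 * L\<^sup>2) * L" by (simp add: power2_eq_square power3_eq_cube)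
      also have "\<dots> \<le> 2 * real K * L" using K1(1) L by (intro mult_right_mono mult_left_mono) auto
      finally show ?thesis by (simp add: L_def)
    qed
    finally show ?thesis .
  qed
  have e3: "?P E3 \<le> exp (10 * L ^ 3 * real n - exp (- L / 4) * (real n)\<^sup>2 / (8 * (1 + 50 * L ^ 4)\<^sup>2))"
  proof -
    have "?P E3 \<le> exp (2 * real K * real m * ln n - exp (- ln n / 4) * (real n)\<^sup>2 / (8 * (1 + 2 * (real K)\<^sup>2)\<^sup>2))"
      unfolding E3_def I_def using p n1 K0 Kn
      by (intro prob_exists_chain_cover_le) (auto simp: p_def L_def m_def)
    also have "\<dots> \<le> exp (10 * L ^ 3 * real n - exp (- L / 4) * (real n)\<^sup>2 / (8 * (1 + 50 * L ^ 4)\<^sup>2))"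
    proof -
      have "2 * real K * real m * ln n \<le> 2 * (5 * L\<^sup>2) * real n * L"
        unfolding L_def[symmetric] using K1(2) L by (intro mult_mono) (auto simp: m_def)
      also have "\<dots> = 10 * L ^ 3 * real n" by (simp add: power2_eq_square power3_eq_cube)
      finally have 1: "2 * real K * real m * ln n \<le> 10 * L ^ 3 * real n" .
      have "(real K)\<^sup>2 \<le> (5 * L\<^sup>2)\<^sup>2" using K1(2) by (intro power_mono) auto
      then have "2 * (real K)\<^sup>2 \<le> 50 * L ^ 4" by (simp add: power_mult_distrib flip: power_mult)
      then have "(1 + 2 * (real K)\<^sup>2)\<^sup>2 \<le> (1 + 50 * L ^ 4)\<^sup>2" by (intro power_mono) auto
      moreover have "0 < (1 + 2 * (real K)\<^sup>2)\<^sup>2" by (intro zero_less_power add_pos_nonneg) auto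
      ultimately have 2: "exp (- L / 4) * (real n)\<^sup>2 / (8 * (1 + 50 * L ^ 4)\<^sup>2)
          \<le> exp (- L / 4) * (real n)\<^sup>2 / (8 * (1 + 2 * (real K)\<^sup>2)\<^sup>2)"
      proof (intro divide_left_mono mult_pos_pos mult_left_mono)
        have "0 < 1 + 50 * L ^ 4" using L by (intro add_pos_nonneg) auto
        then show "0 < (1 + 50 * L ^ 4)\<^sup>2" by simp
      qed auto
      show ?thesis using diff_mono[OF 1 2] unfolding L_def exp_le_cancel_iff .
    qed
    finally show ?thesis .
  qed
  have "UNIV \<subseteq> {f. Q f} \<union> ({f. E1 f} \<union> ({f. E2 f} \<union> {f. E3 f}))"
  proof
    fix f :: "nat \<times> nat \<Rightarrow> bool"
    show "f \<in> {f. Q f} \<union> ({f. E1 f} \<union> ({f. E2 f} \<union> {f. E3 f}))"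
    proof (cases "E1 f \<or> E2 f \<or> E3 f")
      case False
      have "p = 1 / ln (real n)" by (simp add: p_def L_def)
      moreover have "card {x \<in> {..<n} \<times> {..<n}. f x} < nat \<lceil>4 * p * (real n)\<^sup>2\<rceil>"
        using False unfolding E1_def I_def de_Morgan_disj not_le by blast
      ultimately have "Q f"
        unfolding Q_def
        by (rule boxicity_ge_if_no_chain_cover[OF n _ Kn m_def])
          (use False in \<open>unfold E2_def E3_def, blast+\<close>)
      then show ?thesis by simp
    qed blast
  qed
  then have "1 \<le> measure_pmf.prob (random_subset p I) ({f. Q f} \<union> ({f. E1 f} \<union> ({f. E2 f} \<union> {f. E3 f})))"
    using measure_pmf.finite_measure_mono[of UNIV "{f. Q f} \<union> ({f. E1 f} \<union> ({f. E2 f} \<union> {f. E3 f}))" "random_subset p I"]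
    by simp
  also have "\<dots> \<le> ?P Q + (?P E1 + (?P E2 + ?P E3))"
    by (intro order_trans[OF measure_Un_le] add_left_mono order_refl) auto
  finally have "1 - (?P E1 + ?P E2 + ?P E3) \<le> ?P Q" by simp
  moreover have "?P Q = measure_pmf.prob (random_bipartite_graph n (1 / ln (real n)))
       {G. 1 / 208 / 2 * sqrt (real (Euler_genus G) * ln (real (Euler_genus G))) \<le> real (boxicity G)}"
    unfolding random_bipartite_graph_def measure_map_pmf by (simp add: Q_def p_def L_def I_def vimage_def)
  ultimately show ?thesis using e1 e2 e3 by linarith
qed

lemma tendsto_error: "(\<lambda>n::nat. 1 - (exp (- ((real n)\<^sup>2 / ln (real n))) + exp (- (8 * ln (real n) ^ 3)) +
      exp (10 * ln (real n) ^ 3 * real n - exp (- ln (real n) / 4) * (real n)\<^sup>2 / (8 * (1 + 50 * ln (real n) ^ 4)\<^sup>2))))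
    \<longlonglongrightarrow> 1"
  by real_asymp

theorem mainTheorem6:
  shows "\<exists>c1::real. c1 > 0 \<and>
    (\<lambda>n::nat. measure_pmf.prob (random_bipartite_graph n (1 / ln (real n)))
       {G. real (boxicity G) \<ge>
             c1 / 2 * sqrt (real (Euler_genus G) * ln (real (Euler_genus G)))})
    \<longlonglongrightarrow> 1"
proof (intro exI conjI)
  \<comment> \<open>Boxicity at least \<open>n / 104\<close> and a square root of at most
    \<open>4 * n\<close> give the ratio 1/416, which is \<open>c1 / 2\<close>.\<close>
  show "0 < (1 / 208 :: real)" by simp
  have n: "\<forall>\<^sub>F n::nat in sequentially. 8 \<le> ln (real n)" by real_asymp
  have K: "\<forall>\<^sub>F n::nat in sequentially. 5 * (ln (real n))\<^sup>2 \<le> real n" by real_asymp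
  show "(\<lambda>n::nat. measure_pmf.prob (random_bipartite_graph n (1 / ln (real n)))
       {G. real (boxicity G) \<ge>
             1 / 208 / 2 * sqrt (real (Euler_genus G) * ln (real (Euler_genus G)))})
    \<longlonglongrightarrow> 1"
  proof (rule tendsto_sandwich[OF _ _ tendsto_error tendsto_const])
    show "\<forall>\<^sub>F n::nat in sequentially. 1 - (exp (- ((real n)\<^sup>2 / ln (real n))) + exp (- (8 * ln (real n) ^ 3)) +
      exp (10 * ln (real n) ^ 3 * real n - exp (- ln (real n) / 4) * (real n)\<^sup>2 / (8 * (1 + 50 * ln (real n) ^ 4)\<^sup>2)))
      \<le> measure_pmf.prob (random_bipartite_graph n (1 / ln (real n)))
       {G. real (boxicity G) \<ge>
             1 / 208 / 2 * sqrt (real (Euler_genus G) * ln (real (Euler_genus G)))}"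
      using n K by eventually_elim (rule prob_boxicity_ge)
  qed (simp add: measure_pmf.prob_le_1)
qed

end
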